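(* Let $A$ be a finite abelian group with $|A|\geq 7$ and $A\not\cong C_4\times C_2$. Then the lattice $\mathbb{L}(A)$ is extreme.
   Context: Let $A$ be a finite abelian group, written multiplicatively, with group rings $\mathbb{Z}A\subset\mathbb{R}A$. Regard $\mathbb{R}A$ as a Euclidean space with $\langle \sum_a x_a a,\sum_a y_a a\rangle=\sum_a x_a y_a$ and $\|x\|=\sqrt{\langle x,x\rangle}$. Let $\Delta A=\{\sum_a r_a a\in\mathbb{Z}A : \sum_a r_a=0\}$ be the augmentation ideal, let $\psi_A\colon\mathbb{Z}A\to A$ be the homomorphism $\psi_A(\sum_a k_a a)=\prod_a a^{k_a}$ (from the additive group of $\mathbb{Z}A$ to $A$), and let $\mathbb{L}(A)=\operatorname{Ker}(\psi_A)\cap\Delta A$, viewed as a full-rank lattice in the Euclidean space $V=\operatorname{span}_{\mathbb{R}}(\mathbb{L}(A))$. $C_n$ denotes the cyclic group of order $n$. A full-rank lattice $\Lambda$ in an $n$-dimensional Euclidean space $V$ is extreme if it is a local maximum of the packing density. Here the packing density of $\Lambda$ is, up to a constant depending only on $n$, $\operatorname{MinDist}(\Lambda)^n/\operatorname{vol}(V/\Lambda)$, where $\operatorname{MinDist}(\Lambda)=\min\{\|x\| : 0\neq x\in\Lambda\}$. Thus $\Lambda$ is extreme if there is a neighbourhood $U$ of the identity in $\mathrm{GL}(V)$ such that the packing density of $g\Lambda$ is at most that of $\Lambda$ for all $g\in U$. *)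

theory Defs
  imports
    "HOL-Analysis.Analysis"
    "HOL-Algebra.Elementary_Groups"
    "Jordan_Normal_Form.Determinant"
begin

definition int_span :: "'v::real_vector set \<Rightarrow> 'v set" where
  "int_span B = range (\<lambda>c :: 'v \<Rightarrow> int. \<Sum>b\<in>B. of_int (c b) *\<^sub>R b)"

definition lattice_basis :: "'v::euclidean_space list \<Rightarrow> 'v set \<Rightarrow> bool" where
  "lattice_basis bs \<Lambda> \<longleftrightarrow>
     distinct bs \<and> independent (set bs) \<and> int_span (set bs) = \<Lambda>"

definition full_rank_lattice :: "'v::euclidean_space set \<Rightarrow> 'v set \<Rightarrow> bool" where
  "full_rank_lattice V \<Lambda> \<longleftrightarrow> (\<exists>bs. lattice_basis bs \<Lambda> \<and> span (set bs) = V)"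

definition gram_matrix :: "'v::euclidean_space list \<Rightarrow> real mat" where
  "gram_matrix bs =
     Matrix.mat (length bs) (length bs) (\<lambda>(i, j). (bs ! i) \<bullet> (bs ! j))"

text \<open>The volume of \<open>V / \<Lambda>\<close>, that is, of the fundamental parallelepiped spanned by a basis
  of \<open>\<Lambda>\<close>. Two bases of \<open>\<Lambda>\<close> differ by an integer matrix of determinant 1 or -1, so the
  value does not depend on the choice.\<close>

definition covolume :: "'v::euclidean_space set \<Rightarrow> real" where
  "covolume \<Lambda> = sqrt (Determinant.det (gram_matrix (SOME bs. lattice_basis bs \<Lambda>)))"

text \<open>For a nonzero lattice the infimum is a minimum.\<close>

definition min_dist :: "'v::euclidean_space set \<Rightarrow> real" where
  "min_dist \<Lambda> = Inf (norm ` (\<Lambda> - {0}))"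

text \<open>The balls of radius \<open>min_dist \<Lambda> / 2\<close> around the points of \<open>\<Lambda>\<close> form the packing.\<close>

definition packing_density :: "'v::euclidean_space set \<Rightarrow> 'v set \<Rightarrow> real" where
  "packing_density V \<Lambda> =
     unit_ball_vol (real (dim V)) * (min_dist \<Lambda> / 2) ^ dim V / covolume \<Lambda>"

text \<open>An element of the general linear group of \<open>V\<close> is represented by any of its linear
  extensions to the ambient space; only its values on \<open>V\<close> are ever used.\<close>

definition GL :: "'v::euclidean_space set \<Rightarrow> ('v \<Rightarrow> 'v) set" where
  "GL V = {g. linear g \<and> bij_betw g V V}"

text \<open>The neighbourhoods of the identity in the general linear group of \<open>V\<close> are the sets
  containing a ball around the identity for the operator norm on \<open>V\<close>.\<close>

definition extreme :: "'v::euclidean_space set \<Rightarrow> 'v set \<Rightarrow> bool" where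
  "extreme V \<Lambda> \<longleftrightarrow>
     full_rank_lattice V \<Lambda> \<and>
     (\<exists>\<epsilon>>0. \<forall>g\<in>GL V.
        (\<forall>x\<in>V. norm (g x - x) \<le> \<epsilon> * norm x) \<longrightarrow>
        packing_density V (g ` \<Lambda>) \<le> packing_density V \<Lambda>)"

text \<open>Elements of the real and integral group rings of \<open>A\<close> are vectors indexed by the finite
  type \<open>'a\<close> that vanish outside \<open>carrier A\<close>. On these the inner product of \<open>real ^ 'a\<close> is the
  one that makes the group elements orthonormal. Only the additive structure of the group rings
  matters.\<close>

definition int_group_ring :: "('a::finite, 'm) monoid_scheme \<Rightarrow> (int ^ 'a) set" where
  "int_group_ring A = {k. \<forall>a. a \<notin> carrier A \<longrightarrow> vec_nth k a = 0}"

definition augmentation_ideal :: "('a::finite, 'm) monoid_scheme \<Rightarrow> (int ^ 'a) set" where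
  "augmentation_ideal A = {k \<in> int_group_ring A. (\<Sum>a\<in>carrier A. vec_nth k a) = 0}"

definition psi :: "('a::finite, 'm) monoid_scheme \<Rightarrow> int ^ 'a \<Rightarrow> 'a" where
  "psi A k = finprod A (\<lambda>a. a [^]\<^bsub>A\<^esub> vec_nth k a) (carrier A)"

definition psi_kernel :: "('a::finite, 'm) monoid_scheme \<Rightarrow> (int ^ 'a) set" where
  "psi_kernel A = {k \<in> int_group_ring A. psi A k = \<one>\<^bsub>A\<^esub>}"

definition group_lattice :: "('a::finite, 'm) monoid_scheme \<Rightarrow> (real ^ 'a) set" where
  "group_lattice A =
     (\<lambda>k. \<chi> a. real_of_int (vec_nth k a)) ` (psi_kernel A \<inter> augmentation_ideal A)"

end

theory Submission
  imports Defs "HOL-Algebra.Multiplicative_Group"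
begin

text \<open>
  The lattice is extreme because it is perfect and eutactic (Voronoi). A perturbation \<open>g\<close> of the
  lattice is measured by the numbers \<open>D(a, b)\<close>, the increments of the squared length of \<open>a - b\<close>.
  The minimal vectors are the \<open>a + b - c - d\<close> with \<open>ab = cd\<close>, and their increments are linear in \<open>D\<close>.

  Perfection: if all these increments vanish, then \<open>D = 0\<close>. Summing the relations
  \<open>D(a,b) + D(c,d) = D(a,c) + D(a,d) + D(b,c) + D(b,d)\<close> over all \<open>c\<close> expresses \<open>D(a, b)\<close> through the
  row sums of \<open>D\<close> whenever \<open>ab\<close> is not a square; the argument then depends on whether the subgroup
  of squares has index 1, 2 or more.

  Eutaxy: averaging \<open>D\<close> over translations reduces the trace of the perturbation to a sum over pairs
  \<open>(c, d)\<close>, and the trace dominates a positive multiple of the sum of all increments as soon as these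
  are nonnegative.

  Both facts together bound the trace of a perturbation that shortens no minimal vector from below by
  a multiple of its norm, so that the covolume cannot decrease to first order.
\<close>

section \<open>Finite abelian groups\<close>

text \<open>By polarisation a form on sum-zero vectors is determined by its values at differences of
  group elements, so \<open>D\<close> encodes the whole perturbation; its trace is the sum of all
  \<open>D a b\<close> divided by 2|A|. The obstacle in perfection is that the relation for ab = cd
  is available only when a \<noteq> b and c \<noteq> d. Summation over c therefore misses the square
  roots of ab. There are none if ab is not a square, and then D(a,b) = \<alpha>(a) + \<alpha>(b). A
  square has as many roots as the index of the subgroup of squares: for index at least 3 there are
  enough nonsquare products to finish by comparing cosets, for index 2 the values inside the two
  cosets need a separate invariant, and for index 1 no product is a nonsquare, so averages over
  pairs with a common midpoint take over. Index 4 is the value at which the comparison of \<alpha>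
  across cosets degenerates; a further argument needs a third square, and order 8 with exactly two
  squares is C4 x C2. Perfection becomes quantitative because an injective linear map on a
  finite-dimensional space is bounded below.\<close>

locale finite_comm_group = comm_group +
  assumes finite_carrier: "finite (carrier G)"
begin

lemma cancel_inv0:
  assumes "x \<in> carrier G" "y \<in> carrier G"
  shows "x \<otimes> (inv x \<otimes> y) = y" "inv x \<otimes> (x \<otimes> y) = y"
  using assms by (simp_all add: m_assoc [symmetric])

lemma cancel_inv1:
  assumes "x \<in> carrier G" "y \<in> carrier G"
  shows "x \<otimes> (y \<otimes> inv x) = y"
  using assms by (simp add: m_comm [of _ "inv x"] cancel_inv0)

lemma cancel_inv2:
  assumes "x \<in> carrier G" "y \<in> carrier G" "z \<in> carrier G"
  shows "x \<otimes> (y \<otimes> (inv x \<otimes> z)) = y \<otimes> z" "x \<otimes> (y \<otimes> (z \<otimes> inv x)) = y \<otimes> z"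
  using assms by (simp_all add: m_comm [of _ "inv x"] m_lcomm [of _ "inv x"] cancel_inv0)

lemma cancel_inv3:
  assumes "x \<in> carrier G" "y \<in> carrier G" "z \<in> carrier G" "w \<in> carrier G"
  shows "x \<otimes> (y \<otimes> (z \<otimes> (inv x \<otimes> w))) = y \<otimes> (z \<otimes> w)"
    "x \<otimes> (y \<otimes> (z \<otimes> (w \<otimes> inv x))) = y \<otimes> (z \<otimes> w)"
  using assms by (simp_all add: m_comm [of _ "inv x"] m_lcomm [of _ "inv x"] cancel_inv0)

text \<open>AC rewriting may leave \<open>x\<close> and \<open>inv x\<close> separated by up to
  three other factors, so there is one cancellation rule for each distance.\<close>

lemmas group_simps = m_ac inv_mult cancel_inv0 cancel_inv1 cancel_inv2 cancel_inv3

section \<open>Squares, involutions and sums over subgroups\<close>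

definition squares where "squares = (\<lambda>x. x \<otimes> x) ` carrier G"
text \<open>The conditions say that g \<noteq> gcd and gc \<noteq> gd for the two pairs with equal
  product. The cases \<open>c = \<one>\<close> and \<open>d = \<one>\<close> are kept: the vector is
  then zero, and sums over \<open>allowed\<close> have fewer exceptions.\<close>

definition "allowed = {(c, d) \<in> carrier G \<times> carrier G. c \<noteq> d \<and> c \<otimes> d \<noteq> \<one>}"
text \<open>The kernel of the squaring map, with \<open>\<one>\<close> included; its order is the
  index of \<open>squares\<close>.\<close>

definition involutions where "involutions = {x \<in> carrier G. x \<otimes> x = \<one>}"

lemma subgroup_squares: "subgroup squares G"
proof
  show "x \<otimes> y \<in> squares" if xy: "x \<in> squares" "y \<in> squares" for x y
  proof -
    obtain u where u: "u \<in> carrier G" "x = u \<otimes> u"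
      using xy(1) unfolding squares_def by auto
    obtain v where v: "v \<in> carrier G" "y = v \<otimes> v"
      using xy(2) unfolding squares_def by auto
    have "x \<otimes> y = (u \<otimes> v) \<otimes> (u \<otimes> v)" using u v by (simp add: group_simps)
    with u v show ?thesis unfolding squares_def by blast
  qed
  show "\<one> \<in> squares" unfolding squares_def by (rule image_eqI [of _ _ \<one>]) auto
  show "inv x \<in> squares" if x: "x \<in> squares" for x
  proof -
    obtain u where u: "u \<in> carrier G" "x = u \<otimes> u"
      using x unfolding squares_def by auto
    then have "inv x = inv u \<otimes> inv u" by (simp add: group_simps)
    with u show ?thesis unfolding squares_def by blast
  qed
qed (auto simp: squares_def)

lemma subgroup_involutions: "subgroup involutions G"
proof
  show "x \<otimes> y \<in> involutions" if "x \<in> involutions" "y \<in> involutions" for x y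
  proof -
    have "(x \<otimes> y) \<otimes> (x \<otimes> y) = (x \<otimes> x) \<otimes> (y \<otimes> y)"
      using that by (simp add: involutions_def group_simps)
    with that show ?thesis by (simp add: involutions_def)
  qed
  show "inv x \<in> involutions" if "x \<in> involutions" for x
    using that by (simp add: involutions_def inv_mult [symmetric])
qed (auto simp: involutions_def)

lemma sum_mult_subgroup:
  assumes "subgroup H G" "x \<in> H"
  shows "(\<Sum>y\<in>H. f (x \<otimes> y)) = sum f H"
proof -
  interpret H: subgroup H G by fact
  have [simp]: "y \<in> carrier G" if "y \<in> H" for y using that by auto
  show ?thesis
    by (rule sum.reindex_bij_witness [where i = "\<lambda>y. inv x \<otimes> y" and j = "\<lambda>y. x \<otimes> y"])
      (use assms in \<open>auto simp: cancel_inv0\<close>)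
qed

lemma sum_inv_subgroup:
  assumes "subgroup H G"
  shows "(\<Sum>y\<in>H. f (inv y)) = sum f H"
proof -
  interpret H: subgroup H G by fact
  show ?thesis
    by (rule sum.reindex_bij_witness [where i = "\<lambda>y. inv y" and j = "\<lambda>y. inv y"]) auto
qed

lemmas sum_mult = sum_mult_subgroup [OF subgroup_self]
lemmas sum_inv = sum_inv_subgroup [OF subgroup_self]

lemma sum_mult_inv:
  assumes "x \<in> carrier G"
  shows "(\<Sum>y\<in>carrier G. f (x \<otimes> inv y)) = sum f (carrier G)"
  using sum_inv [of "\<lambda>y. f (x \<otimes> y)"] sum_mult [OF assms, of f] by simp

text \<open>The fibres of the squaring homomorphism are cosets of its kernel: multiplication by one
  root \<open>r\<close> maps \<open>involutions\<close> onto the fibre.\<close>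

lemma card_square_roots:
  assumes "g \<in> squares"
  shows "card {x \<in> carrier G. x \<otimes> x = g} = card involutions"
proof -
  obtain r where r: "r \<in> carrier G" "g = r \<otimes> r" using assms unfolding squares_def by auto
  have "bij_betw (\<lambda>x. r \<otimes> x) involutions {x \<in> carrier G. x \<otimes> x = g}"
  proof (rule bij_betw_byWitness [where f' = "\<lambda>x. inv r \<otimes> x"])
    have "r \<otimes> x \<otimes> (r \<otimes> x) = r \<otimes> r \<otimes> (x \<otimes> x)" if "x \<in> carrier G" for x
      using that r by (simp add: group_simps)
    then show "(\<lambda>x. r \<otimes> x) ` involutions \<subseteq> {x \<in> carrier G. x \<otimes> x = g}"
      using r by (auto simp: involutions_def)
    have "inv r \<otimes> x \<otimes> (inv r \<otimes> x) = (x \<otimes> x) \<otimes> inv (r \<otimes> r)" if "x \<in> carrier G" for x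
      using that r by (simp add: group_simps)
    then show "(\<lambda>x. inv r \<otimes> x) ` {x \<in> carrier G. x \<otimes> x = g} \<subseteq> involutions"
      using r by (auto simp: involutions_def)
  qed (use r in \<open>auto simp: involutions_def cancel_inv0\<close>)
  then show ?thesis by (simp add: bij_betw_same_card)
qed

lemma sum_square:
  fixes f :: "'a \<Rightarrow> real"
  shows "(\<Sum>x\<in>carrier G. f (x \<otimes> x)) = card involutions * sum f squares"
proof -
  have "(\<Sum>x\<in>carrier G. f (x \<otimes> x)) = (\<Sum>g\<in>squares. \<Sum>x\<in>{x \<in> carrier G. x \<otimes> x = g}. f (x \<otimes> x))"
    unfolding squares_def by (rule sum.image_gen [OF finite_carrier])
  also have "\<dots> = (\<Sum>g\<in>squares. card involutions * f g)"
    by (rule sum.cong) (simp_all add: card_square_roots)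
  finally show ?thesis by (simp add: sum_distrib_left)
qed

lemma card_eq_involutions_squares: "card (carrier G) = card involutions * card squares"
proof -
  have "real (card (carrier G)) = real (card involutions * card squares)"
    using sum_square [of "\<lambda>_. 1"] by simp
  then show ?thesis by linarith
qed

lemma int_pow_mod:
  assumes "x \<in> carrier G" "x [^] (k::int) = \<one>"
  shows "x [^] (i mod k) = x [^] i"
proof -
  have "x [^] i = x [^] (i div k * k + i mod k)" by simp
  also have "\<dots> = x [^] (k * (i div k)) \<otimes> x [^] (i mod k)" using assms by (simp only: int_pow_mult mult.commute)
  also have "x [^] (k * (i div k)) = (x [^] k) [^] (i div k)" using int_pow_pow [OF assms(1), of k "i div k"] by simp
  finally show ?thesis using assms by simp
qed

text \<open>Translates the excluded isomorphism type into the two numbers that the perfection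
  argument sees. Squaring has a kernel of order 4 and takes only the values \<open>\<one>\<close>
  and one further \<open>z\<close>. A root \<open>x\<close> of \<open>z\<close> generates the factor
  of order 4, and a kernel element \<open>y\<close> outside {\<one>, z} generates the other
  factor.\<close>

lemma iso_C4_C2:
  assumes "card (carrier G) = 8" "card squares = 2"
  shows "G \<cong> integer_mod_group 4 \<times>\<times> integer_mod_group 2"
proof -
  let ?C = "integer_mod_group 4 \<times>\<times> integer_mod_group 2"
  have one: "\<one> \<in> squares" "\<one> \<in> involutions"
    using subgroup.one_closed [OF subgroup_squares] subgroup.one_closed [OF subgroup_involutions] by auto
  have "card (squares - {\<one>}) = 1" using assms(2) one by simp
  then obtain z where z: "squares - {\<one>} = {z}" using card_1_singletonE by blast
  then have zs: "z \<in> squares" "z \<noteq> \<one>" by auto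
  then obtain x where x: "x \<in> carrier G" "z = x \<otimes> x" by (auto simp: squares_def)
  have zc: "z \<in> carrier G" using x by simp
  have sq2: "w \<otimes> w = \<one> \<or> w \<otimes> w = z" if "w \<in> carrier G" for w
    using z that by (auto simp: squares_def)
  have zz: "z \<otimes> z = \<one>"
  proof (rule ccontr)
    assume "z \<otimes> z \<noteq> \<one>"
    then have "z \<otimes> z = z" using sq2 [OF zc] by simp
    then show False using zs zc by (metis l_cancel_one)
  qed
  have "card involutions = 4" using card_eq_involutions_squares assms by simp
  then have "\<not> involutions \<subseteq> {\<one>, z}"
    using card_mono [of "{\<one>, z}" involutions] by (auto simp: card_insert_if split: if_splits)
  then obtain y where y: "y \<in> carrier G" "y \<otimes> y = \<one>" "y \<noteq> \<one>" "y \<noteq> z" by (auto simp: involutions_def)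
  have px: "x [^] (2::int) = z" "x [^] (3::int) = x \<otimes> z" "x [^] (4::int) = \<one>"
    using int_pow_mult [OF x(1), of 1 1] int_pow_mult [OF x(1), of 1 2] int_pow_mult [OF x(1), of 2 2] x zz by simp_all
  have py: "y [^] (2::int) = \<one>" using int_pow_mult [OF y(1), of 1 1] y by simp
  define h where "h = (\<lambda>(i::int, j::int). x [^] i \<otimes> y [^] j)"
  have C: "group ?C" by (simp add: DirProd_group)
  have carC: "carrier ?C = {0..<4} \<times> {0..<2}" by (simp add: carrier_integer_mod_group)
  have hom: "h \<in> hom ?C G"
  proof (rule homI)
    fix u v assume "u \<in> carrier ?C" "v \<in> carrier ?C"
    then show "h (u \<otimes>\<^bsub>?C\<^esub> v) = h u \<otimes> h v"
      using int_pow_mod [OF x(1) px(3)] int_pow_mod [OF y(1) py] x(1) y(1)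
      by (auto simp: h_def int_pow_mult m_ac)
  qed (use x(1) y(1) in \<open>auto simp: h_def\<close>)
  interpret h: group_hom ?C G h by (unfold_locales) (use C hom in \<open>auto simp: group_def monoid_def group_axioms_def\<close>)
  have "kernel ?C G h \<subseteq> {\<one>\<^bsub>?C\<^esub>}"
  proof
    fix u assume "u \<in> kernel ?C G h"
    then obtain i j where u: "u = (i, j)" "0 \<le> i" "i < 4" "0 \<le> j" "j < 2" and 1: "x [^] i \<otimes> y [^] j = \<one>"
      by (auto simp: kernel_def carrier_integer_mod_group h_def)
    have "i = 0 \<or> i = 1 \<or> i = 2 \<or> i = 3" "j = 0 \<or> j = 1" using u by auto
    \<comment> \<open>Such a product squares to \<open>z\<close>, so it is not
      \<open>\<one>\<close>; this excludes the exponents with odd \<open>i\<close>.\<close>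
    moreover have nsq: "w \<otimes> v \<noteq> \<one>" if "w \<in> carrier G" "w \<otimes> w = z" "v \<in> carrier G" "v \<otimes> v = \<one>" for w v
    proof
      assume 0: "w \<otimes> v = \<one>"
      have "(w \<otimes> v) \<otimes> (w \<otimes> v) = (w \<otimes> w) \<otimes> (v \<otimes> v)" using that(1,3) by (simp only: m_ac m_closed)
      then show False using that zc zs 0 by simp
    qed
    have xz: "(x \<otimes> z) \<otimes> (x \<otimes> z) = z"
    proof -
      have "(x \<otimes> z) \<otimes> (x \<otimes> z) = (x \<otimes> x) \<otimes> (z \<otimes> z)" using x(1) zc by (simp only: m_ac m_closed)
      then show ?thesis using zz x zc by simp
    qed
    have "z \<otimes> y \<noteq> \<one>" using zz y zc by (metis inv_equality inv_inv)
    moreover have "x \<noteq> \<one>" "x \<otimes> z \<noteq> \<one>" "x \<otimes> y \<noteq> \<one>" "x \<otimes> z \<otimes> y \<noteq> \<one>"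
      using nsq [of x \<one>] nsq [of "x \<otimes> z" \<one>] nsq [of x y] nsq [of "x \<otimes> z" y] x y zc xz by auto
    ultimately have "i = 0 \<and> j = 0" using 1 x(1) y(1,3) zs(2) zc px by auto
    then show "u \<in> {\<one>\<^bsub>?C\<^esub>}" using u by simp
  qed
  moreover have "\<one>\<^bsub>?C\<^esub> \<in> kernel ?C G h" by (simp add: h_def kernel_def)
  ultimately have "kernel ?C G h = {\<one>\<^bsub>?C\<^esub>}" by blast
  then have inj: "inj_on h (carrier ?C)" using h.inj_iff_trivial_ker by simp
  have "h ` carrier ?C = carrier G"
  proof (rule card_subset_eq [OF finite_carrier])
    show "h ` carrier ?C \<subseteq> carrier G" by auto
    show "card (h ` carrier ?C) = card (carrier G)"
      using card_image [OF inj] assms by (simp add: carrier_integer_mod_group)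
  qed
  then have "h \<in> iso ?C G" using hom inj by (simp add: iso_def bij_betw_def)
  then have "?C \<cong> G" by (rule is_isoI)
  then show ?thesis by (rule group.iso_sym [OF C])
qed

end

section \<open>Eutaxy\<close>

text \<open>A quadratic form \<open>q\<close> on the sum-zero part of the real group ring is encoded by
  \<open>D a b = q(a - b)\<close>, of which only symmetry and the zero diagonal are retained.\<close>

locale sym_form = finite_comm_group +
  fixes D :: "'a \<Rightarrow> 'a \<Rightarrow> real"
  assumes D_sym: "\<lbrakk>a \<in> carrier G; b \<in> carrier G\<rbrakk> \<Longrightarrow> D a b = D b a"
    and D_diag: "a \<in> carrier G \<Longrightarrow> D a a = 0"
begin

definition n :: real where "n = card (carrier G)"
definition s where "s a = (\<Sum>b\<in>carrier G. D a b)"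
definition \<sigma> where "\<sigma> = (\<Sum>a\<in>carrier G. s a)"
definition m :: real where "m = card squares"

lemma n_pos: "n > 0"
  unfolding n_def using finite_carrier by (simp add: card_gt_0_iff) blast

lemma square_mem [simp]: "a \<in> carrier G \<Longrightarrow> a \<otimes> a \<in> squares" by (auto simp: squares_def)

lemma squares_carrier: "h \<in> squares \<Longrightarrow> h \<in> carrier G"
  by (auto simp: squares_def)

lemma m_pos: "m \<ge> 1"
proof -
  have "finite squares" "\<one> \<otimes> \<one> \<in> squares" using finite_carrier square_mem [of \<one>] by (simp_all add: squares_def)
  then have "card squares > 0" using card_gt_0_iff by blast
  then show ?thesis unfolding m_def by linarith
qed

lemma card_involutions: "n = real (card involutions) * m"
  using card_eq_involutions_squares by (simp add: n_def m_def)

section \<open>Averages over translations\<close>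

text \<open>Total increment over all translates of the difference \<one> - h. Averaging makes the
  form translation invariant, so a function of one group element replaces the function
  \<open>D\<close> of two.\<close>

definition \<rho> where "\<rho> h = (\<Sum>g\<in>carrier G. D g (g \<otimes> h))"

text \<open>\<open>\<Psi> g c d\<close> is the value of \<open>q\<close> at the lattice vector \<open>g(1 - c)(1 - d)\<close>, which is
  minimal for \<open>c \<noteq> \<one> \<noteq> d\<close> and zero otherwise, provided that \<open>(c, d)\<close> is allowed.\<close>

definition \<Psi> where "\<Psi> g c d = D g (g \<otimes> c) + D g (g \<otimes> d) + D (g \<otimes> (c \<otimes> d)) (g \<otimes> c) + D (g \<otimes> (c \<otimes> d)) (g \<otimes> d)
   - D g (g \<otimes> (c \<otimes> d)) - D (g \<otimes> c) (g \<otimes> d)"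
definition \<Psi>_sum where "\<Psi>_sum c d = (\<Sum>g\<in>carrier G. \<Psi> g c d)"

lemma \<rho>_one [simp]: "\<rho> \<one> = 0"
  by (simp add: \<rho>_def D_diag)

lemma \<rho>_shift:
  assumes "x \<in> carrier G" "y \<in> carrier G"
  shows "(\<Sum>g\<in>carrier G. D (g \<otimes> x) (g \<otimes> y)) = \<rho> (inv x \<otimes> y)"
proof -
  have "(\<Sum>g\<in>carrier G. D (g \<otimes> x) (g \<otimes> y)) = (\<Sum>g\<in>carrier G. D (x \<otimes> g) (x \<otimes> g \<otimes> (inv x \<otimes> y)))"
    by (rule sum.cong) (use assms in \<open>auto simp: group_simps\<close>)
  also have "\<dots> = \<rho> (inv x \<otimes> y)"
    unfolding \<rho>_def by (rule sum_mult [OF assms(1)])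
  finally show ?thesis .
qed

lemma \<rho>_inv:
  assumes "x \<in> carrier G"
  shows "\<rho> (inv x) = \<rho> x"
proof -
  have "\<rho> (inv x) = (\<Sum>g\<in>carrier G. D (g \<otimes> x) (g \<otimes> \<one>))" using \<rho>_shift [of x \<one>] assms by simp
  also have "\<dots> = \<rho> x" unfolding \<rho>_def by (rule sum.cong) (use assms D_sym in auto)
  finally show ?thesis .
qed

lemma sum_\<rho>: "sum \<rho> (carrier G) = \<sigma>"
proof -
  have "sum \<rho> (carrier G) = (\<Sum>g\<in>carrier G. \<Sum>h\<in>carrier G. D g (g \<otimes> h))"
    unfolding \<rho>_def by (rule sum.swap)
  also have "\<dots> = \<sigma>"
    unfolding \<sigma>_def s_def by (rule sum.cong [OF refl]) (rule sum_mult)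
  finally show ?thesis .
qed

text \<open>The six terms of \<open>\<Psi>\<close> join points whose quotients are c, d, cd and c/d
  up to inversion, and \<open>\<rho>\<close> is even. What remains is the defect of
  \<open>\<rho>\<close> in the parallelogram law.\<close>

lemma \<Psi>_sum_eq:
  assumes "c \<in> carrier G" "d \<in> carrier G"
  shows "\<Psi>_sum c d = 2 * \<rho> c + 2 * \<rho> d - \<rho> (c \<otimes> d) - \<rho> (c \<otimes> inv d)"
proof -
  have "\<Psi>_sum c d = \<rho> c + \<rho> d + \<rho> (inv (c \<otimes> d) \<otimes> c) + \<rho> (inv (c \<otimes> d) \<otimes> d) - \<rho> (c \<otimes> d) - \<rho> (inv c \<otimes> d)"
    using assms \<rho>_shift [of "c \<otimes> d" c] \<rho>_shift [of "c \<otimes> d" d] \<rho>_shift [of c d]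
    by (simp add: \<Psi>_sum_def \<Psi>_def sum.distrib sum_subtractf flip: \<rho>_def)
  also have "inv (c \<otimes> d) \<otimes> c = inv d" using assms by (simp add: group_simps)
  also have "inv (c \<otimes> d) \<otimes> d = inv c" using assms by (simp add: group_simps)
  also have "inv c \<otimes> d = inv (c \<otimes> inv d)" using assms by (simp add: inv_mult m_comm)
  finally show ?thesis using assms by (simp add: \<rho>_inv)
qed

lemma sum_\<Psi>_sum:
  assumes "c \<in> carrier G"
  shows "(\<Sum>d\<in>carrier G. \<Psi>_sum c d) = 2 * n * \<rho> c"
  using sum_mult [OF assms, of \<rho>] sum_mult_inv [OF assms, of \<rho>] assms
  by (simp add: \<Psi>_sum_eq sum.distrib sum_subtractf n_def flip: sum_distrib_left cong: sum.cong)

text \<open>For c in a subgroup and d running over all of it, the sums of \<rho>(cd) and \<rho>(c/d)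
  cancel twice the sum of \<rho>(d), and only \<rho>(c) survives. This is used for \<open>K\<close>
  and for the whole group, and the results are subtracted.\<close>

lemma sum_\<Psi>_sum_subgroup:
  assumes H: "subgroup K G"
  shows "(\<Sum>c\<in>K. \<Sum>d\<in>carrier G - K. \<Psi>_sum c d) = 2 * (n - card K) * sum \<rho> K"
proof -
  interpret K: subgroup K G by fact
  have K: "K \<subseteq> carrier G" "finite K" using finite_carrier K.subset finite_subset by auto
  have "(\<Sum>c\<in>K. \<Sum>d\<in>K. \<Psi>_sum c d) = (\<Sum>c\<in>K. 2 * card K * \<rho> c)"
  proof (rule sum.cong [OF refl])
    fix c assume c: "c \<in> K"
    have "(\<Sum>d\<in>K. \<rho> (c \<otimes> inv d)) = sum \<rho> K"
      using sum_inv_subgroup [OF H, of "\<lambda>d. \<rho> (c \<otimes> d)"] sum_mult_subgroup [OF H c, of \<rho>] by simp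
    moreover have "(\<Sum>d\<in>K. \<Psi>_sum c d) = (\<Sum>d\<in>K. 2 * \<rho> c + 2 * \<rho> d - \<rho> (c \<otimes> d) - \<rho> (c \<otimes> inv d))"
      by (rule sum.cong) (use c K in \<open>auto simp: \<Psi>_sum_eq\<close>)
    ultimately show "(\<Sum>d\<in>K. \<Psi>_sum c d) = 2 * card K * \<rho> c"
      using sum_mult_subgroup [OF H c, of \<rho>]
      by (simp add: sum.distrib sum_subtractf flip: sum_distrib_left)
  qed
  moreover have "(\<Sum>c\<in>K. \<Sum>d\<in>carrier G. \<Psi>_sum c d) = (\<Sum>c\<in>K. 2 * n * \<rho> c)"
    by (rule sum.cong) (use sum_\<Psi>_sum in auto)
  ultimately show ?thesis
    using finite_carrier K by (simp add: sum_diff sum_subtractf algebra_simps flip: sum_distrib_left)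
qed

text \<open>Inclusion and exclusion: the forbidden pairs are the diagonal d = c and the antidiagonal
  d = inv c, which carry equal sums and meet in the involutions. Along either of them the term
  \<rho>(cc) hits each square \<open>card involutions\<close> times.\<close>

lemma sum_\<Psi>_sum_allowed:
  "(\<Sum>(c, d)\<in>allowed. \<Psi>_sum c d)
     = (2 * n - 8) * \<sigma> + 2 * real (card involutions) * sum \<rho> squares + 4 * sum \<rho> involutions"
proof -
  let ?S = "carrier G"
  define A where "A = (\<lambda>c. (c, c)) ` ?S" 
  define B where "B = (\<lambda>c. (c, inv c)) ` ?S"
  define P where "P = (\<lambda>(c, d). \<Psi>_sum c d)"
  have diag: "\<Psi>_sum c c = 4 * \<rho> c - \<rho> (c \<otimes> c)" "\<Psi>_sum c (inv c) = 4 * \<rho> c - \<rho> (c \<otimes> c)" if "c \<in> ?S" for c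
    using that by (simp_all add: \<Psi>_sum_eq \<rho>_inv)
  have sumd: "(\<Sum>c\<in>?S. 4 * \<rho> c - \<rho> (c \<otimes> c)) = 4 * \<sigma> - card involutions * sum \<rho> squares"
    by (simp add: sum_subtractf sum_square sum_\<rho> flip: sum_distrib_left)
  have A: "sum P A = 4 * \<sigma> - card involutions * sum \<rho> squares"
    unfolding A_def sumd [symmetric] by (subst sum.reindex) (auto simp: inj_on_def P_def diag)
  have B: "sum P B = 4 * \<sigma> - card involutions * sum \<rho> squares"
    unfolding B_def sumd [symmetric] by (subst sum.reindex) (auto simp: inj_on_def P_def diag)
  have AB: "A \<inter> B = (\<lambda>c. (c, c)) ` involutions"
  proof -
    have "inv c = c \<longleftrightarrow> c \<otimes> c = \<one>" if "c \<in> ?S" for c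
      using that by (metis inv_equality r_inv)
    then show ?thesis unfolding A_def B_def involutions_def by force
  qed
  have "sum P (A \<inter> B) = 4 * sum \<rho> involutions"
    unfolding AB sum_distrib_left
    by (subst sum.reindex) (auto simp: inj_on_def P_def diag involutions_def intro!: sum.cong)
  then have U: "sum P (A \<union> B) = 8 * \<sigma> - 2 * card involutions * sum \<rho> squares - 4 * sum \<rho> involutions"
    using sum.union_inter [of A B P] A B finite_carrier by (simp add: A_def B_def algebra_simps)
  have "c \<otimes> d = \<one> \<longleftrightarrow> d = inv c" if "c \<in> ?S" "d \<in> ?S" for c d
    using that by (metis inv_equality m_comm r_inv)
  then have "allowed = ?S \<times> ?S - (A \<union> B)" unfolding allowed_def A_def B_def by auto
  moreover have "A \<union> B \<subseteq> ?S \<times> ?S" by (auto simp: A_def B_def)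
  ultimately have "sum P allowed = sum P (?S \<times> ?S) - sum P (A \<union> B)"
    using finite_carrier by (simp add: sum_diff)
  moreover have "sum P (?S \<times> ?S) = 2 * n * \<sigma>"
  proof -
    have "sum P (?S \<times> ?S) = (\<Sum>c\<in>?S. \<Sum>d\<in>?S. \<Psi>_sum c d)" unfolding P_def by (rule sum.cartesian_product [symmetric])
    also have "\<dots> = (\<Sum>c\<in>?S. 2 * n * \<rho> c)" by (rule sum.cong) (use sum_\<Psi>_sum in auto)
    finally show ?thesis by (simp add: sum_\<rho> flip: sum_distrib_left)
  qed
  ultimately show ?thesis using U by (simp add: P_def algebra_simps)
qed

section \<open>The trace dominates the increments of the minimal vectors\<close>

context
  assumes nonneg: "\<And>g c d. \<lbrakk>g \<in> carrier G; (c, d) \<in> allowed\<rbrakk> \<Longrightarrow> \<Psi> g c d \<ge> 0"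
begin

lemma \<Psi>_sum_nonneg: "(c, d) \<in> allowed \<Longrightarrow> \<Psi>_sum c d \<ge> 0"
  unfolding \<Psi>_sum_def using nonneg by (auto intro: sum_nonneg)

lemma \<Psi>_sum_sym: "\<lbrakk>c \<in> carrier G; d \<in> carrier G\<rbrakk> \<Longrightarrow> \<Psi>_sum c d = \<Psi>_sum d c"
  using \<rho>_inv [of "c \<otimes> inv d"] by (simp add: \<Psi>_sum_eq inv_mult m_comm)

text \<open>A pair with exactly one member in \<open>K\<close> is allowed, since c = d or cd =
  \<one> would put both members inside or both outside. These pairs form a part of a nonnegative
  sum, and their contribution is known from \<open>sum_\<Psi>_sum_subgroup\<close>.\<close>

lemma sum_\<rho>_subgroup_bound:
  assumes "subgroup K G"
  shows "4 * (n - card K) * sum \<rho> K \<le> (\<Sum>(c, d)\<in>allowed. \<Psi>_sum c d)"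
proof -
  interpret K: subgroup K G by fact
  let ?C = "carrier G - K"
  have K: "K \<subseteq> carrier G" "finite K" using finite_carrier K.subset finite_subset by auto
  have fin: "finite ?C" "finite allowed"
    using finite_carrier finite_subset [of allowed "carrier G \<times> carrier G"] by (auto simp: allowed_def)
  have eq: "(\<Sum>(c, d)\<in>K \<times> ?C. \<Psi>_sum c d) = 2 * (n - card K) * sum \<rho> K"
    using sum_\<Psi>_sum_subgroup [OF assms] sum.cartesian_product [of \<Psi>_sum ?C K] by simp
  have "(\<Sum>(c, d)\<in>?C \<times> K. \<Psi>_sum c d) = (\<Sum>(c, d)\<in>K \<times> ?C. \<Psi>_sum c d)"
    by (rule sum.reindex_bij_witness [where i = prod.swap and j = prod.swap]) (use K \<Psi>_sum_sym in auto)
  moreover have "(\<Sum>(c, d)\<in>K \<times> ?C \<union> ?C \<times> K. \<Psi>_sum c d)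
      = (\<Sum>(c, d)\<in>K \<times> ?C. \<Psi>_sum c d) + (\<Sum>(c, d)\<in>?C \<times> K. \<Psi>_sum c d)"
    by (rule sum.union_disjoint) (use K fin in auto)
  ultimately have "4 * (n - card K) * sum \<rho> K = (\<Sum>(c, d)\<in>K \<times> ?C \<union> ?C \<times> K. \<Psi>_sum c d)"
    using eq by simp
  also have "\<dots> \<le> (\<Sum>(c, d)\<in>allowed. \<Psi>_sum c d)"
  proof (rule sum_mono2 [OF fin(2)])
    have *: "d \<otimes> c \<noteq> \<one>" if "c \<in> K" "d \<in> ?C" for c d
    proof
      assume "d \<otimes> c = \<one>"
      then have "d = inv c" using that by (simp add: inv_equality)
      then show False using that by simp
    qed
    then have "c \<otimes> d \<noteq> \<one>" if "c \<in> K" "d \<in> ?C" for c d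
      using that by (simp add: m_comm)
    with * show "K \<times> ?C \<union> ?C \<times> K \<subseteq> allowed" using K by (auto simp: allowed_def)
  qed (use \<Psi>_sum_nonneg in auto)
  finally show ?thesis .
qed

text \<open>The total T is (2n - 8) \<sigma> plus two terms with sums of \<open>\<rho>\<close> over
  the squares and the involutions. If both subgroups are nontrivial, these terms are at most T/2 and
  2T/7, and 1 - 1/2 - 2/7 = 3/14 is the origin of the constant 28/3. If squaring is bijective or
  trivial, the two sums are \<sigma> and 0 in some order, and T is a multiple of \<sigma>.\<close>

lemma eutactic_bound:
  assumes n: "n \<ge> 7"
  shows "3 * (\<Sum>(c, d)\<in>allowed. \<Psi>_sum c d) \<le> 28 * n * \<sigma>" "\<sigma> \<ge> 0"
proof -
  define T where "T = (\<Sum>(c, d)\<in>allowed. \<Psi>_sum c d)"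
  define t where "t = real (card involutions)"
  have T: "T \<ge> 0" unfolding T_def using \<Psi>_sum_nonneg by (auto intro: sum_nonneg)
  have eq: "T = (2 * n - 8) * \<sigma> + 2 * t * sum \<rho> squares + 4 * sum \<rho> involutions"
    unfolding T_def t_def using sum_\<Psi>_sum_allowed by simp
  have b1: "4 * (n - t) * sum \<rho> involutions \<le> T"
    unfolding T_def t_def by (rule sum_\<rho>_subgroup_bound [OF subgroup_involutions])
  have b2: "4 * (n - m) * sum \<rho> squares \<le> T"
    unfolding T_def m_def by (rule sum_\<rho>_subgroup_bound [OF subgroup_squares])
  have nt: "n = t * m" unfolding t_def by (rule card_involutions)
  have t1: "t \<ge> 1"
  proof -
    have "t \<noteq> 0" using nt n by auto
    then show ?thesis unfolding t_def by simp
  qed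
  have T\<sigma>: "T * (3 / 14) \<le> 2 * n * \<sigma>"
  proof -
    consider "t = 1" | "m = 1" "t \<noteq> 1" | "t \<ge> 2" "m \<ge> 2"
    proof -
      have *: "real k = 1 \<or> real k \<ge> 2" if "real k \<ge> 1" for k :: nat
      proof -
        have "k = 1 \<or> k \<ge> 2" using that by linarith
        then show ?thesis by auto
      qed
      have "m = 1 \<or> m \<ge> 2" "t = 1 \<or> t \<ge> 2"
        using * [of "card squares"] * [of "card involutions"] m_pos t1 by (simp_all add: m_def t_def)
      then show thesis using that by blast
    qed
    then show ?thesis
    proof cases
      case 1
      then have "squares = carrier G"
        using nt card_subset_eq [OF finite_carrier, of squares] squares_carrier by (auto simp: n_def m_def)
      then have "T = (2 * n - 6) * \<sigma> + 4 * sum \<rho> involutions" using eq 1 sum_\<rho> by (simp add: algebra_simps)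
      moreover have "involutions = {\<one>}"
      proof -
        have "card involutions = 1" using 1 by (simp add: t_def)
        moreover have "\<one> \<in> involutions" by (simp add: involutions_def)
        ultimately show ?thesis by (metis card_1_singletonE singletonD)
      qed
      ultimately have T': "T = (2 * n - 6) * \<sigma>" by simp
      have "\<sigma> \<ge> 0" using T T' n by (simp add: zero_le_mult_iff)
      then have "T \<le> 2 * n * \<sigma>" unfolding T' by (intro mult_right_mono) auto
      then show ?thesis using T by linarith
    next
      case 2
      then have "card involutions = card (carrier G)" using nt by (simp add: n_def t_def)
      moreover have "involutions \<subseteq> carrier G" by (auto simp: involutions_def)
      ultimately have "involutions = carrier G" using card_subset_eq [OF finite_carrier] by blast
      moreover have "squares = {\<one>}"
      proof -
        have "card squares = 1" using 2 by (simp add: m_def)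
        moreover have "\<one> \<in> squares" using square_mem [of \<one>] by simp
        ultimately show ?thesis by (metis card_1_singletonE singletonD)
      qed
      ultimately have T': "T = (2 * n - 4) * \<sigma>" using eq sum_\<rho> by (simp add: algebra_simps)
      have "\<sigma> \<ge> 0" using T T' n by (simp add: zero_le_mult_iff)
      then have "T \<le> 2 * n * \<sigma>" unfolding T' by (intro mult_right_mono) auto
      then show ?thesis using T by linarith
    next
      case 3
      have n2: "n \<ge> 2 * m" "n \<ge> 2 * t"
        using 3 mult_right_mono [of 2 t m] mult_left_mono [of 2 m t] by (auto simp: nt)
      \<comment> \<open>Here n - t \<ge> n/2 \<ge> 7/2, so the subgroup bound has a factor of at
        least 14. A negative sum satisfies the estimate trivially.\<close>
      have r1: "4 * sum \<rho> involutions \<le> 2 / 7 * T"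
      proof (cases "sum \<rho> involutions \<ge> 0")
        case True
        have "4 * (7 / 2) * sum \<rho> involutions \<le> 4 * (n - t) * sum \<rho> involutions"
          using True n n2 by (intro mult_right_mono mult_left_mono) auto
        then show ?thesis using b1 by simp
      qed (use T in auto)
      have r2: "2 * t * sum \<rho> squares \<le> 1 / 2 * T"
      proof (cases "sum \<rho> squares \<ge> 0")
        case True
        \<comment> \<open>Because n = tm, this amounts to (t - 1)(m - 1) \<ge> 1.\<close>
        have "t \<le> n - m"
        proof -
          have "(t - 1) * (m - 1) \<ge> 1 * 1" using 3 by (intro mult_mono) auto
          then show ?thesis by (simp add: nt algebra_simps)
        qed
        then have "4 * t * sum \<rho> squares \<le> 4 * (n - m) * sum \<rho> squares"
          using True by (intro mult_right_mono mult_left_mono) auto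
        then show ?thesis using b2 by simp
      qed (use T t1 in \<open>auto simp: mult_nonneg_nonpos intro: order_trans [of _ 0]\<close>)
      have T': "T * (3 / 14) \<le> (2 * n - 8) * \<sigma>" using eq r1 r2 by linarith
      then have "0 \<le> (2 * n - 8) * \<sigma>" using T by linarith
      then have "\<sigma> \<ge> 0" using n by (simp add: zero_le_mult_iff)
      then have "(2 * n - 8) * \<sigma> \<le> 2 * n * \<sigma>" by (intro mult_right_mono) auto
      then show ?thesis using T' by linarith
    qed
  qed
  then show "3 * (\<Sum>(c, d)\<in>allowed. \<Psi>_sum c d) \<le> 28 * n * \<sigma>" unfolding T_def [symmetric] by simp
  show "\<sigma> \<ge> 0"
  proof -
    have "0 \<le> 2 * n * \<sigma>" using T\<sigma> T by simp
    then show ?thesis using n by (simp add: zero_le_mult_iff)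
  qed
qed

end

end

section \<open>Perfection\<close>

text \<open>The assumption says that \<open>q\<close> vanishes at all vectors \<open>a + b - c - d\<close> of the lattice.\<close>

locale quad_form = sym_form +
  assumes quad: "\<lbrakk>a \<in> carrier G; b \<in> carrier G; c \<in> carrier G; d \<in> carrier G; a \<otimes> b = c \<otimes> d; a \<noteq> b; c \<noteq> d\<rbrakk>
      \<Longrightarrow> D a b + D c d = D a c + D a d + D b c + D b d"
begin

section \<open>Nonsquare products and cosets of the squares\<close>

definition roots where "roots g = {c \<in> carrier G. c \<otimes> c = g}"

lemma sum_D_partner:
  assumes "a \<in> carrier G" "g \<in> carrier G"
  shows "(\<Sum>c\<in>carrier G. D a (g \<otimes> inv c)) = s a"
  unfolding s_def by (rule sum_mult_inv [OF assms(2)])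

text \<open>The relation \<open>quad\<close> is summed over all c, whose partner d = ab/c also runs
  through the group. A root c of ab is its own partner and violates c \<noteq> d, so the roots are
  left out of the sum and reappear as corrections.\<close>

lemma partner_sum:
  assumes a: "a \<in> carrier G" and b: "b \<in> carrier G" and "a \<noteq> b"
  shows "(n - card (roots (a \<otimes> b))) * D a b + (\<Sum>c\<in>carrier G. D c ((a \<otimes> b) \<otimes> inv c))
    = 2 * (s a + s b) - 2 * (\<Sum>c\<in>roots (a \<otimes> b). D a c + D b c)"
proof -
  let ?g = "a \<otimes> b" and ?R = "roots (a \<otimes> b)" and ?S = "carrier G"
  have R: "?R \<subseteq> ?S" "finite ?R" using finite_carrier by (auto simp: roots_def)
  have root: "?g \<otimes> inv c = c" if "c \<in> ?R" for c
    using that by (auto simp: roots_def m_assoc) (metis inv_solve_right' m_closed a b)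
  have "D a b + D c (?g \<otimes> inv c) = D a c + D a (?g \<otimes> inv c) + D b c + D b (?g \<otimes> inv c)"
    if "c \<in> ?S - ?R" for c
  proof -
    have c: "c \<in> carrier G" "c \<otimes> c \<noteq> ?g" using that by (auto simp: roots_def)
    have e: "?g = c \<otimes> (?g \<otimes> inv c)" using a b c(1) by (simp add: group_simps)
    have "c \<noteq> ?g \<otimes> inv c" using e c(2) by auto
    then show ?thesis using quad [OF a b c(1) _ e \<open>a \<noteq> b\<close>] a b c by simp
  qed
  then have "(\<Sum>c\<in>?S - ?R. D a b + D c (?g \<otimes> inv c))
     = (\<Sum>c\<in>?S - ?R. D a c + D a (?g \<otimes> inv c) + D b c + D b (?g \<otimes> inv c))"
    by (intro sum.cong) auto
  moreover have "(\<Sum>c\<in>?R. D c (?g \<otimes> inv c)) = 0"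
    by (rule sum.neutral) (metis D_diag root R(1) subsetD)
  moreover have "(\<Sum>c\<in>?R. D a c + D a (?g \<otimes> inv c) + D b c + D b (?g \<otimes> inv c)) = 2 * (\<Sum>c\<in>?R. D a c + D b c)"
    unfolding sum_distrib_left by (rule sum.cong) (simp_all add: root)
  moreover have "(\<Sum>c\<in>?S. D a c + D a (?g \<otimes> inv c) + D b c + D b (?g \<otimes> inv c)) = 2 * (s a + s b)"
    using a b by (simp add: sum.distrib sum_D_partner flip: s_def)
  moreover have "real (card (?S - ?R)) = n - card ?R"
    using R card_mono [OF finite_carrier R(1)] by (simp add: n_def card_Diff_subset of_nat_diff)
  ultimately show ?thesis
    by (simp add: sum_diff [OF finite_carrier R(1)] sum.distrib algebra_simps)
qed

text \<open>The normalisation is dictated by \<open>D_nonsquare\<close>: the sum of \<open>D\<close>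
  over partners equals 2\<sigma>/n there, and each of the two points receives half of its
  contribution.\<close>

definition \<alpha> where "\<alpha> a = 2 / n * (s a - \<sigma> / (2 * n))"

text \<open>Without roots, \<open>partner_sum\<close> reads n D(c,d) + F = 2(s c + s d) for every
  factorisation cd = ab, with a common F. Summation over all factorisations determines F.\<close>

lemma D_nonsquare:
  assumes a: "a \<in> carrier G" and b: "b \<in> carrier G" and ns: "a \<otimes> b \<notin> squares"
  shows "D a b = \<alpha> a + \<alpha> b"
proof -
  let ?g = "a \<otimes> b"
  define F where "F = (\<Sum>c\<in>carrier G. D c (?g \<otimes> inv c))"
  have g: "?g \<in> carrier G" using a b by simp
  have R: "roots ?g = {}" using ns unfolding roots_def squares_def by force
  have eq: "n * D c d + F = 2 * (s c + s d)" if "c \<in> carrier G" "d \<in> carrier G" "c \<otimes> d = ?g" for c d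
  proof -
    have "c \<noteq> d" using that ns square_mem by metis
    from partner_sum [OF that(1,2) this] show ?thesis by (simp add: that(3) R F_def)
  qed
  have "(\<Sum>c\<in>carrier G. n * D c (?g \<otimes> inv c) + F) = (\<Sum>c\<in>carrier G. 2 * (s c + s (?g \<otimes> inv c)))"
  proof (rule sum.cong [OF refl])
    show "n * D c (?g \<otimes> inv c) + F = 2 * (s c + s (?g \<otimes> inv c))" if "c \<in> carrier G" for c
      by (rule eq) (use that a b in \<open>simp_all add: group_simps\<close>)
  qed
  also have "\<dots> = 4 * \<sigma>"
    using sum_mult_inv [OF g, of s] by (simp add: sum.distrib \<sigma>_def flip: sum_distrib_left)
  finally have "2 * n * F = 4 * \<sigma>"
    by (simp add: sum.distrib F_def n_def flip: sum_distrib_left)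
  then have F: "F = 2 * \<sigma> / n" using n_pos by (simp add: field_simps)
  have "n * D a b = 2 * (s a + s b) - 2 * \<sigma> / n" using eq [OF a b refl] F by simp
  then have "D a b = (2 * (s a + s b) - 2 * \<sigma> / n) / n"
    using n_pos by (metis nonzero_mult_div_cancel_left less_irrefl)
  then show ?thesis by (simp add: \<alpha>_def algebra_simps add_divide_distrib diff_divide_distrib)
qed

text \<open>Equality of cosets modulo \<open>squares\<close>, written without inverses: ab and a/b
  differ by the square of b. This form matches the hypothesis of \<open>D_nonsquare\<close>.\<close>

definition same where "same a b \<longleftrightarrow> a \<otimes> b \<in> squares"

lemma same_refl [simp]: "a \<in> carrier G \<Longrightarrow> same a a" by (simp add: same_def)

lemma same_sym: "a \<in> carrier G \<Longrightarrow> b \<in> carrier G \<Longrightarrow> same a b \<longleftrightarrow> same b a"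
  by (simp add: same_def m_comm)

lemma mem_squares_mult_left [simp]:
  assumes "h \<in> squares" "a \<in> carrier G"
  shows "h \<otimes> a \<in> squares \<longleftrightarrow> a \<in> squares"
proof -
  interpret Q: subgroup squares G by (rule subgroup_squares)
  have "a = inv h \<otimes> (h \<otimes> a)" using assms squares_carrier by (simp add: cancel_inv0)
  then show ?thesis using assms Q.m_closed Q.m_inv_closed by metis
qed

lemma mem_squares_mult_right [simp]:
  assumes "h \<in> squares" "a \<in> carrier G"
  shows "a \<otimes> h \<in> squares \<longleftrightarrow> a \<in> squares"
  using mem_squares_mult_left [OF assms] assms squares_carrier by (simp add: m_comm)

lemma same_trans:
  assumes "a \<in> carrier G" "b \<in> carrier G" "c \<in> carrier G" "same a b"
  shows "same a c \<longleftrightarrow> same b c"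
proof -
  have "(a \<otimes> b) \<otimes> (b \<otimes> c) = (b \<otimes> b) \<otimes> (a \<otimes> c)" using assms by (simp add: group_simps)
  then show ?thesis using assms mem_squares_mult_left
    by (metis m_closed same_def square_mem)
qed

lemma same_mult:
  assumes "a \<in> carrier G" "h \<in> squares"
  shows "same a (a \<otimes> h)" "same (a \<otimes> h) a"
proof -
  have "a \<otimes> (a \<otimes> h) = (a \<otimes> a) \<otimes> h" using assms squares_carrier by (simp add: group_simps)
  then show "same a (a \<otimes> h)" unfolding same_def using assms squares_carrier by simp
  then show "same (a \<otimes> h) a" using assms squares_carrier by (simp add: same_sym)
qed

lemma same_inv:
  assumes "a \<in> carrier G" "same a b" "b \<in> carrier G"
  shows "b \<otimes> inv a \<in> squares" "inv a \<otimes> b \<in> squares"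
proof -
  have "a \<otimes> b = (a \<otimes> a) \<otimes> (inv a \<otimes> b)" using assms by (simp add: group_simps)
  with assms show "inv a \<otimes> b \<in> squares" by (simp add: same_def)
  with assms show "b \<otimes> inv a \<in> squares" by (simp add: m_comm)
qed

text \<open>Four of the six terms of the relation lie between different cosets; written through
  \<open>\<alpha>\<close> they cancel, and the two terms inside cosets remain.\<close>

lemma D_opposite:
  assumes "a \<in> carrier G" "b \<in> carrier G" "c \<in> carrier G" "d \<in> carrier G" "a \<otimes> b = c \<otimes> d"
    "same a c" "\<not> same a b"
  shows "D a c + D b d = 0"
proof -
  have cd: "\<not> same c d" using assms by (simp add: same_def)
  have cb: "\<not> same c b" using assms same_trans by blast
  have ad: "\<not> same a d" using assms same_trans cd by blast
  have "D a b = \<alpha> a + \<alpha> b" "D c d = \<alpha> c + \<alpha> d" "D b c = \<alpha> b + \<alpha> c" "D a d = \<alpha> a + \<alpha> d"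
    using assms cd cb ad D_nonsquare by (auto simp: same_def m_comm)
  moreover have "a \<noteq> b" "c \<noteq> d" using assms cd by auto
  ultimately show ?thesis using quad [OF assms(1-5)] by simp
qed

definition coset where "coset a = {b \<in> carrier G. same a b}"
lemma bij_coset: "a \<in> carrier G \<Longrightarrow> bij_betw (\<lambda>h. a \<otimes> h) squares (coset a)"
  by (rule bij_betw_byWitness [where f' = "\<lambda>b. inv a \<otimes> b"])
    (auto simp: coset_def same_mult same_inv squares_carrier cancel_inv0)

lemma card_coset: "a \<in> carrier G \<Longrightarrow> card (coset a) = card squares"
  using bij_betw_same_card [OF bij_coset] by simp

lemma sum_coset: "a \<in> carrier G \<Longrightarrow> (\<Sum>h\<in>squares. f (a \<otimes> h)) = sum f (coset a)"
  by (rule sum.reindex_bij_betw [OF bij_coset])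

lemma coset_eq: "a \<in> carrier G \<Longrightarrow> b \<in> carrier G \<Longrightarrow> same a b \<Longrightarrow> coset a = coset b"
  unfolding coset_def using same_trans by blast

lemma finite_coset: "finite (coset a)" "coset a \<subseteq> carrier G" 
  using finite_carrier by (auto simp: coset_def)

section \<open>At least three cosets of squares\<close>

lemma not_two_cosets:
  assumes x: "x \<in> carrier G" and y: "y \<in> carrier G" and "n > 2 * m"
  shows "\<exists>c\<in>carrier G. \<not> same x c \<and> \<not> same y c"
proof (rule ccontr)
  assume "\<not> ?thesis"
  then have "carrier G \<subseteq> coset x \<union> coset y" by (auto simp: coset_def)
  then have "card (carrier G) \<le> card (coset x \<union> coset y)" by (intro card_mono) (auto simp: finite_coset)
  also have "\<dots> \<le> card (coset x) + card (coset y)" by (rule card_Un_le)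
  finally show False using assms by (simp add: n_def m_def card_coset)
qed

text \<open>The common product is a square \<open>p\<close> other than aa and cc. Division of
  \<open>p\<close> by a and by c stays in the coset, and the choice of \<open>p\<close> makes the
  members of each pair distinct.\<close>

lemma exists_quad:
  assumes a: "a \<in> carrier G" and c: "c \<in> carrier G" and "m > 2"
  obtains b d where "b \<in> carrier G" "d \<in> carrier G" "same a b" "same c d" "a \<noteq> b" "c \<noteq> d" "a \<otimes> b = c \<otimes> d"
proof -
  have "\<not> squares \<subseteq> {a \<otimes> a, c \<otimes> c}"
  proof
    assume "squares \<subseteq> {a \<otimes> a, c \<otimes> c}"
    then have "card squares \<le> card {a \<otimes> a, c \<otimes> c}" by (intro card_mono) auto
    also have "\<dots> \<le> 2" by (simp add: card_insert_if)
    finally show False using \<open>m > 2\<close> by (simp add: m_def)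
  qed
  then obtain p where p: "p \<in> squares" "p \<noteq> a \<otimes> a" "p \<noteq> c \<otimes> c" by auto
  note pc = squares_carrier [OF p(1)]
  have *: "x \<otimes> (inv x \<otimes> p) = p" if "x \<in> carrier G" for x using that pc by (simp add: cancel_inv0)
  show thesis
  proof (rule that [of "inv a \<otimes> p" "inv c \<otimes> p"])
    show "same a (inv a \<otimes> p)" "same c (inv c \<otimes> p)" using * a c p by (auto simp: same_def)
    show "a \<noteq> inv a \<otimes> p" "c \<noteq> inv c \<otimes> p" using * [OF a] * [OF c] p by auto
  qed (use * a c pc in auto)
qed

lemma same_cong:
  assumes "a \<in> carrier G" "b \<in> carrier G" "c \<in> carrier G" "d \<in> carrier G" "same a b" "same c d"
  shows "same a c \<longleftrightarrow> same b d"
proof -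
  have "same a c \<longleftrightarrow> same b c" by (rule same_trans) (use assms in auto)
  also have "\<dots> \<longleftrightarrow> same c b" using assms by (simp add: same_sym)
  also have "\<dots> \<longleftrightarrow> same d b" by (rule same_trans) (use assms in auto)
  also have "\<dots> \<longleftrightarrow> same b d" using assms by (simp add: same_sym)
  finally show ?thesis .
qed

text \<open>The points a, b, e lie in three cosets, and multiplication by a/c moves b to d and e to
  f inside theirs. By \<open>D_opposite\<close> any two of D(a,c), D(b,d), D(e,f) add up to zero, so
  all three vanish.\<close>

lemma D_same_zero:
  assumes "n > 2 * m" and a: "a \<in> carrier G" and c: "c \<in> carrier G" and "same a c"
  shows "D a c = 0"
proof -
  obtain b where b: "b \<in> carrier G" "\<not> same a b"
    using not_two_cosets [OF a a assms(1)] by auto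
  obtain e where e: "e \<in> carrier G" "\<not> same a e" "\<not> same b e"
    using not_two_cosets [OF a b(1) assms(1)] by auto
  define d where "d = a \<otimes> b \<otimes> inv c"
  define f where "f = a \<otimes> e \<otimes> inv c"
  have cl: "d \<in> carrier G" "f \<in> carrier G" using a b c e by (simp_all add: d_def f_def)
  have ab: "a \<otimes> b = c \<otimes> d" and ae: "a \<otimes> e = c \<otimes> f" and bf: "b \<otimes> f = d \<otimes> e"
    using a b c e by (simp_all add: d_def f_def group_simps)
  have bd: "same b d"
  proof -
    have "b \<otimes> d = (a \<otimes> c) \<otimes> ((b \<otimes> inv c) \<otimes> (b \<otimes> inv c))"
      using a b c by (simp add: d_def group_simps)
    then show ?thesis using a b c assms(4) by (simp add: same_def)
  qed
  have ef: "same e f"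
  proof -
    have "e \<otimes> f = (a \<otimes> c) \<otimes> ((e \<otimes> inv c) \<otimes> (e \<otimes> inv c))"
      using a e c by (simp add: f_def group_simps)
    then show ?thesis using a e c assms(4) by (simp add: same_def)
  qed
  have "\<not> same b f" using same_cong [of b b e f] e b cl ef by auto
  then have "D b d + D f e = 0"
    using D_opposite [of b f d e] b cl e bd bf by simp
  moreover have "D a c + D b d = 0" using D_opposite [OF a b(1) c cl(1) ab] assms b by simp
  moreover have "D a c + D e f = 0" using D_opposite [OF a e(1) c cl(2) ae] assms e by simp
  ultimately show ?thesis using D_sym [OF e(1) cl(2)] by simp
qed

lemma s_many_cosets:
  assumes "n > 2 * m" and a: "a \<in> carrier G"
  shows "s a = (n - m) * \<alpha> a + sum \<alpha> (carrier G) - sum \<alpha> (coset a)"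
proof -
  have "s a = (\<Sum>b\<in>carrier G - coset a. D a b) + (\<Sum>b\<in>coset a. D a b)"
    unfolding s_def by (rule sum.subset_diff [OF finite_coset(2) finite_carrier])
  also have "(\<Sum>b\<in>coset a. D a b) = 0"
    by (rule sum.neutral) (use D_same_zero assms in \<open>auto simp: coset_def\<close>)
  also have "(\<Sum>b\<in>carrier G - coset a. D a b) = (\<Sum>b\<in>carrier G - coset a. \<alpha> a + \<alpha> b)"
    by (rule sum.cong) (use a in \<open>auto simp: coset_def same_def D_nonsquare\<close>)
  also have "\<dots> = real (card (carrier G - coset a)) * \<alpha> a + (sum \<alpha> (carrier G) - sum \<alpha> (coset a))"
    using finite_coset finite_carrier by (simp add: sum.distrib sum_diff)
  also have "real (card (carrier G - coset a)) = n - m"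
    using finite_coset card_mono [OF finite_carrier finite_coset(2) [of a]] card_coset [OF a]
    by (simp add: card_Diff_subset n_def m_def of_nat_diff)
  finally show ?thesis by simp
qed

lemma \<alpha>_diff: "n / 2 * (\<alpha> a - \<alpha> b) = s a - s b"
  using n_pos by (simp add: \<alpha>_def field_simps)

text \<open>The difference s a - s b is n - m times the difference of \<open>\<alpha>\<close> by
  \<open>s_many_cosets\<close>, and n/2 times it by the definition of
  \<open>\<alpha>\<close>.\<close>

lemma \<alpha>_coset_const:
  assumes "n > 2 * m" "a \<in> carrier G" "b \<in> carrier G" "same a b"
  shows "\<alpha> a = \<alpha> b"
proof -
  have "s a - s b = (n - m) * (\<alpha> a - \<alpha> b)"
    using s_many_cosets [OF assms(1,2)] s_many_cosets [OF assms(1,3)] coset_eq [OF assms(2-4)]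
    by (simp add: algebra_simps)
  then have "(n - 2 * m) * (\<alpha> a - \<alpha> b) = 0" using \<alpha>_diff [of a b] by (simp add: algebra_simps)
  then show ?thesis using assms(1) by simp
qed

text \<open>Across cosets the two coset sums contribute a further -m, so the competing factors are n
  - 2m and n/2. They coincide exactly for index 4.\<close>

lemma \<alpha>_const:
  assumes "n > 2 * m" "n \<noteq> 4 * m" "a \<in> carrier G" "b \<in> carrier G"
  shows "\<alpha> a = \<alpha> b"
proof -
  have *: "sum \<alpha> (coset x) = m * \<alpha> x" if x: "x \<in> carrier G" for x
  proof -
    have "sum \<alpha> (coset x) = (\<Sum>b\<in>coset x. \<alpha> x)"
      by (rule sum.cong) (use \<alpha>_coset_const [OF assms(1) x] in \<open>auto simp: coset_def\<close>)
    then show ?thesis by (simp add: card_coset x m_def)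
  qed
  have "s a - s b = (n - 2 * m) * (\<alpha> a - \<alpha> b)"
    using s_many_cosets [OF assms(1,3)] s_many_cosets [OF assms(1,4)] * assms(3,4)
    by (simp add: algebra_simps)
  then have "(n - 4 * m) * (\<alpha> a - \<alpha> b) = 0" using \<alpha>_diff [of a b] by (simp add: algebra_simps)
  then show ?thesis using assms(2) by simp
qed

text \<open>Between different cosets \<open>D\<close> is now one constant. The points \<one>, x, c,
  x/c are chosen in pairwise different cosets, so the relation equates two copies of this constant
  with four.\<close>

lemma \<alpha>_zero_many_cosets:
  assumes "n > 2 * m" "n \<noteq> 4 * m" "a \<in> carrier G"
  shows "\<alpha> a = 0"
proof -
  obtain x where x: "x \<in> carrier G" "\<not> same \<one> x"
    using not_two_cosets [of \<one> \<one>] assms by auto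
  obtain c where c: "c \<in> carrier G" "\<not> same \<one> c" "\<not> same x c"
    using not_two_cosets [of \<one> x] assms x by auto
  define d where "d = x \<otimes> inv c"
  have d: "d \<in> carrier G" using x c by (simp add: d_def)
  have eq: "\<one> \<otimes> x = c \<otimes> d" using x c by (simp add: d_def group_simps)
  have "x \<otimes> c = d \<otimes> (c \<otimes> c)" "c \<otimes> d = x" using x c by (simp_all add: d_def group_simps)
  then have nd: "\<not> same \<one> d" "\<not> same c d"
    using x c d unfolding same_def by auto
  have "x \<otimes> d = (x \<otimes> inv c) \<otimes> (x \<otimes> inv c) \<otimes> c" using x c by (simp add: d_def group_simps)
  then have nx: "\<not> same x d" using x c unfolding same_def by auto
  have D: "D p q = 2 * \<alpha> a" if "p \<in> carrier G" "q \<in> carrier G" "\<not> same p q" for p q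
    using D_nonsquare [of p q] that \<alpha>_const [OF assms(1,2) that(1) assms(3)]
      \<alpha>_const [OF assms(1,2) that(2) assms(3)] by (simp add: same_def)
  have "\<one> \<noteq> x" "c \<noteq> d" using x nd same_refl c by auto
  then have "D \<one> x + D c d = D \<one> c + D \<one> d + D x c + D x d"
    using quad [OF _ _ _ _ eq] x c d by simp
  then show ?thesis using D x c d nd nx by simp
qed

text \<open>Here \<open>\<alpha>\<close> might still vary between cosets. A quadruple with two
  points in each of two cosets has zero \<open>D\<close> inside the cosets, so the values of
  \<open>\<alpha>\<close> on the two cosets are opposite; three cosets cannot be pairwise opposite
  unless the values vanish. The quadruple requires a third square, which C4 x C2 does not
  have.\<close>

lemma \<alpha>_zero_four_cosets:
  assumes "n = 4 * m" "m > 2" "a \<in> carrier G"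
  shows "\<alpha> a = 0"
proof -
  have nm: "n > 2 * m" using assms m_pos by simp
  have opp: "\<alpha> p + \<alpha> q = 0" if p: "p \<in> carrier G" and q: "q \<in> carrier G" and "\<not> same p q" for p q
  proof -
    obtain b d where bd: "b \<in> carrier G" "d \<in> carrier G" "same p b" "same q d" "p \<noteq> b" "q \<noteq> d"
      "p \<otimes> b = q \<otimes> d"
      using exists_quad [OF p q assms(2)] by metis
    have ns: "\<not> same p d" "\<not> same b q" "\<not> same b d"
      using same_cong [of p p q d] same_cong [of p b q q] same_cong [of p b q d] p q bd that by auto
    have "\<alpha> b = \<alpha> p" "\<alpha> d = \<alpha> q" 
      using \<alpha>_coset_const [OF nm p bd(1,3)] \<alpha>_coset_const [OF nm q bd(2,4)] by simp_all
    then have "D p q = \<alpha> p + \<alpha> q" "D p d = \<alpha> p + \<alpha> q" "D b q = \<alpha> p + \<alpha> q" "D b d = \<alpha> p + \<alpha> q"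
      using D_nonsquare [OF p q] D_nonsquare [OF p bd(2)] D_nonsquare [OF bd(1) q] D_nonsquare [OF bd(1,2)]
        ns that(3) by (simp_all add: same_def)
    moreover have "D p b = 0" "D q d = 0"
      using D_same_zero [OF nm p bd(1,3)] D_same_zero [OF nm q bd(2,4)] by simp_all
    ultimately show ?thesis using quad [OF p bd(1) q bd(2) bd(7,5,6)] by simp
  qed
  obtain b where b: "b \<in> carrier G" "\<not> same a b"
    using not_two_cosets [OF assms(3,3) nm] by auto
  obtain e where e: "e \<in> carrier G" "\<not> same a e" "\<not> same b e"
    using not_two_cosets [OF assms(3) b(1) nm] by auto
  show ?thesis using opp [OF assms(3) b(1)] opp [OF assms(3) e(1)] opp [OF b(1) e(1)] b e by simp
qed

lemma D_zero_many_cosets: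
  assumes "n > 2 * m" "n \<noteq> 4 * m \<or> m > 2" "a \<in> carrier G" "b \<in> carrier G"
  shows "D a b = 0"
proof -
  have "\<alpha> x = 0" if "x \<in> carrier G" for x
    using \<alpha>_zero_four_cosets \<alpha>_zero_many_cosets assms that by blast
  then show ?thesis
    using D_same_zero [OF assms(1,3,4)] D_nonsquare [OF assms(3,4)] assms by (auto simp: same_def)
qed

section \<open>Two cosets of squares\<close>

definition \<phi> where "\<phi> h = D \<one> h"
definition \<epsilon> :: "'a \<Rightarrow> real" where "\<epsilon> a = (if a \<in> squares then 1 else - 1)"
definition \<beta> where "\<beta> a = - 2 * \<epsilon> a * \<alpha> a"
text \<open>Designed to depend only on the product ab, for distinct a and b in one coset. The sign
  \<open>\<epsilon>\<close>, a quadratic character for index 2, accounts for the change of sign of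
  \<open>D\<close> between the two cosets, and \<open>\<beta>\<close> absorbs the values of
  \<open>\<alpha>\<close> from the terms across cosets.\<close>

definition X where "X a b = \<phi> (inv a \<otimes> b) + \<beta> a + \<beta> b"

lemma \<phi>_one [simp]: "\<phi> \<one> = 0"
  by (simp add: \<phi>_def D_diag)

lemma \<epsilon>_sq [simp]: "\<epsilon> a * \<epsilon> a = 1" "\<epsilon> a * (\<epsilon> a * x) = x"
  by (simp_all add: \<epsilon>_def)

lemma mem_squares_iff: "a \<in> carrier G \<Longrightarrow> a \<in> squares \<longleftrightarrow> same \<one> a"
  by (simp add: same_def)

lemma \<epsilon>_same: "\<lbrakk>a \<in> carrier G; b \<in> carrier G; same a b\<rbrakk> \<Longrightarrow> \<epsilon> a = \<epsilon> b"
  unfolding \<epsilon>_def by (metis mem_squares_iff one_closed same_sym same_trans)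

lemma D_nonsquare_shift:
  assumes "h \<in> squares" and a: "a \<in> carrier G" "a \<notin> squares"
  shows "D a (a \<otimes> h) = - \<phi> h"
proof -
  note h = squares_carrier [OF assms(1)]
  have "D \<one> h + D (a \<otimes> h) a = 0"
    by (rule D_opposite) (use h assms in \<open>simp_all add: same_def group_simps\<close>)
  then show ?thesis using D_sym [of a "a \<otimes> h"] a h by (simp add: \<phi>_def)
qed

lemma same_iff_two_cosets:
  assumes "n = 2 * m" "a \<in> carrier G" "b \<in> carrier G" "c \<in> carrier G" "\<not> same a c" "\<not> same b c"
  shows "same a b"
proof (rule ccontr)
  assume "\<not> same a b"
  then have disj: "coset a \<inter> coset b = {}"
    using same_trans same_sym assms unfolding coset_def by blast
  have "coset a \<union> coset b = carrier G"
  proof (rule card_subset_eq [OF finite_carrier])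
    show "coset a \<union> coset b \<subseteq> carrier G" using finite_coset by simp
    have "card (coset a \<union> coset b) = card (coset a) + card (coset b)"
      using disj finite_coset by (simp add: card_Un_disjoint)
    also have "\<dots> = card (carrier G)" using assms by (simp add: card_coset n_def m_def)
    finally show "card (coset a \<union> coset b) = card (carrier G)" .
  qed
  then show False using assms by (auto simp: coset_def)
qed

lemma exists_nonsquare:
  assumes "n = 2 * m" "a \<in> carrier G"
  obtains u where "u \<in> carrier G" "\<not> same a u"
proof -
  have "coset a \<noteq> carrier G"
  proof
    assume "coset a = carrier G"
    then have "n = m" using card_coset [OF assms(2)] by (simp add: n_def m_def)
    then show False using assms m_pos by simp
  qed
  then show thesis using that finite_coset(2) [of a] by (auto simp: coset_def)
qed

lemma \<epsilon>_not_same: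
  assumes "n = 2 * m" "a \<in> carrier G" "b \<in> carrier G" "\<not> same a b"
  shows "\<epsilon> b = - \<epsilon> a"
proof -
  have "\<not> same \<one> a \<or> \<not> same \<one> b" using assms same_trans [of \<one> a b] by auto
  moreover have "same \<one> a \<or> same \<one> b"
    using same_iff_two_cosets [OF assms(1-3), of \<one>] assms same_sym by auto
  ultimately show ?thesis using assms by (auto simp: \<epsilon>_def mem_squares_iff)
qed

text \<open>Inside cosets \<open>D\<close> is translation invariant up to the sign
  \<open>\<epsilon>\<close>. A square \<open>a\<close> is reached through some \<open>u\<close> in
  the other coset, where the value is known from the pair (\<one>, h).\<close>

lemma D_shift:
  assumes "n = 2 * m" "h \<in> squares" and a: "a \<in> carrier G"
  shows "D a (a \<otimes> h) = \<epsilon> a * \<phi> h"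
proof (cases "a \<in> squares")
  case True
  note h = squares_carrier [OF assms(2)]
  obtain u where u: "u \<in> carrier G" "\<not> same a u" using exists_nonsquare [OF assms(1) a] .
  then have "u \<notin> squares" using True a by (simp add: same_def)
  then have "D u (u \<otimes> h) = - \<phi> h" using D_nonsquare_shift assms u by simp
  moreover have "D a (a \<otimes> h) + D (u \<otimes> h) u = 0"
    by (rule D_opposite)
      (use h u a assms True \<open>u \<notin> squares\<close> in \<open>simp_all add: same_def group_simps squares_carrier\<close>)
  ultimately show ?thesis using True D_sym [of u "u \<otimes> h"] u h by (simp add: \<epsilon>_def)
qed (simp add: D_nonsquare_shift assms \<epsilon>_def)

lemma D_same:
  assumes "n = 2 * m" "a \<in> carrier G" "b \<in> carrier G" "same a b"
  shows "D a b = \<epsilon> a * \<phi> (inv a \<otimes> b)"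
  using D_shift [OF assms(1) same_inv(2) [OF assms(2,4,3)] assms(2)] assms by (simp add: cancel_inv0)

text \<open>The terms across cosets contribute twice the sum of \<open>\<alpha>\<close> over the
  four points. Multiplied by \<epsilon>(a), the relation separates into a part with a, b and a part
  with c, d, since \<open>\<epsilon>\<close> has opposite values on the two pairs.\<close>

lemma X_opposite:
  assumes nm: "n = 2 * m" and cl: "a \<in> carrier G" "b \<in> carrier G" "c \<in> carrier G" "d \<in> carrier G"
    and "same a b" "same c d" "a \<noteq> b" "c \<noteq> d" and eq: "a \<otimes> b = c \<otimes> d" and ns: "\<not> same a c"
  shows "X a b = X c d"
proof -
  have ns': "\<not> same a d" "\<not> same b c" "\<not> same b d"
    using same_cong [of a a c d] same_cong [of a b c c] same_cong [of a b c d] assms by auto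
  have e: "\<epsilon> b = \<epsilon> a" "\<epsilon> d = \<epsilon> c" "\<epsilon> c = - \<epsilon> a"
    using \<epsilon>_same [of a b] \<epsilon>_same [of c d] \<epsilon>_not_same [OF nm, of a c] assms by simp_all
  have "D a b + D c d = 2 * (\<alpha> a + \<alpha> b + \<alpha> c + \<alpha> d)"
    using quad [OF cl eq] assms ns' D_nonsquare by (simp add: same_def)
  then have "\<epsilon> a * (D a b + D c d) = \<epsilon> a * (2 * (\<alpha> a + \<alpha> b + \<alpha> c + \<alpha> d))" by simp
  moreover have "D a b = \<epsilon> a * \<phi> (inv a \<otimes> b)" "D c d = - \<epsilon> a * \<phi> (inv c \<otimes> d)"
    using D_same assms e by simp_all
  ultimately show ?thesis by (simp add: X_def \<beta>_def e algebra_simps)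
qed

lemma card_roots:
  assumes "n = 2 * m" "g \<in> squares"
  shows "card (roots g) = 2"
proof -
  have "real (card involutions) = 2" using card_involutions assms(1) m_pos by simp
  then show ?thesis using card_square_roots [OF assms(2)] by (simp add: roots_def)
qed

text \<open>Two pairs in one coset are compared through a pair (e, f) with the same product in the
  other coset. It exists because the product has only two roots while the coset has m \<ge> 3
  elements, so some \<open>e\<close> is not its own partner.\<close>

lemma X_eq:
  assumes nm: "n = 2 * m" and m: "m \<ge> 3"
    and cl: "a \<in> carrier G" "b \<in> carrier G" "c \<in> carrier G" "d \<in> carrier G"
    and sm: "same a b" "same c d" and ne: "a \<noteq> b" "c \<noteq> d" and eq: "a \<otimes> b = c \<otimes> d"
  shows "X a b = X c d"
proof (cases "same a c")
  case True
  obtain u where u: "u \<in> carrier G" "\<not> same a u" using exists_nonsquare [OF nm cl(1)] .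
  have g: "a \<otimes> b \<in> squares" using sm by (simp add: same_def)
  have "\<not> coset u \<subseteq> roots (a \<otimes> b)"
  proof
    assume "coset u \<subseteq> roots (a \<otimes> b)"
    then have "card (coset u) \<le> card (roots (a \<otimes> b))"
      by (intro card_mono) (use finite_carrier in \<open>auto simp: roots_def\<close>)
    then show False using card_roots [OF nm g] card_coset [OF u(1)] m by (simp add: m_def)
  qed
  then obtain e where e: "e \<in> carrier G" "same u e" "e \<otimes> e \<noteq> a \<otimes> b"
    by (auto simp: coset_def roots_def)
  define f where "f = inv e \<otimes> (a \<otimes> b)"
  have f: "f \<in> carrier G" "e \<otimes> f = a \<otimes> b" using e cl by (simp_all add: f_def cancel_inv0)
  then have ef: "same e f" "e \<noteq> f" using g e by (auto simp: same_def)
  have ae: "\<not> same a e" using u e cl same_cong [of a a u e] by simp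
  then have ce: "\<not> same c e" using True e cl same_trans by blast
  have "X a b = X e f" using X_opposite [OF nm cl(1,2) e(1) f(1)] sm ef ne f ae by simp
  moreover have "X c d = X e f" using X_opposite [OF nm cl(3,4) e(1) f(1)] sm ef ne f ce eq by simp
  ultimately show ?thesis by simp
qed (use X_opposite assms in blast)

definition \<psi> where "\<psi> p = sum \<beta> (roots p)"

lemma sum_\<psi>: "sum \<psi> squares = sum \<beta> (carrier G)"
  unfolding \<psi>_def roots_def squares_def by (rule sum.image_gen [OF finite_carrier, symmetric])

text \<open>Since X depends only on p = ab, averaging X over the factorisations c, p/c of p
  evaluates it. The two roots of p are left out of the average; each would contribute 2 \<beta>(c),
  which explains \<open>\<psi>\<close>.\<close>

lemma X_formula:
  assumes nm: "n = 2 * m" and m: "m \<ge> 3"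
    and cl: "a \<in> carrier G" "b \<in> carrier G" and "same a b" "a \<noteq> b"
  shows "(n - 2) * X a b = 2 * sum \<phi> squares + 2 * sum \<beta> (carrier G) - 2 * \<psi> (a \<otimes> b)"
proof -
  let ?p = "a \<otimes> b" let ?S = "carrier G" let ?R = "roots ?p"
  have p: "?p \<in> squares" using assms by (simp add: same_def)
  have pc: "?p \<in> carrier G" using cl by simp
  have R: "?R \<subseteq> ?S" "finite ?R" using finite_carrier by (auto simp: roots_def)
  have "real (card (?S - ?R)) = n - 2"
    using R card_mono [OF finite_carrier R(1)] card_roots [OF nm p]
    by (simp add: n_def card_Diff_subset of_nat_diff)
  then have "(n - 2) * X a b = (\<Sum>c\<in>?S - ?R. X a b)" by simp
  also have "\<dots> = (\<Sum>c\<in>?S - ?R. X c (?p \<otimes> inv c))"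
  proof (rule sum.cong [OF refl])
    fix c assume c: "c \<in> ?S - ?R"
    have e: "c \<otimes> (?p \<otimes> inv c) = ?p" using c cl by (simp add: group_simps)
    have "same c (?p \<otimes> inv c)" using e p by (simp add: same_def)
    moreover have "c \<noteq> ?p \<otimes> inv c" using c e by (auto simp: roots_def)
    ultimately show "X a b = X c (?p \<otimes> inv c)"
      using X_eq [OF nm m cl, of c "?p \<otimes> inv c"] assms(5,6) c e cl by simp
  qed
  also have "\<dots> = (\<Sum>c\<in>?S. X c (?p \<otimes> inv c)) - (\<Sum>c\<in>?R. X c (?p \<otimes> inv c))"
    using R finite_carrier by (simp add: sum_diff)
  also have "(\<Sum>c\<in>?R. X c (?p \<otimes> inv c)) = 2 * \<psi> ?p"
    unfolding \<psi>_def sum_distrib_left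
  proof (rule sum.cong [OF refl])
    fix c assume c: "c \<in> ?R"
    then have "?p \<otimes> inv c = c" by (metis (mono_tags, lifting) inv_solve_right' mem_Collect_eq pc roots_def)
    then show "X c (?p \<otimes> inv c) = 2 * \<beta> c" using c by (simp add: X_def roots_def)
  qed
  also have "(\<Sum>c\<in>?S. X c (?p \<otimes> inv c))
      = (\<Sum>c\<in>?S. \<phi> (?p \<otimes> inv (c \<otimes> c))) + sum \<beta> ?S + (\<Sum>c\<in>?S. \<beta> (?p \<otimes> inv c))"
    using cl by (simp add: X_def sum.distrib group_simps cong: sum.cong)
  also have "(\<Sum>c\<in>?S. \<phi> (?p \<otimes> inv (c \<otimes> c))) = 2 * sum \<phi> squares"
  proof -
    have "real (card involutions) = 2" using card_involutions nm m_pos by simp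
    then have "(\<Sum>c\<in>?S. \<phi> (?p \<otimes> inv (c \<otimes> c))) = 2 * (\<Sum>h\<in>squares. \<phi> (?p \<otimes> inv h))"
      using sum_square [of "\<lambda>h. \<phi> (?p \<otimes> inv h)"] by simp
    also have "(\<Sum>h\<in>squares. \<phi> (?p \<otimes> inv h)) = sum \<phi> squares"
      using sum_inv_subgroup [OF subgroup_squares, of "\<lambda>h. \<phi> (?p \<otimes> h)"]
        sum_mult_subgroup [OF subgroup_squares p, of \<phi>] by simp
    finally show ?thesis .
  qed
  also have "(\<Sum>c\<in>?S. \<beta> (?p \<otimes> inv c)) = sum \<beta> ?S" by (rule sum_mult_inv [OF pc])
  finally show ?thesis by simp
qed

text \<open>Summed over b = ah, every quantity except \<beta>(a) and \<psi>(aa) depends only on the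
  coset of a, so two elements of a coset can be compared. Omitting h = \<one> leaves m - 1 copies of
  \<beta>(a) and removes one more from the sum over the coset, hence m - 2.\<close>

lemma sum_X:
  assumes nm: "n = 2 * m" and m: "m \<ge> 3" and a: "a \<in> carrier G"
  shows "(n - 2) * (sum \<phi> squares + (m - 2) * \<beta> a + sum \<beta> (coset a))
    = (m - 1) * (2 * sum \<phi> squares + 2 * sum \<beta> (carrier G)) - 2 * (sum \<beta> (carrier G) - \<psi> (a \<otimes> a))"
proof -
  let ?Q = "squares - {\<one>}"
  have one: "\<one> \<in> squares" using square_mem [of \<one>] by simp
  have fin: "finite squares" using finite_carrier by (simp add: squares_def)
  have cQ: "real (card ?Q) = m - 1" using fin one m_pos by (simp add: m_def of_nat_diff)
  have rem: "(\<Sum>h\<in>?Q. f h) = sum f squares - f \<one>" for f :: "'a \<Rightarrow> real"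
    using fin one by (simp add: sum_diff1)
  have "(\<Sum>h\<in>?Q. (n - 2) * X a (a \<otimes> h))
     = (\<Sum>h\<in>?Q. 2 * sum \<phi> squares + 2 * sum \<beta> (carrier G) - 2 * \<psi> (a \<otimes> (a \<otimes> h)))"
  proof (rule sum.cong [OF refl], rule X_formula [OF nm m a])
    fix h assume h: "h \<in> ?Q"
    then have hc: "h \<in> carrier G" using squares_carrier by simp
    show "a \<otimes> h \<in> carrier G" "same a (a \<otimes> h)" using h hc a by (auto simp: same_mult)
    show "a \<noteq> a \<otimes> h" using h hc a by (metis Diff_iff l_cancel_one' singletonI)
  qed
  also have "\<dots> = (m - 1) * (2 * sum \<phi> squares + 2 * sum \<beta> (carrier G)) - 2 * (\<Sum>h\<in>?Q. \<psi> (a \<otimes> (a \<otimes> h)))"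
    using cQ by (simp add: sum_subtractf sum_distrib_left)
  also have "(\<Sum>h\<in>?Q. \<psi> (a \<otimes> (a \<otimes> h))) = sum \<beta> (carrier G) - \<psi> (a \<otimes> a)"
  proof -
    have "(\<Sum>h\<in>squares. \<psi> (a \<otimes> (a \<otimes> h))) = (\<Sum>h\<in>squares. \<psi> ((a \<otimes> a) \<otimes> h))"
      by (rule sum.cong) (use a squares_carrier in \<open>simp_all add: m_assoc\<close>)
    also have "\<dots> = sum \<beta> (carrier G)"
      using sum_mult_subgroup [OF subgroup_squares square_mem [OF a], of \<psi>] sum_\<psi> by simp
    finally show ?thesis using a by (subst rem) simp
  qed
  also have "(\<Sum>h\<in>?Q. (n - 2) * X a (a \<otimes> h)) = (n - 2) * (\<Sum>h\<in>?Q. \<phi> h + \<beta> a + \<beta> (a \<otimes> h))"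
    unfolding sum_distrib_left
    by (rule sum.cong) (use a squares_carrier in \<open>simp_all add: X_def cancel_inv0\<close>)
  also have "(\<Sum>h\<in>?Q. \<phi> h + \<beta> a + \<beta> (a \<otimes> h)) = sum \<phi> squares + (m - 2) * \<beta> a + sum \<beta> (coset a)"
    using a by (simp add: sum.distrib rem sum_coset cQ algebra_simps)
  finally show ?thesis .
qed

lemma \<psi>_square:
  assumes nm: "n = 2 * m"
  obtains z where "z \<in> carrier G" "z \<otimes> z = \<one>" "\<And>a. a \<in> carrier G \<Longrightarrow> \<psi> (a \<otimes> a) = \<beta> a + \<beta> (a \<otimes> z)"
proof -
  have "card involutions = 2" using card_involutions nm m_pos by simp
  then have "card (involutions - {\<one>}) = 1" by (simp add: card_Diff_singleton_if involutions_def)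
  then obtain z where z: "involutions - {\<one>} = {z}" using card_1_singletonE by blast
  have zc: "z \<in> carrier G" "z \<otimes> z = \<one>" "z \<noteq> \<one>" using z by (auto simp: involutions_def)
  have "\<psi> (a \<otimes> a) = \<beta> a + \<beta> (a \<otimes> z)" if a: "a \<in> carrier G" for a
  proof -
    have ne: "a \<noteq> a \<otimes> z" using a zc by (metis l_cancel_one')
    have "(a \<otimes> z) \<otimes> (a \<otimes> z) = (a \<otimes> a) \<otimes> (z \<otimes> z)" using a zc(1) by (simp only: m_ac m_closed)
    then have "{a, a \<otimes> z} \<subseteq> roots (a \<otimes> a)" using a zc by (simp add: roots_def)
    moreover have "finite (roots (a \<otimes> a))" using finite_carrier by (simp add: roots_def)
    moreover have "card {a, a \<otimes> z} = card (roots (a \<otimes> a))"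
      using card_roots [OF nm square_mem [OF a]] ne by simp
    ultimately have "{a, a \<otimes> z} = roots (a \<otimes> a)" using card_subset_eq by blast
    then have "\<psi> (a \<otimes> a) = sum \<beta> {a, a \<otimes> z}" by (simp add: \<psi>_def)
    then show ?thesis using ne by simp
  qed
  then show thesis using that zc by blast
qed

text \<open>The value \<psi>(aa) = \<beta>(a) + \<beta>(az) is the same for a and az. So the
  differences u = \<beta>(a) - \<beta>(b) and v = \<beta>(az) - \<beta>(bz) satisfy k u = k v = 2(u
  + v), which forces u = v = 0 because k \<ge> 12.\<close>

lemma \<beta>_coset_const:
  assumes nm: "n = 2 * m" and m: "m \<ge> 4" and a: "a \<in> carrier G" and b: "b \<in> carrier G" and ab: "same a b"
  shows "\<beta> a = \<beta> b"
proof -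
  obtain z where z: "z \<in> carrier G" "z \<otimes> z = \<one>"
    and \<psi>: "\<And>a. a \<in> carrier G \<Longrightarrow> \<psi> (a \<otimes> a) = \<beta> a + \<beta> (a \<otimes> z)" by (rule \<psi>_square [OF nm]) (rule that)
  have m3: "m \<ge> 3" using m by simp
  \<comment> \<open>The coefficient (n - 2)(m - 2) of \<beta>(a) in \<open>sum_X\<close>.\<close>
  define k where "k = (2 * m - 2) * (m - 2)"
  have "k \<ge> 6 * 2" unfolding k_def by (rule mult_mono) (use m in auto)
  have *: "k * (\<beta> x - \<beta> y) = 2 * (\<psi> (x \<otimes> x) - \<psi> (y \<otimes> y))"
    if "x \<in> carrier G" "y \<in> carrier G" "same x y" for x y
    using sum_X [OF nm m3 that(1)] sum_X [OF nm m3 that(2)] coset_eq [OF that] nm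
    by (simp add: k_def algebra_simps)
  have sz: "same (a \<otimes> z) (b \<otimes> z)"
  proof -
    have "(a \<otimes> z) \<otimes> (b \<otimes> z) = (a \<otimes> b) \<otimes> (z \<otimes> z)" using a b z(1) by (simp only: m_ac m_closed)
    then show ?thesis using ab a b z by (simp add: same_def)
  qed
  have zz: "a \<otimes> z \<otimes> z = a" "b \<otimes> z \<otimes> z = b" using a b z by (simp_all add: m_assoc)
  have 1: "k * (\<beta> a - \<beta> b) = 2 * (\<beta> a + \<beta> (a \<otimes> z) - \<beta> b - \<beta> (b \<otimes> z))"
    using * [OF a b ab] \<psi> a b by simp
  have 2: "k * (\<beta> (a \<otimes> z) - \<beta> (b \<otimes> z)) = 2 * (\<beta> a + \<beta> (a \<otimes> z) - \<beta> b - \<beta> (b \<otimes> z))"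
    using * [OF _ _ sz] \<psi> [of "a \<otimes> z"] \<psi> [of "b \<otimes> z"] a b z zz by simp
  have "(k - 4) * (\<beta> a + \<beta> (a \<otimes> z) - \<beta> b - \<beta> (b \<otimes> z)) = 0" using 1 2 by (simp add: algebra_simps)
  then have "\<beta> a + \<beta> (a \<otimes> z) - \<beta> b - \<beta> (b \<otimes> z) = 0" using \<open>k \<ge> 6 * 2\<close> by simp
  then show ?thesis using 1 \<open>k \<ge> 6 * 2\<close> by simp
qed

lemma exists_square_avoiding:
  assumes "m \<ge> 4" "p \<in> carrier G" "q \<in> carrier G"
  obtains y where "y \<in> squares" "y \<noteq> \<one>" "y \<noteq> p" "y \<noteq> q"
proof -
  have "\<not> squares \<subseteq> {\<one>, p, q}"
  proof
    assume "squares \<subseteq> {\<one>, p, q}"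
    then have "card squares \<le> card {\<one>, p, q}" by (intro card_mono) auto
    also have "\<dots> \<le> 3" by (simp add: card_insert_if)
    finally show False using assms by (simp add: m_def)
  qed
  then show thesis using that by auto
qed

text \<open>As \<open>\<beta>\<close> is constant on cosets, X(a, ax) reduces to \<phi>(x) + 2
  \<beta>(a); the pairs (a, ax) and (aw, awy) have equal products.\<close>

lemma X_shift:
  assumes nm: "n = 2 * m" and m: "m \<ge> 4"
    and x: "x \<in> squares" "x \<noteq> \<one>" and y: "y \<in> squares" "y \<noteq> \<one>"
    and w: "w \<in> carrier G" "x = (w \<otimes> w) \<otimes> y" and a: "a \<in> carrier G"
  shows "\<phi> x + 2 * \<beta> a = \<phi> y + 2 * \<beta> (a \<otimes> w)"
proof -
  have c: "x \<in> carrier G" "y \<in> carrier G" using x y squares_carrier by auto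
  have "X a (a \<otimes> x) = X (a \<otimes> w) (a \<otimes> w \<otimes> y)"
  proof (rule X_eq [OF nm])
    show "a \<otimes> (a \<otimes> x) = (a \<otimes> w) \<otimes> (a \<otimes> w \<otimes> y)" using w a c(2) by (simp add: m_ac)
    show "a \<noteq> a \<otimes> x" using a c x by (metis l_cancel_one')
    show "a \<otimes> w \<noteq> a \<otimes> w \<otimes> y" using a w c y by (metis l_cancel_one' m_closed)
  qed (use m a w(1) c x y in \<open>simp_all add: same_mult\<close>)
  moreover have "X b (b \<otimes> h) = \<phi> h + 2 * \<beta> b" if "b \<in> carrier G" "h \<in> squares" for b h
    using that \<beta>_coset_const [OF nm m that(1), of "b \<otimes> h"] squares_carrier
    by (simp add: X_def cancel_inv0 same_mult)
  ultimately show ?thesis using a w x y by simp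
qed

text \<open>The quotient x/y is a square ww. A shift by w from \<one> compares
  \<open>\<beta>\<close> at \<one> and w. If w is not a square, the same shift from w to ww undoes
  the change of \<open>\<beta>\<close>, and the two equations add up to the claim.\<close>

lemma \<phi>_const:
  assumes nm: "n = 2 * m" and m: "m \<ge> 4"
    and x: "x \<in> squares" "x \<noteq> \<one>" and y: "y \<in> squares" "y \<noteq> \<one>"
  shows "\<phi> x = \<phi> y"
proof -
  have c: "x \<in> carrier G" "y \<in> carrier G" using x y squares_carrier by auto
  interpret Q: subgroup squares G by (rule subgroup_squares)
  have "x \<otimes> inv y \<in> squares" using x y by auto
  then obtain w where w: "w \<in> carrier G" "x \<otimes> inv y = w \<otimes> w" unfolding squares_def by auto
  then have xw: "x = (w \<otimes> w) \<otimes> y" using c by (metis inv_solve_right' m_closed inv_solve_right)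
  show ?thesis
  proof (cases "w \<in> squares")
    case True
    then have "\<beta> (\<one> \<otimes> w) = \<beta> \<one>" using \<beta>_coset_const [OF nm m, of w \<one>] w by (simp add: same_def)
    then show ?thesis using X_shift [OF nm m x y w(1) xw, of \<one>] by simp
  next
    case False
    have "\<beta> (w \<otimes> w) = \<beta> \<one>" using \<beta>_coset_const [OF nm m, of "w \<otimes> w" \<one>] w(1) by (simp add: same_def)
    then show ?thesis
      using X_shift [OF nm m x y w(1) xw, of \<one>] X_shift [OF nm m x y w(1) xw, of w] w(1) by simp
  qed
qed

text \<open>For a square y other than \<one> and the inverse of ww, both y and wwy are nontrivial
  squares with equal \<open>\<phi>\<close>, and \<open>X_shift\<close> leaves only the values of
  \<open>\<beta>\<close>.\<close>

lemma \<beta>_const: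
  assumes nm: "n = 2 * m" and m: "m \<ge> 4" and a: "a \<in> carrier G" and b: "b \<in> carrier G"
  shows "\<beta> a = \<beta> b"
proof -
  define w where "w = inv a \<otimes> b"
  have w: "w \<in> carrier G" "a \<otimes> w = b" using a b by (simp_all add: w_def cancel_inv0)
  obtain y where y: "y \<in> squares" "y \<noteq> \<one>" "y \<noteq> inv (w \<otimes> w)" "y \<noteq> \<one>"
    using exists_square_avoiding [OF m, of "inv (w \<otimes> w)" \<one>] w by auto
  have yc: "y \<in> carrier G" using y squares_carrier by auto
  have "(w \<otimes> w) \<otimes> y \<noteq> \<one>" using y w yc by (metis inv_equality inv_inv m_closed)
  moreover have "(w \<otimes> w) \<otimes> y \<in> squares" using y w yc by simp
  ultimately show ?thesis
    using X_shift [OF nm m _ _ y(1,2) w(1) refl a] \<phi>_const [OF nm m _ _ y(1,2)] w by auto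
qed

text \<open>On the subgroup of squares \<open>D\<close> has a single value off the diagonal. For the
  four distinct squares \<one>, h, y, hy the relation equates two copies of it with four.\<close>

lemma \<phi>_zero:
  assumes nm: "n = 2 * m" and m: "m \<ge> 4" and h: "h \<in> squares"
  shows "\<phi> h = 0"
proof (cases "h = \<one>")
  case False
  have hc: "h \<in> carrier G" using h squares_carrier by auto
  interpret Q: subgroup squares G by (rule subgroup_squares)
  obtain y where y: "y \<in> squares" "y \<noteq> \<one>" "y \<noteq> h" "y \<noteq> inv h"
    using exists_square_avoiding [OF m, of h "inv h"] hc by auto
  have yc: "y \<in> carrier G" using y squares_carrier by auto
  have k: "\<phi> x = \<phi> h" if "x \<in> squares" "x \<noteq> \<one>" for x using \<phi>_const [OF nm m that h False] .
  have e: "\<one> \<otimes> (h \<otimes> y) = h \<otimes> y" "h \<otimes> y \<noteq> \<one>"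
    using hc yc y by (auto dest: inv_equality) 
  have "inv h \<otimes> y \<noteq> \<one>" using hc yc y by (metis inv_equality inv_inv inv_closed m_comm)
  have sh: "D a (a \<otimes> x) = \<phi> h" if "a \<in> squares" "x \<in> squares" "x \<noteq> \<one>" for a x
    using D_shift [OF nm that(2), of a] that k squares_carrier by (simp add: \<epsilon>_def)
  have "D \<one> (h \<otimes> y) + D h y = D \<one> h + D \<one> y + D (h \<otimes> y) h + D (h \<otimes> y) y"
    by (rule quad) (use hc yc y e in auto)
  moreover have "D h y = \<phi> h"
    using sh [of h "inv h \<otimes> y"] hc yc h y \<open>inv h \<otimes> y \<noteq> \<one>\<close> by (simp add: cancel_inv0)
  moreover have "D (h \<otimes> y) h = \<phi> h" using sh [of h y] h y hc yc D_sym by simp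
  moreover have "D (h \<otimes> y) y = \<phi> h" using sh [of y h] h y hc yc D_sym False by (simp add: m_comm)
  moreover have "D \<one> (h \<otimes> y) = \<phi> h" "D \<one> y = \<phi> h" using k h y e by (auto simp flip: \<phi>_def)
  ultimately show ?thesis by (simp add: \<phi>_def)
qed simp

lemma D_zero_two_cosets:
  assumes nm: "n = 2 * m" and m: "m \<ge> 4" and a: "a \<in> carrier G" and b: "b \<in> carrier G"
  shows "D a b = 0"
proof -
  have same0: "D x y = 0" if "x \<in> carrier G" "y \<in> carrier G" "same x y" for x y
    using D_same [OF nm that] \<phi>_zero [OF nm m same_inv(2)] that by simp
  have opp: "\<alpha> x + \<alpha> y = 0" if xy: "x \<in> carrier G" "y \<in> carrier G" "\<not> same x y" for x y
  proof -
    have e: "\<epsilon> y = - \<epsilon> x" using \<epsilon>_not_same [OF nm xy] .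
    have "\<epsilon> x * \<beta> x = \<epsilon> x * \<beta> y" using \<beta>_const [OF nm m xy(1,2)] by simp
    then show ?thesis by (simp add: \<beta>_def e algebra_simps)
  qed
  have D0: "D x y = 0" if "x \<in> carrier G" "y \<in> carrier G" for x y
    using same0 [OF that] opp [OF that] D_nonsquare [OF that] by (auto simp: same_def)
  then show ?thesis using a b by simp
qed

section \<open>Bijective squaring: midpoints\<close>

text \<open>When squaring is bijective, every ordered pair is (r/z, rz) for a unique midpoint
  \<open>r\<close> and a unique \<open>z\<close>. In these coordinates \<open>F\<close> sums over
  the pairs with a given midpoint, \<open>H\<close> over the pairs with a given z, and
  \<open>Q\<close> joins r to its two neighbours rxx and r/(xx).\<close>

definition D_mid where "D_mid r z = D (r \<otimes> inv z) (r \<otimes> z)"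
definition F where "F r = (\<Sum>z\<in>carrier G. D_mid r z)"
definition H where "H x = (\<Sum>r\<in>carrier G. D_mid r x)"
definition Q where "Q r x = D_mid (r \<otimes> x) x + D_mid (r \<otimes> inv x) x"

lemma D_mid_inv: "\<lbrakk>r \<in> carrier G; z \<in> carrier G\<rbrakk> \<Longrightarrow> D_mid r (inv z) = D_mid r z"
  unfolding D_mid_def using D_sym [of "r \<otimes> inv z" "r \<otimes> z"] by simp

lemma D_mid_one [simp]: "r \<in> carrier G \<Longrightarrow> D_mid r \<one> = 0"
  by (simp add: D_mid_def D_diag)

lemma D_mid_mult:
  assumes "r \<in> carrier G" "x \<in> carrier G"
  shows "D_mid (r \<otimes> x) x = D r (r \<otimes> (x \<otimes> x))" "D_mid (r \<otimes> inv x) x = D (r \<otimes> inv (x \<otimes> x)) r"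
  using assms by (simp_all add: D_mid_def group_simps)

lemma squares_bij:
  assumes "n = m"
  shows "involutions = {\<one>}" "squares = carrier G"
proof -
  have "card involutions = 1" using card_involutions assms m_pos by simp
  moreover have "\<one> \<in> involutions" by (simp add: involutions_def)
  ultimately show "involutions = {\<one>}" by (metis card_1_singletonE singletonD)
  show "squares = carrier G"
    using card_subset_eq [OF finite_carrier, of squares] assms squares_carrier by (auto simp: n_def m_def)
qed

lemma sum_squared: "n = m \<Longrightarrow> (\<Sum>x\<in>carrier G. f (x \<otimes> x)) = sum f (carrier G)" for f :: "'a \<Rightarrow> real"
  using sum_square [of f] squares_bij by simp

lemma square_eq_one: "\<lbrakk>n = m; x \<in> carrier G; x \<otimes> x = \<one>\<rbrakk> \<Longrightarrow> x = \<one>"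
  using squares_bij(1) by (auto simp: involutions_def)

text \<open>The relation for two pairs with the same midpoint, with z equal to xy and to x/y; the
  conditions on x and y keep both pairs nondegenerate.\<close>

lemma D_mid_quad:
  assumes nm: "n = m" and cl: "r \<in> carrier G" "x \<in> carrier G" "y \<in> carrier G"
    and ne: "x \<noteq> y" "x \<otimes> y \<noteq> \<one>"
  shows "D_mid r (x \<otimes> y) + D_mid r (x \<otimes> inv y)
    = D_mid (r \<otimes> y) x + D_mid (r \<otimes> inv y) x + D_mid (r \<otimes> x) y + D_mid (r \<otimes> inv x) y"
proof -
  let ?a = "r \<otimes> inv (x \<otimes> y)" let ?b = "r \<otimes> (x \<otimes> y)"
  let ?c = "r \<otimes> inv (x \<otimes> inv y)" let ?d = "r \<otimes> (x \<otimes> inv y)"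
  have key: "z = \<one>" if "z \<in> carrier G" "r \<otimes> inv z = r \<otimes> z" for z
  proof (rule square_eq_one [OF nm that(1)])
    have "inv z = z" using that cl by simp
    then show "z \<otimes> z = \<one>" using that(1) by (metis r_inv)
  qed
  have "?a \<noteq> ?b" using key [of "x \<otimes> y"] cl ne by auto
  moreover have "?c \<noteq> ?d"
  proof
    assume "?c = ?d"
    then have "x \<otimes> inv y = \<one>" using key [of "x \<otimes> inv y"] cl by simp
    then show False using cl ne by (metis inv_equality inv_inv inv_closed)
  qed
  moreover have "?a \<otimes> ?b = ?c \<otimes> ?d" using cl by (simp add: group_simps)
  ultimately have "D ?a ?b + D ?c ?d = D ?a ?c + D ?a ?d + D ?b ?c + D ?b ?d"
    using quad [of ?a ?b ?c ?d] cl by simp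
  moreover have "D ?a ?c = D_mid (r \<otimes> inv x) y" "D ?a ?d = D_mid (r \<otimes> inv y) x"
    using cl by (simp_all add: D_mid_def group_simps)
  moreover have "D ?b ?c = D_mid (r \<otimes> y) x" "D ?b ?d = D_mid (r \<otimes> x) y"
    using cl D_sym [of ?b ?c] D_sym [of ?b ?d] by (simp_all add: D_mid_def group_simps)
  ultimately show ?thesis by (simp add: D_mid_def)
qed

text \<open>Summation of \<open>D_mid_quad\<close> over y. The exceptional values y = x and y = inv
  x supply the corrections with D_mid(r, xx) and \<open>Q\<close>.\<close>

lemma sum_D_mid_quad:
  assumes nm: "n = m" and r: "r \<in> carrier G" and x: "x \<in> carrier G" "x \<noteq> \<one>"
  shows "2 * F r - 2 * D_mid r (x \<otimes> x) = 2 * H x - 4 * Q r x + F (r \<otimes> x) + F (r \<otimes> inv x)"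
proof -
  define L where "L y = D_mid r (x \<otimes> y) + D_mid r (x \<otimes> inv y)" for y
  define R where "R y = D_mid (r \<otimes> y) x + D_mid (r \<otimes> inv y) x + D_mid (r \<otimes> x) y + D_mid (r \<otimes> inv x) y" for y
  have ne: "x \<noteq> inv x" using square_eq_one [OF nm x(1)] x by (metis r_inv)
  have "(\<Sum>y\<in>carrier G. L y - R y) = (\<Sum>y\<in>{x, inv x}. L y - R y)"
  proof (rule sum.mono_neutral_right [OF finite_carrier])
    show "\<forall>y\<in>carrier G - {x, inv x}. L y - R y = 0"
    proof
      fix y assume y: "y \<in> carrier G - {x, inv x}"
      have "x \<otimes> y \<noteq> \<one>" using y x by (metis DiffE inv_equality insertI1 insertI2 m_comm)
      then show "L y - R y = 0" using D_mid_quad [OF nm r x(1), of y] y by (auto simp add: L_def R_def)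
    qed
  qed (use x in auto)
  also have "\<dots> = (L x - R x) + (L (inv x) - R (inv x))" using ne by simp
  also have "L x = D_mid r (x \<otimes> x)" using x r by (simp add: L_def)
  also have "L (inv x) = D_mid r (x \<otimes> x)" using x r by (simp add: L_def)
  also have "R x = 2 * Q r x" by (simp add: R_def Q_def)
  also have "R (inv x) = 2 * Q r x" using x r by (simp add: R_def Q_def D_mid_inv)
  finally have "sum L (carrier G) - sum R (carrier G) = 2 * D_mid r (x \<otimes> x) - 4 * Q r x"
    by (simp add: sum_subtractf)
  moreover have "sum L (carrier G) = 2 * F r"
    using sum_mult [OF x(1), of "D_mid r"] sum_mult_inv [OF x(1), of "D_mid r"]
    by (simp add: L_def sum.distrib F_def)
  moreover have "sum R (carrier G) = 2 * H x + F (r \<otimes> x) + F (r \<otimes> inv x)"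
    using sum_mult [OF r, of "\<lambda>z. D_mid z x"] sum_mult_inv [OF r, of "\<lambda>z. D_mid z x"]
    by (simp add: R_def sum.distrib F_def H_def)
  ultimately show ?thesis by simp
qed

text \<open>An instance of \<open>partner_sum\<close> for the pair r/(xx), rxx, whose product rr has
  r as its only root.\<close>

lemma partner_sum_mid:
  assumes nm: "n = m" and r: "r \<in> carrier G" and x: "x \<in> carrier G" "x \<noteq> \<one>"
  shows "(n - 1) * D_mid r (x \<otimes> x) + F r
    = 2 * (s (r \<otimes> inv (x \<otimes> x)) + s (r \<otimes> (x \<otimes> x))) - 2 * Q r x"
proof -
  let ?a = "r \<otimes> inv (x \<otimes> x)" let ?b = "r \<otimes> (x \<otimes> x)"
  have ab: "?a \<otimes> ?b = r \<otimes> r" using r x(1) by (simp add: group_simps)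
  have "?a \<noteq> ?b"
  proof
    assume "?a = ?b"
    then have "inv (x \<otimes> x) = x \<otimes> x" using r x by simp
    then have "(x \<otimes> x) \<otimes> (x \<otimes> x) = \<one>" using x(1) by (metis m_closed r_inv)
    then show False using square_eq_one [OF nm] x by (metis m_closed)
  qed
  have "card (roots (r \<otimes> r)) = 1"
    using card_square_roots [OF square_mem [OF r]] squares_bij [OF nm] by (simp add: roots_def)
  moreover have "r \<in> roots (r \<otimes> r)" using r by (simp add: roots_def)
  ultimately have R: "roots (r \<otimes> r) = {r}" by (metis card_1_singletonE singletonD)
  have "F r = (\<Sum>c\<in>carrier G. D c ((r \<otimes> r) \<otimes> inv c))"
    using sum_mult_inv [OF r, of "\<lambda>c. D c ((r \<otimes> r) \<otimes> inv c)"] r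
    by (simp add: F_def D_mid_def group_simps cong: sum.cong)
  moreover have "Q r x = D ?a r + D ?b r"
    using r x D_sym [of r ?b] by (simp add: Q_def D_mid_mult)
  moreover have "D_mid r (x \<otimes> x) = D ?a ?b" by (simp add: D_mid_def)
  ultimately show ?thesis using partner_sum [of ?a ?b] \<open>?a \<noteq> ?b\<close> r x R by (simp add: ab)
qed

text \<open>Eliminating \<open>Q\<close> from the two preceding identities also removes
  F(r).\<close>

lemma D_mid_formula:
  assumes "n = m" "r \<in> carrier G" "x \<in> carrier G" "x \<noteq> \<one>"
  shows "n * D_mid r (x \<otimes> x) + H x + (F (r \<otimes> x) + F (r \<otimes> inv x)) / 2
    = 2 * (s (r \<otimes> inv (x \<otimes> x)) + s (r \<otimes> (x \<otimes> x)))"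
  using sum_D_mid_quad [OF assms] partner_sum_mid [OF assms] by (simp add: field_simps)

lemma sum_Q:
  assumes nm: "n = m" and r: "r \<in> carrier G"
  shows "(\<Sum>x\<in>carrier G. Q r x) = 2 * s r"
proof -
  have "(\<Sum>x\<in>carrier G. Q r x) = (\<Sum>x\<in>carrier G. D r (r \<otimes> (x \<otimes> x)) + D r (r \<otimes> inv (x \<otimes> x)))"
    by (rule sum.cong) (use r D_sym in \<open>auto simp: Q_def D_mid_mult\<close>)
  also have "\<dots> = s r + s r"
    using sum_squared [OF nm, of "\<lambda>y. D r (r \<otimes> y)"] sum_squared [OF nm, of "\<lambda>y. D r (r \<otimes> inv y)"]
      sum_mult [OF r, of "D r"] sum_mult_inv [OF r, of "D r"]
    by (simp add: sum.distrib s_def)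
  finally show ?thesis by simp
qed

text \<open>Summation of \<open>partner_sum_mid\<close> over x \<noteq> \<one>. As squaring permutes
  the group, the sums are \<sigma>, F(r) and s(r) up to the omitted term.\<close>

lemma F_formula:
  assumes nm: "n = m" and r: "r \<in> carrier G"
  shows "2 * (n - 1) * F r = 4 * \<sigma> - 8 * s r"
proof -
  let ?S = "carrier G - {\<one>}"
  have rem: "sum f ?S = sum f (carrier G) - f \<one>" for f :: "'a \<Rightarrow> real"
    using finite_carrier by (simp add: sum_diff1)
  have "(\<Sum>x\<in>?S. (n - 1) * D_mid r (x \<otimes> x) + F r)
      = (\<Sum>x\<in>?S. 2 * (s (r \<otimes> inv (x \<otimes> x)) + s (r \<otimes> (x \<otimes> x))) - 2 * Q r x)"
    by (rule sum.cong) (use partner_sum_mid [OF nm r] in auto)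
  then have "(\<Sum>x\<in>carrier G. (n - 1) * D_mid r (x \<otimes> x) + F r) - F r
      = (\<Sum>x\<in>carrier G. 2 * (s (r \<otimes> inv (x \<otimes> x)) + s (r \<otimes> (x \<otimes> x))) - 2 * Q r x) - 4 * s r"
    using r by (simp add: rem Q_def)
  then show ?thesis
    using sum_squared [OF nm, of "D_mid r"] sum_squared [OF nm, of "\<lambda>y. s (r \<otimes> y)"]
      sum_squared [OF nm, of "\<lambda>y. s (r \<otimes> inv y)"] sum_mult [OF r, of s] sum_mult_inv [OF r, of s]
      sum_Q [OF nm r]
    by (simp add: sum.distrib sum_subtractf F_def \<sigma>_def n_def algebra_simps flip: sum_distrib_left)
qed

lemma sum_F:
  assumes nm: "n = m"
  shows "sum F (carrier G) = \<sigma>"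
proof -
  have "sum F (carrier G) = (\<Sum>z\<in>carrier G. \<Sum>r\<in>carrier G. D_mid r z)"
    unfolding F_def by (rule sum.swap)
  also have "\<dots> = (\<Sum>z\<in>carrier G. \<Sum>a\<in>carrier G. D a (a \<otimes> (z \<otimes> z)))"
  proof (rule sum.cong [OF refl])
    fix z assume z: "z \<in> carrier G"
    show "(\<Sum>r\<in>carrier G. D_mid r z) = (\<Sum>a\<in>carrier G. D a (a \<otimes> (z \<otimes> z)))"
      using sum_mult [OF z, of "\<lambda>r. D_mid r z"] z
      by (simp add: D_mid_def group_simps cong: sum.cong)
  qed
  also have "\<dots> = (\<Sum>a\<in>carrier G. \<Sum>z\<in>carrier G. D a (a \<otimes> (z \<otimes> z)))" by (rule sum.swap)
  also have "\<dots> = \<sigma>"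
    unfolding \<sigma>_def
  proof (rule sum.cong [OF refl])
    show "(\<Sum>z\<in>carrier G. D a (a \<otimes> (z \<otimes> z))) = s a" if "a \<in> carrier G" for a
      using sum_squared [OF nm, of "\<lambda>y. D a (a \<otimes> y)"] sum_mult [OF that, of "D a"] by (simp add: s_def)
  qed
  finally show ?thesis .
qed

text \<open>Every ordered pair has one midpoint, so F sums to \<sigma>. Summing
  \<open>F_formula\<close> over r gives a second equation for \<sigma>, and the two differ by a
  factor n - 3.\<close>

lemma \<sigma>_zero:
  assumes nm: "n = m" and "n > 3"
  shows "\<sigma> = 0"
proof -
  have "(\<Sum>r\<in>carrier G. 2 * (n - 1) * F r) = (\<Sum>r\<in>carrier G. 4 * \<sigma> - 8 * s r)"
    by (rule sum.cong) (use F_formula [OF nm] in auto)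
  then have "2 * (n - 1) * \<sigma> = 4 * n * \<sigma> - 8 * \<sigma>"
    using sum_F [OF nm] by (simp add: sum_subtractf n_def flip: sum_distrib_left \<sigma>_def)
  then have "(n - 3) * \<sigma> = 0" by (simp add: algebra_simps)
  then show ?thesis using assms by simp
qed

lemma sum_mid_shift:
  assumes "x \<in> carrier G"
  shows "(\<Sum>r\<in>carrier G. f (r \<otimes> x)) = sum f (carrier G)" "(\<Sum>r\<in>carrier G. f (r \<otimes> inv x)) = sum f (carrier G)"
  using sum_mult [OF assms, of f] sum_mult [OF inv_closed [OF assms], of f] assms
  by (simp_all add: m_comm cong: sum.cong)

text \<open>Summed over r, the two identities become H(xx) = -(n - 4) H(x) and H(xx) = -H(x), which
  are incompatible for n > 5 unless H(x) = 0.\<close>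

lemma H_zero:
  assumes nm: "n = m" and n: "n > 5" and x: "x \<in> carrier G" "x \<noteq> \<one>"
  shows "H x = 0"
proof -
  have \<sigma>: "\<sigma> = 0" using \<sigma>_zero [OF nm] n by simp
  have xx: "x \<otimes> x \<in> carrier G" using x by simp
  have "(\<Sum>r\<in>carrier G. 2 * F r - 2 * D_mid r (x \<otimes> x))
     = (\<Sum>r\<in>carrier G. 2 * H x - 4 * Q r x + F (r \<otimes> x) + F (r \<otimes> inv x))"
    by (rule sum.cong) (use sum_D_mid_quad [OF nm _ x] in auto)
  moreover have "(\<Sum>r\<in>carrier G. Q r x) = 2 * H x"
    using sum_mid_shift [OF x(1), of "\<lambda>r. D_mid r x"] by (simp add: Q_def H_def sum.distrib)
  ultimately have 1: "- 2 * H (x \<otimes> x) = 2 * n * H x - 8 * H x"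
    using sum_mid_shift [OF x(1), of F] \<sigma> sum_F [OF nm]
    by (simp add: sum.distrib sum_subtractf n_def flip: sum_distrib_left H_def)
  have "(\<Sum>r\<in>carrier G. n * D_mid r (x \<otimes> x) + H x + (F (r \<otimes> x) + F (r \<otimes> inv x)) / 2)
      = (\<Sum>r\<in>carrier G. 2 * (s (r \<otimes> inv (x \<otimes> x)) + s (r \<otimes> (x \<otimes> x))))"
    by (rule sum.cong) (use D_mid_formula [OF nm _ x] in auto)
  then have "n * H (x \<otimes> x) + n * H x = 0"
    using sum_mid_shift [OF x(1), of F] sum_mid_shift [OF xx, of s] \<sigma> sum_F [OF nm]
    by (simp add: sum.distrib n_def flip: sum_distrib_left sum_divide_distrib H_def \<sigma>_def)
  then have "H (x \<otimes> x) = - H x" using n_pos by (simp flip: distrib_left)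
  with 1 have "(n - 5) * H x = 0" by (simp add: algebra_simps)
  then show ?thesis using n by simp
qed

text \<open>\<open>D_mid_formula\<close> at the midpoint azz, with H = 0 and F a multiple of s. It
  expresses \<open>D\<close> through s alone, so that only s has to be shown to vanish.\<close>

lemma D_mid_eq:
  assumes nm: "n = m" and n: "n > 5" and a: "a \<in> carrier G" and z: "z \<in> carrier G" "z \<noteq> \<one>"
  shows "n * D a (a \<otimes> ((z \<otimes> z) \<otimes> (z \<otimes> z)))
    = 2 * (s a + s (a \<otimes> ((z \<otimes> z) \<otimes> (z \<otimes> z)))) + 2 / (n - 1) * (s (a \<otimes> (z \<otimes> (z \<otimes> z))) + s (a \<otimes> z))"
proof -
  let ?r = "a \<otimes> (z \<otimes> z)"
  have F: "F x = - 4 / (n - 1) * s x" if "x \<in> carrier G" for x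
    using F_formula [OF nm that] \<sigma>_zero [OF nm] n by (simp add: field_simps)
  have e: "?r \<otimes> z = a \<otimes> (z \<otimes> (z \<otimes> z))" "?r \<otimes> inv z = a \<otimes> z" "?r \<otimes> inv (z \<otimes> z) = a"
      "?r \<otimes> (z \<otimes> z) = a \<otimes> ((z \<otimes> z) \<otimes> (z \<otimes> z))"
    using a z(1) by (simp_all add: group_simps)
  have "D_mid ?r (z \<otimes> z) = D a (a \<otimes> ((z \<otimes> z) \<otimes> (z \<otimes> z)))" unfolding D_mid_def e ..
  then have "n * D a (a \<otimes> ((z \<otimes> z) \<otimes> (z \<otimes> z))) + H z + (F (a \<otimes> (z \<otimes> (z \<otimes> z))) + F (a \<otimes> z)) / 2
      = 2 * (s a + s (a \<otimes> ((z \<otimes> z) \<otimes> (z \<otimes> z))))"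
    using D_mid_formula [OF nm _ z, of ?r] a z(1) unfolding e by simp
  moreover define \<delta> where "\<delta> = 2 / (n - 1)"
  moreover have "F (a \<otimes> (z \<otimes> (z \<otimes> z))) = - 2 * (\<delta> * s (a \<otimes> (z \<otimes> (z \<otimes> z))))"
    "F (a \<otimes> z) = - 2 * (\<delta> * s (a \<otimes> z))" using F a z(1) by (simp_all add: \<delta>_def)
  moreover have "H z = 0" by (rule H_zero [OF nm n z])
  moreover have "A = B + \<delta> * (u + v)"
    if "A + h + (f + g) / 2 = B" "f = - 2 * (\<delta> * u)" "g = - 2 * (\<delta> * v)" "h = 0" for A B f g h u v
    using that by (simp add: field_simps)
  ultimately show ?thesis unfolding \<delta>_def by blast
qed

text \<open>A maximum principle: the previous identity, summed over \<open>z\<close>, expresses \<open>(n - 4) s(a)\<close> through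
  an average of values of \<open>s\<close> with total weight less than \<open>n - 4\<close>.\<close>

lemma s_zero:
  assumes nm: "n = m" and n: "n \<ge> 7" and b: "b \<in> carrier G"
  shows "s b = 0"
proof -
  let ?S = "carrier G - {\<one>}"
  have rem: "sum f ?S = sum f (carrier G) - f \<one>" for f :: "'a \<Rightarrow> real"
    using finite_carrier by (simp add: sum_diff1)
  have cS: "real (card ?S) = n - 1" using rem [of "\<lambda>_. 1"] by (simp add: n_def)
  have \<sigma>: "\<sigma> = 0" using \<sigma>_zero [OF nm] n by simp
  define M where "M = Max ((\<lambda>x. \<bar>s x\<bar>) ` carrier G)"
  have M: "\<bar>s x\<bar> \<le> M" if "x \<in> carrier G" for x
    unfolding M_def using finite_carrier that by simp
  have "M \<in> (\<lambda>x. \<bar>s x\<bar>) ` carrier G"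
    unfolding M_def using finite_carrier b by (intro Max_in) auto
  then obtain a where a: "a \<in> carrier G" "M = \<bar>s a\<bar>" by auto
  have four: "(\<Sum>z\<in>carrier G. f (a \<otimes> ((z \<otimes> z) \<otimes> (z \<otimes> z)))) = sum f (carrier G)" for f :: "'a \<Rightarrow> real"
    using sum_squared [OF nm, of "\<lambda>y. f (a \<otimes> (y \<otimes> y))"] sum_squared [OF nm, of "\<lambda>y. f (a \<otimes> y)"]
      sum_mult [OF a(1), of f] by simp
  \<comment> \<open>Fourth powers permute the group, so sums over them are known. Cubing is not
    injective if 3 divides the order, so this sum is only estimated.\<close>
  define T where "T = (\<Sum>z\<in>?S. s (a \<otimes> (z \<otimes> (z \<otimes> z))))"
  have "(\<Sum>z\<in>?S. n * D a (a \<otimes> ((z \<otimes> z) \<otimes> (z \<otimes> z)))) = (\<Sum>z\<in>?S. 2 * (s a + s (a \<otimes> ((z \<otimes> z) \<otimes> (z \<otimes> z)))) 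
       + 2 / (n - 1) * (s (a \<otimes> (z \<otimes> (z \<otimes> z))) + s (a \<otimes> z)))"
    by (rule sum.cong) (use D_mid_eq [OF nm _ a(1)] n in auto)
  also have "\<dots> = (\<Sum>z\<in>?S. 2 * (s a + s (a \<otimes> ((z \<otimes> z) \<otimes> (z \<otimes> z))))) + 2 / (n - 1) * (T + (\<Sum>z\<in>?S. s (a \<otimes> z)))"
    by (simp only: sum.distrib T_def flip: sum_distrib_left)
  also have "(\<Sum>z\<in>?S. s (a \<otimes> z)) = - s a" using sum_mult [OF a(1), of s] \<sigma> a(1) by (simp add: rem \<sigma>_def)
  also have "(\<Sum>z\<in>?S. 2 * (s a + s (a \<otimes> ((z \<otimes> z) \<otimes> (z \<otimes> z))))) = (2 * n - 4) * s a"
  proof -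
    have "(\<Sum>z\<in>?S. s (a \<otimes> ((z \<otimes> z) \<otimes> (z \<otimes> z)))) = - s a"
      using four [of s] \<sigma> a(1) by (simp add: rem \<sigma>_def)
    moreover have c: "real (card (carrier G) - Suc 0) = n - 1" using cS by simp
    ultimately show ?thesis by (simp add: c sum.distrib algebra_simps flip: sum_distrib_left)
  qed
  also have "(\<Sum>z\<in>?S. n * D a (a \<otimes> ((z \<otimes> z) \<otimes> (z \<otimes> z)))) = n * s a"
    using four [of "D a"] a(1) by (simp add: rem s_def D_diag flip: sum_distrib_left)
  finally have "(n - 4) * s a = - (2 / (n - 1) * (T - s a))" by (simp add: algebra_simps)
  then have "(n - 4) * (n - 1) * s a = 2 * (s a - T)" using n by (simp add: field_simps)
  then have "\<bar>(n - 4) * (n - 1) * s a\<bar> = 2 * \<bar>s a - T\<bar>" by (simp only: abs_mult abs_numeral)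
  then have "(n - 4) * (n - 1) * M = 2 * \<bar>s a - T\<bar>" using n by (simp add: abs_mult a)
  also have "\<dots> \<le> 2 * (M + (n - 1) * M)"
  proof -
    have "\<bar>T\<bar> \<le> (\<Sum>z\<in>?S. M)"
      unfolding T_def by (rule order_trans [OF sum_abs sum_mono]) (use M a in auto)
    also have "\<dots> = (n - 1) * M" by (simp only: sum_constant cS)
    finally have T: "\<bar>T\<bar> \<le> (n - 1) * M" .
    have "\<bar>s a - T\<bar> \<le> M + \<bar>T\<bar>" using abs_triangle_ineq4 [of "s a" T] unfolding a(2) .
    also have "\<dots> \<le> M + (n - 1) * M" using T by (rule add_left_mono)
    finally show ?thesis by (rule mult_left_mono) simp
  qed
  \<comment> \<open>The coefficient is (n - 4)(n - 1) - 2n.\<close>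
  finally have "(n * (n - 7) + 4) * M \<le> 0" by (simp add: algebra_simps)
  moreover have "n * (n - 7) + 4 > 0" using n by (simp add: add_nonneg_pos)
  ultimately have "M \<le> 0" by (simp add: mult_le_0_iff)
  then show ?thesis using M [OF b] by linarith
qed

lemma D_zero_one_coset:
  assumes nm: "n = m" and n: "n \<ge> 7" and a: "a \<in> carrier G" and b: "b \<in> carrier G"
  shows "D a b = 0"
proof (cases "a = b")
  case False
  have "inv a \<otimes> b \<in> squares" using a b squares_bij [OF nm] by simp
  then obtain w where w: "w \<in> carrier G" "inv a \<otimes> b = w \<otimes> w" by (auto simp: squares_def)
  then have "w \<in> squares" using squares_bij [OF nm] by simp
  then obtain z where z: "z \<in> carrier G" "w = z \<otimes> z" by (auto simp: squares_def)
  have b': "b = a \<otimes> ((z \<otimes> z) \<otimes> (z \<otimes> z))" using w z a b by (metis cancel_inv0(1))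
  then have "z \<noteq> \<one>" using False a by auto
  have "n * D a b = 0"
    using D_mid_eq [OF nm _ a z(1) \<open>z \<noteq> \<one>\<close>] n s_zero [OF nm n] a z by (simp add: b')
  then show ?thesis using n by simp
qed (simp add: D_diag a b)

text \<open>The number of involutions, with \<open>\<one>\<close> counted, is the index of the
  squares; the values 1, 2 and at least 3 select the three arguments. In the last one, index 4 with
  at most two squares would mean an order below 7 or the excluded pair of numbers.\<close>

lemma D_zero:
  assumes "card (carrier G) \<ge> 7" "\<not> (card (carrier G) = 8 \<and> card squares = 2)"
    and "a \<in> carrier G" "b \<in> carrier G"
  shows "D a b = 0"
proof -
  have n: "n \<ge> 7" using assms(1) by (simp add: n_def)
  have t: "n = real (card involutions) * m" by (rule card_involutions)
  have mi: "m = real (card squares)" by (simp add: m_def)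
  consider "card involutions = 0" | "card involutions = 1" | "card involutions = 2" | "card involutions \<ge> 3" by linarith
  then show ?thesis
  proof cases
    case 1
    then show ?thesis using n t by simp
  next
    case 2
    then show ?thesis using D_zero_one_coset n t assms(3,4) by simp
  next
    case 3
    then have "2 * real (card squares) \<ge> 7" using n t mi by simp
    then have "card squares \<ge> 4" by linarith
    then have "m \<ge> 4" unfolding mi by simp
    then show ?thesis using 3 D_zero_two_cosets t assms(3,4) by simp
  next
    case 4
    then have "real (card involutions) * m \<ge> 3 * m" using m_pos by (intro mult_right_mono) auto
    then have "n > 2 * m" using t m_pos by linarith
    moreover have "n \<noteq> 4 * m \<or> m > 2"
    proof (rule ccontr)
      assume c: "\<not> (n \<noteq> 4 * m \<or> m > 2)"
      then have "card (carrier G) = 4 * card squares" "card squares \<le> 2" by (simp_all add: n_def mi)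
      then show False using assms(1,2) by presburger
    qed
    ultimately show ?thesis using D_zero_many_cosets assms by blast
  qed
qed

end

section \<open>Covolumes and determinants\<close>

text \<open>The base 4 is crude but survives the induction: a new factor adds at most twice the
  previous error bound.\<close>

lemma prod_one_plus_bound:
  fixes a :: "'i \<Rightarrow> real"
  assumes "finite I" "0 \<le> e" "e \<le> 1" "\<And>i. i \<in> I \<Longrightarrow> \<bar>a i\<bar> \<le> e"
  shows "\<bar>(\<Prod>i\<in>I. 1 + a i) - 1 - (\<Sum>i\<in>I. a i)\<bar> \<le> 4 ^ card I * e\<^sup>2"
  using assms(1,4)
proof (induction I rule: finite_induct)
  case (insert j I)
  define P where "P = (\<Prod>i\<in>I. 1 + a i)"
  define A where "A = (\<Sum>i\<in>I. a i)"
  have IH: "\<bar>P - 1 - A\<bar> \<le> 4 ^ card I * e\<^sup>2" unfolding P_def A_def using insert by simp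
  have "\<bar>A\<bar> \<le> (\<Sum>i\<in>I. e)"
    unfolding A_def by (rule order_trans [OF sum_abs sum_mono]) (use insert in auto)
  then have A: "\<bar>A\<bar> \<le> real (card I) * e" by simp
  have "real (card I) \<le> 4 ^ card I"
    by (rule less_imp_le, rule order_less_le_trans [OF of_nat_less_two_power]) (rule power_mono; simp)
  then have "\<bar>A\<bar> \<le> 4 ^ card I * e" using A assms(2) by (meson mult_right_mono order_trans)
  moreover have "4 ^ card I * e\<^sup>2 \<le> 4 ^ card I * e"
    using assms(2,3) by (intro mult_left_mono) (auto simp: power2_eq_square mult_left_le)
  ultimately have "\<bar>P - 1\<bar> \<le> 2 * 4 ^ card I * e" using IH by linarith
  then have "\<bar>a j\<bar> * \<bar>P - 1\<bar> \<le> e * (2 * 4 ^ card I * e)"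
    using insert assms(2) by (intro mult_mono) auto
  then have "\<bar>a j * (P - 1)\<bar> \<le> 2 * 4 ^ card I * e\<^sup>2"
    by (simp add: abs_mult power2_eq_square mult_ac)
  moreover have "(1 + a j) * P - 1 - (a j + A) = (P - 1 - A) + a j * (P - 1)" by (simp add: algebra_simps)
  ultimately have "\<bar>(1 + a j) * P - 1 - (a j + A)\<bar> \<le> 3 * (4 ^ card I * e\<^sup>2)" using IH by linarith
  also have "\<dots> \<le> 4 ^ card (insert j I) * e\<^sup>2" using insert by simp
  finally show ?case using insert by (simp add: P_def A_def)
qed simp

text \<open>A permutation other than the identity moves at least two points, so its term in the Leibniz
  formula is of second order.\<close>

lemma det_near_one:
  obtains C :: real where "C \<ge> 0"
    "\<And>M e. \<lbrakk>M \<in> carrier_mat d d; 0 \<le> e; e \<le> 1;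
        \<And>i j. \<lbrakk>i < d; j < d\<rbrakk> \<Longrightarrow> \<bar>M $$ (i, j) - (if i = j then 1 else 0)\<bar> \<le> e\<rbrakk>
      \<Longrightarrow> 1 + (\<Sum>i<d. M $$ (i, i) - 1) - C * e\<^sup>2 \<le> Determinant.det M"
proof
  let ?P = "{p. p permutes {0..<d}}"
  \<comment> \<open>\<open>4 ^ d\<close> comes from the identity permutation; each other permutation
    contributes at most \<open>2 ^ d * e\<^sup>2\<close>.\<close>
  let ?C = "4 ^ d + real (card ?P) * 2 ^ d"
  fix M :: "real mat" and e :: real
  assume M: "M \<in> carrier_mat d d" and e: "0 \<le> e" "e \<le> 1"
    and b: "\<And>i j. \<lbrakk>i < d; j < d\<rbrakk> \<Longrightarrow> \<bar>M $$ (i, j) - (if i = j then 1 else 0)\<bar> \<le> e"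
  define f where "f p = signof p * (\<Prod>i = 0..<d. M $$ (i, p i))" for p
  have fin: "finite ?P" by (simp add: finite_permutations)
  have id: "id \<in> ?P" by (simp add: permutes_id)
  have "Determinant.det M = sum f ?P" unfolding f_def by (rule det_def' [OF M])
  then have det: "Determinant.det M = f id + sum f (?P - {id})" using sum.remove [OF fin id] by metis
  have "\<bar>f p\<bar> \<le> 2 ^ d * e\<^sup>2" if "p \<in> ?P - {id}" for p
  proof -
    have p: "p permutes {0..<d}" "p \<noteq> id" using that by auto
    then obtain i where i: "p i \<noteq> i" by (auto simp: fun_eq_iff)
    then have ii: "i \<in> {0..<d}" using p(1) permutes_not_in by metis
    then have pi: "p i \<in> {0..<d}" using permutes_in_image [OF p(1)] by simp
    have ppi: "p (p i) \<noteq> p i" using i permutes_inj [OF p(1)] by (metis injD)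
    have "\<bar>f p\<bar> = (\<Prod>k = 0..<d. \<bar>M $$ (k, p k)\<bar>)"
      unfolding f_def by (simp add: abs_mult abs_prod sign_def)
    also have "\<dots> = \<bar>M $$ (i, p i)\<bar> * (\<bar>M $$ (p i, p (p i))\<bar> * (\<Prod>k \<in> {0..<d} - {i} - {p i}. \<bar>M $$ (k, p k)\<bar>))"
      using ii pi i by (subst prod.remove [OF _ ii], simp, subst prod.remove [of _ "p i"]) auto
    also have "\<dots> \<le> e * (e * 2 ^ d)"
    proof (intro mult_mono)
      show "\<bar>M $$ (i, p i)\<bar> \<le> e" using b [of i "p i"] i ii pi by auto
      have "p (p i) \<in> {0..<d}" using permutes_in_image [OF p(1)] pi by simp
      then show "\<bar>M $$ (p i, p (p i))\<bar> \<le> e" using b [of "p i" "p (p i)"] ppi pi by auto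
      have "(\<Prod>k \<in> {0..<d} - {i} - {p i}. \<bar>M $$ (k, p k)\<bar>) \<le> (\<Prod>k \<in> {0..<d} - {i} - {p i}. 2)"
      proof (rule prod_mono)
        fix k assume "k \<in> {0..<d} - {i} - {p i}"
        then have k: "k < d" "p k < d" using permutes_in_image [OF p(1), of k] by auto
        have "\<bar>M $$ (k, p k)\<bar> \<le> 2" using b [OF k] e by (auto split: if_splits)
        then show "0 \<le> \<bar>M $$ (k, p k)\<bar> \<and> \<bar>M $$ (k, p k)\<bar> \<le> 2" by simp
      qed
      also have "\<dots> \<le> 2 ^ d"
        using card_mono [of "{0..<d}" "{0..<d} - {i} - {p i}"] by (auto intro!: power_increasing)
      finally show "(\<Prod>k \<in> {0..<d} - {i} - {p i}. \<bar>M $$ (k, p k)\<bar>) \<le> 2 ^ d" .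
    qed (use e in \<open>auto intro!: prod_nonneg mult_nonneg_nonneg\<close>)
    finally show ?thesis by (simp add: power2_eq_square mult_ac)
  qed
  then have "(\<Sum>p\<in>?P - {id}. \<bar>f p\<bar>) \<le> (\<Sum>p\<in>?P - {id}. 2 ^ d * e\<^sup>2)" by (rule sum_mono)
  also have "\<dots> \<le> (\<Sum>p\<in>?P. 2 ^ d * e\<^sup>2)" using fin by (intro sum_mono2) auto
  finally have "\<bar>sum f (?P - {id})\<bar> \<le> real (card ?P) * 2 ^ d * e\<^sup>2"
    using order_trans [OF sum_abs [of f "?P - {id}"]] by (simp add: mult.assoc)
  moreover have "\<bar>f id - 1 - (\<Sum>i<d. M $$ (i, i) - 1)\<bar> \<le> 4 ^ d * e\<^sup>2"
    using prod_one_plus_bound [of "{..<d}" e "\<lambda>i. M $$ (i, i) - 1"] e b [of i i for i]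
    by (simp add: f_def sign_id atLeast0LessThan)
  ultimately show "1 + (\<Sum>i<d. M $$ (i, i) - 1) - ?C * e\<^sup>2 \<le> Determinant.det M"
    unfolding det distrib_right by linarith
qed (simp)

section \<open>Coordinates in an orthonormal basis and covolumes\<close>

text \<open>\<open>V\<close> may be a proper subspace, so the ambient coordinates of a lattice basis
  need not form a square matrix. Coordinates with respect to \<open>us\<close> do, and a Gram
  determinant becomes a squared determinant.\<close>

locale orthonormal_list =
  fixes us :: "'v::euclidean_space list" and V :: "'v set"
  assumes us_distinct: "distinct us" and us_orth: "pairwise Linear_Algebra.orthogonal (set us)"
    and us_norm: "\<And>u. u \<in> set us \<Longrightarrow> norm u = 1" and us_span: "span (set us) = V"
    and us_indep: "independent (set us)"
begin

abbreviation d where "d \<equiv> length us"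

definition coord_mat :: "'v list \<Rightarrow> real mat" where
  "coord_mat vs = Matrix.mat d d (\<lambda>(i, j). us ! i \<bullet> vs ! j)"

lemma coord_mat_carrier [simp]: "coord_mat vs \<in> carrier_mat d d"
  by (simp add: coord_mat_def)

lemma dim_V: "dim V = d"
  using us_span us_indep us_distinct by (metis dim_span_eq_card_independent distinct_card)

lemma us_inner: "i < d \<Longrightarrow> j < d \<Longrightarrow> us ! i \<bullet> us ! j = (if i = j then 1 else 0)"
  using us_orth us_norm us_distinct
  by (auto simp: pairwise_def Linear_Algebra.orthogonal_def nth_eq_iff_index_eq norm_eq_1)

lemma sum_us: "(\<Sum>u\<in>set us. f u) = (\<Sum>i<d. f (us ! i))"
  using sum.reindex_bij_betw [OF bij_betw_nth [OF us_distinct refl refl], of f] by simp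

lemma expand: "x \<in> V \<Longrightarrow> x = (\<Sum>i<d. (us ! i \<bullet> x) *\<^sub>R us ! i)"
  using orthonormal_basis_expand [OF us_orth us_norm, of x] us_span
  by (simp add: sum_us inner_commute)

lemma inner_expand:
  assumes "x \<in> V" shows "y \<bullet> x = (\<Sum>i<d. (us ! i \<bullet> y) * (us ! i \<bullet> x))"
  by (subst expand [OF assms]) (simp add: inner_sum_right inner_commute mult_ac)

lemma coord_mat_combination:
  assumes "P \<in> carrier_mat d d" "\<And>j. j < d \<Longrightarrow> ws ! j = (\<Sum>k<d. P $$ (k, j) *\<^sub>R vs ! k)"
  shows "coord_mat ws = coord_mat vs * P"
proof (rule eq_matI)
  fix i j assume "i < dim_row (coord_mat vs * P)" "j < dim_col (coord_mat vs * P)"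
  then have ij: "i < d" "j < d" using assms by (auto simp: coord_mat_def)
  then show "coord_mat ws $$ (i, j) = (coord_mat vs * P) $$ (i, j)"
    using assms by (simp add: coord_mat_def scalar_prod_def inner_sum_right atLeast0LessThan mult_ac)
qed (use assms in \<open>auto simp: coord_mat_def\<close>)

lemma coord_mat_us: "coord_mat us = 1\<^sub>m d"
  by (rule eq_matI) (auto simp: coord_mat_def us_inner)

lemma index_mult_mat_sum:
  assumes "A \<in> carrier_mat n n" "B \<in> carrier_mat n n" "i < n" "j < n"
  shows "(A * B) $$ (i, j) = (\<Sum>k<n. A $$ (i, k) * B $$ (k, j))"
proof -
  have "(A * B) $$ (i, j) = (\<Sum>k\<in>{0..<n}. row A i $ k * col B j $ k)"
    using assms by (simp add: scalar_prod_def)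
  also have "\<dots> = (\<Sum>k<n. A $$ (i, k) * B $$ (k, j))"
    unfolding atLeast0LessThan by (rule sum.cong) (use assms in auto)
  finally show ?thesis .
qed

text \<open>Separates the perturbation from the lattice: only the Gram matrix of the images of
  \<open>us\<close> involves \<open>g\<close>.\<close>

lemma gram_map:
  assumes "linear g" "length vs = d" "set vs \<subseteq> V"
  shows "gram_matrix (map g vs) = transpose_mat (coord_mat vs) * (gram_matrix (map g us) * coord_mat vs)"
proof (rule eq_matI)
  interpret linear g by fact
  fix i j
  assume "i < dim_row (transpose_mat (coord_mat vs) * (gram_matrix (map g us) * coord_mat vs))"
    "j < dim_col (transpose_mat (coord_mat vs) * (gram_matrix (map g us) * coord_mat vs))"
  then have ij: "i < d" "j < d" by (auto simp: coord_mat_def)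
  have g: "g (vs ! k) = (\<Sum>i<d. (us ! i \<bullet> vs ! k) *\<^sub>R g (us ! i))" if "k < d" for k
  proof -
    have "vs ! k \<in> V" using assms that by auto
    then have "g (vs ! k) = g (\<Sum>i<d. (us ! i \<bullet> vs ! k) *\<^sub>R us ! i)" using expand by metis
    then show ?thesis by (simp add: sum scale)
  qed
  have G: "gram_matrix (map g us) \<in> carrier_mat d d" by (simp add: gram_matrix_def)
  have T: "transpose_mat (coord_mat vs) \<in> carrier_mat d d" by simp
  have "(transpose_mat (coord_mat vs) * (gram_matrix (map g us) * coord_mat vs)) $$ (i, j)
      = (\<Sum>k<d. (us ! k \<bullet> vs ! i) * (gram_matrix (map g us) * coord_mat vs) $$ (k, j))"
    unfolding index_mult_mat_sum [OF T mult_carrier_mat [OF G coord_mat_carrier] ij]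
    by (rule sum.cong) (use ij in \<open>auto simp: coord_mat_def\<close>)
  also have "\<dots> = (\<Sum>k<d. (us ! k \<bullet> vs ! i) * (\<Sum>l<d. (g (us ! k) \<bullet> g (us ! l)) * (us ! l \<bullet> vs ! j)))"
  proof (rule sum.cong [OF refl])
    fix k assume "k \<in> {..<d}"
    then have k: "k < d" by simp
    show "(us ! k \<bullet> vs ! i) * (gram_matrix (map g us) * coord_mat vs) $$ (k, j)
        = (us ! k \<bullet> vs ! i) * (\<Sum>l<d. (g (us ! k) \<bullet> g (us ! l)) * (us ! l \<bullet> vs ! j))"
      unfolding index_mult_mat_sum [OF G coord_mat_carrier k ij(2)]
      by (intro arg_cong2 [of _ _ _ _ "(*)"] sum.cong) (use k ij in \<open>auto simp: coord_mat_def gram_matrix_def\<close>)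
  qed
  also have "\<dots> = gram_matrix (map g vs) $$ (i, j)"
    using ij assms
    by (simp add: gram_matrix_def g inner_sum_left inner_sum_right sum_distrib_left mult_ac)
  finally show "gram_matrix (map g vs) $$ (i, j)
      = (transpose_mat (coord_mat vs) * (gram_matrix (map g us) * coord_mat vs)) $$ (i, j)" by simp
qed (use assms in \<open>auto simp: gram_matrix_def coord_mat_def\<close>)

lemma det_gram_map:
  assumes "linear g" "length vs = d" "set vs \<subseteq> V"
  shows "Determinant.det (gram_matrix (map g vs))
    = Determinant.det (gram_matrix (map g us)) * (Determinant.det (coord_mat vs))\<^sup>2"
proof -
  have G: "gram_matrix (map g us) \<in> carrier_mat d d" by (simp add: gram_matrix_def)
  have T: "transpose_mat (coord_mat vs) \<in> carrier_mat d d" by simp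
  show ?thesis unfolding gram_map [OF assms]
    using det_mult [OF T mult_carrier_mat [OF G coord_mat_carrier]] det_mult [OF G coord_mat_carrier]
      det_transpose [OF coord_mat_carrier]
    by (simp add: power2_eq_square)
qed

lemma det_gram:
  assumes "length vs = d" "set vs \<subseteq> V"
  shows "Determinant.det (gram_matrix vs) = (Determinant.det (coord_mat vs))\<^sup>2"
proof -
  have "gram_matrix us = 1\<^sub>m d"
    by (rule eq_matI) (auto simp: gram_matrix_def us_inner)
  then show ?thesis using det_gram_map [OF linear_id assms] by (simp add: id_def)
qed

end

lemma int_span_subset_span: "int_span B \<subseteq> span B"
  unfolding int_span_def by (auto intro!: span_sum span_scale intro: span_base)

lemma int_span_superset:
  assumes "finite B" shows "B \<subseteq> int_span B"
proof
  fix b assume b: "b \<in> B"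
  have "(\<Sum>x\<in>B. of_int (if x = b then 1 else 0) *\<^sub>R x) = (\<Sum>x\<in>B. if x = b then x else 0)"
    by (rule sum.cong) auto
  also have "\<dots> = b" using assms b by simp
  finally show "b \<in> int_span B" unfolding int_span_def by (intro range_eqI) (rule sym)
qed

lemma int_span_image:
  assumes "linear g" "inj_on g B"
  shows "int_span (g ` B) = g ` int_span B"
proof -
  interpret linear g by fact
  have 1: "(\<Sum>b\<in>g ` B. of_int (c b) *\<^sub>R b) = g (\<Sum>b\<in>B. of_int (c (g b)) *\<^sub>R b)" for c :: "_ \<Rightarrow> int"
    using assms(2) by (simp add: sum scale sum.reindex)
  have 2: "g (\<Sum>b\<in>B. of_int (c b) *\<^sub>R b) = (\<Sum>b\<in>g ` B. of_int (c (the_inv_into B g b)) *\<^sub>R b)" for c :: "_ \<Rightarrow> int"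
    using assms(2) by (simp add: sum scale sum.reindex the_inv_into_f_f cong: sum.cong)
  show ?thesis
  proof
    show "int_span (g ` B) \<subseteq> g ` int_span B" by (auto simp: int_span_def 1)
    show "g ` int_span B \<subseteq> int_span (g ` B)" by (auto simp: int_span_def 2)
  qed
qed

lemma span_lattice_basis: "lattice_basis vs \<Lambda> \<Longrightarrow> span \<Lambda> = span (set vs)"
  unfolding lattice_basis_def
  by (metis List.finite_set int_span_subset_span int_span_superset span_eq span_superset subset_trans)

context orthonormal_list
begin

lemma lattice_basis_in:
  assumes "lattice_basis vs \<Lambda>" "span \<Lambda> = V"
  shows "length vs = d" "set vs \<subseteq> V" "span (set vs) = V"
proof -
  show V: "span (set vs) = V" using span_lattice_basis assms by metis
  then show "set vs \<subseteq> V" using span_superset by metis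
  show "length vs = d"
    using dim_V V assms unfolding lattice_basis_def by (metis dim_span_eq_card_independent distinct_card)
qed

lemma sum_list_basis:
  assumes "lattice_basis vs \<Lambda>" "span \<Lambda> = V"
  shows "(\<Sum>v\<in>set vs. f v) = (\<Sum>i<d. f (vs ! i))"
  using sum.reindex_bij_betw [OF bij_betw_nth [of vs, OF _ refl refl], of f] lattice_basis_in(1) [OF assms] assms
  by (simp add: lattice_basis_def)

text \<open>The vectors \<open>us\<close> are combinations of \<open>vs\<close>, which gives the
  coordinate matrix a right inverse.\<close>

lemma det_coord_mat_nonzero:
  assumes "lattice_basis vs \<Lambda>" "span \<Lambda> = V"
  shows "Determinant.det (coord_mat vs) \<noteq> 0"
proof -
  have "\<exists>c. us ! j = (\<Sum>k<d. c k *\<^sub>R vs ! k)" if "j < d" for j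
  proof -
    have "us ! j \<in> span (set vs)"
      using lattice_basis_in(3) [OF assms] us_span that by (metis nth_mem span_base)
    then obtain c where "us ! j = (\<Sum>v\<in>set vs. c v *\<^sub>R v)" by (auto simp: span_finite)
    then show ?thesis using sum_list_basis [OF assms, of "\<lambda>v. c v *\<^sub>R v"] by auto
  qed
  then obtain c where c: "\<And>j. j < d \<Longrightarrow> us ! j = (\<Sum>k<d. c j k *\<^sub>R vs ! k)" by metis
  define P where "P = Matrix.mat d d (\<lambda>(k, j). c j k)"
  have P: "P \<in> carrier_mat d d" by (simp add: P_def)
  have "coord_mat us = coord_mat vs * P"
    by (rule coord_mat_combination [OF P]) (use c in \<open>simp add: P_def\<close>)
  then have "Determinant.det (coord_mat vs) * Determinant.det P = 1"
    using det_mult [OF coord_mat_carrier P, of vs] coord_mat_us det_one by metis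
  then show ?thesis by auto
qed

lemma det_coord_mat_multiple:
  assumes "lattice_basis vs \<Lambda>" "lattice_basis ws \<Lambda>" "span \<Lambda> = V"
  shows "\<exists>p. Determinant.det (coord_mat ws) = Determinant.det (coord_mat vs) * of_int p"
proof -
  have "\<exists>c :: nat \<Rightarrow> int. ws ! j = (\<Sum>k<d. of_int (c k) *\<^sub>R vs ! k)" if "j < d" for j
  proof -
    have "ws ! j \<in> set ws" using that lattice_basis_in(1) [OF assms(2,3)] by simp
    then have "ws ! j \<in> int_span (set ws)" using int_span_superset by (metis List.finite_set subsetD)
    then have "ws ! j \<in> int_span (set vs)" using assms by (simp add: lattice_basis_def)
    then obtain c :: "_ \<Rightarrow> int" where "ws ! j = (\<Sum>v\<in>set vs. of_int (c v) *\<^sub>R v)" by (auto simp: int_span_def)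
    then show ?thesis using sum_list_basis [OF assms(1,3), of "\<lambda>v. of_int (c v) *\<^sub>R v"] 
      by (intro exI [of _ "\<lambda>k. c (vs ! k)"]) simp
  qed
  then obtain c :: "nat \<Rightarrow> nat \<Rightarrow> int" where c: "\<And>j. j < d \<Longrightarrow> ws ! j = (\<Sum>k<d. of_int (c j k) *\<^sub>R vs ! k)" by metis
  define Z where "Z = Matrix.mat d d (\<lambda>(k, j). c j k)"
  define P :: "real mat" where "P = map_mat of_int Z"
  have P: "P \<in> carrier_mat d d" by (simp add: P_def Z_def)
  have "coord_mat ws = coord_mat vs * P"
    by (rule coord_mat_combination [OF P]) (use c in \<open>simp add: P_def Z_def\<close>)
  moreover have "Determinant.det P = of_int (Determinant.det Z)" unfolding P_def by (rule of_int_hom.hom_det)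
  ultimately show ?thesis using det_mult [OF coord_mat_carrier P, of vs] by metis
qed

text \<open>Frees \<open>covolume\<close> from the basis picked by \<open>SOME\<close>: the
  determinants for two bases are nonzero integer multiples of each other, hence equal in absolute
  value.\<close>

lemma covolume_eq:
  assumes vs: "lattice_basis vs \<Lambda>" and V: "span \<Lambda> = V"
  shows "covolume \<Lambda> = \<bar>Determinant.det (coord_mat vs)\<bar>" "covolume \<Lambda> > 0"
proof -
  define ws where "ws = (SOME bs. lattice_basis bs \<Lambda>)"
  have ws: "lattice_basis ws \<Lambda>" unfolding ws_def using vs by (rule someI)
  have le: "\<bar>Determinant.det (coord_mat xs)\<bar> \<le> \<bar>Determinant.det (coord_mat ys)\<bar>"
    if xy: "lattice_basis xs \<Lambda>" "lattice_basis ys \<Lambda>" for xs ys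
  proof -
    obtain p where p: "Determinant.det (coord_mat ys) = Determinant.det (coord_mat xs) * of_int p"
      using det_coord_mat_multiple [OF xy V] by blast
    then have "p \<noteq> 0" using det_coord_mat_nonzero [OF xy(2) V] by auto
    then have "\<bar>real_of_int p\<bar> \<ge> 1" by linarith
    then show ?thesis unfolding p abs_mult by (simp add: mult_le_cancel_left1)
  qed
  have "covolume \<Lambda> = \<bar>Determinant.det (coord_mat ws)\<bar>"
    unfolding covolume_def ws_def [symmetric] using det_gram lattice_basis_in [OF ws V] by simp
  then show eq: "covolume \<Lambda> = \<bar>Determinant.det (coord_mat vs)\<bar>" using le vs ws by (metis order_antisym)
  show "covolume \<Lambda> > 0" using det_coord_mat_nonzero [OF vs V] eq by simp
qed

lemma covolume_image:
  assumes vs: "lattice_basis vs \<Lambda>" and V: "span \<Lambda> = V" and g: "g \<in> GL V"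
  shows "(covolume (g ` \<Lambda>))\<^sup>2 = Determinant.det (gram_matrix (map g us)) * (covolume \<Lambda>)\<^sup>2"
    "covolume (g ` \<Lambda>) > 0"
proof -
  have lin: "linear g" and bij: "bij_betw g V V" using g by (auto simp: GL_def)
  note vs' = lattice_basis_in [OF vs V]
  have injV: "inj_on g V" using bij by (simp add: bij_betw_def)
  then have inj: "inj_on g (set vs)" using vs'(2) inj_on_subset by blast
  have gvs: "lattice_basis (map g vs) (g ` \<Lambda>)"
    unfolding lattice_basis_def
  proof (intro conjI)
    show "distinct (map g vs)" using vs inj by (simp add: lattice_basis_def distinct_map)
    show "independent (set (map g vs))"
      using linear_independent_injective_image [OF lin] vs injV vs'(3) by (simp add: lattice_basis_def)
    show "int_span (set (map g vs)) = g ` \<Lambda>"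
      using int_span_image [OF lin inj] vs by (simp add: lattice_basis_def)
  qed
  have gV: "span (g ` \<Lambda>) = V"
    using linear_span_image [OF lin, of \<Lambda>] V bij by (simp add: bij_betw_def)
  have "(covolume (g ` \<Lambda>))\<^sup>2 = (Determinant.det (coord_mat (map g vs)))\<^sup>2"
    using covolume_eq(1) [OF gvs gV] by simp
  also have "\<dots> = Determinant.det (gram_matrix (map g vs))"
    using det_gram lattice_basis_in [OF gvs gV] by simp
  also have "\<dots> = Determinant.det (gram_matrix (map g us)) * (covolume \<Lambda>)\<^sup>2"
    using det_gram_map [OF lin vs'(1,2)] covolume_eq(1) [OF vs V] by simp
  finally show "(covolume (g ` \<Lambda>))\<^sup>2 = Determinant.det (gram_matrix (map g us)) * (covolume \<Lambda>)\<^sup>2" .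
  show "covolume (g ` \<Lambda>) > 0" by (rule covolume_eq(2) [OF gvs gV])
qed

end

section \<open>The lattice of a finite abelian group\<close>

lemma int_span_insert:
  assumes "finite B" "v \<notin> B"
  shows "int_span (insert v B) = {of_int q *\<^sub>R v + y |q y. y \<in> int_span B}"
proof -
  have 1: "(\<Sum>b\<in>insert v B. of_int (c b) *\<^sub>R b) = of_int (c v) *\<^sub>R v + (\<Sum>b\<in>B. of_int (c b) *\<^sub>R b)" for c :: "_ \<Rightarrow> int"
    using assms by simp
  have 2: "of_int q *\<^sub>R v + (\<Sum>b\<in>B. of_int (c b) *\<^sub>R b) = (\<Sum>b\<in>insert v B. of_int ((c(v := q)) b) *\<^sub>R b)"
    for c :: "_ \<Rightarrow> int" and q
  proof -
    have "(\<Sum>b\<in>B. of_int (c b) *\<^sub>R b) = (\<Sum>b\<in>B. of_int ((c(v := q)) b) *\<^sub>R b)"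
      by (rule sum.cong) (use assms in auto)
    then show ?thesis using assms by simp
  qed
  show ?thesis
  proof
    show "int_span (insert v B) \<subseteq> {of_int q *\<^sub>R v + y |q y. y \<in> int_span B}"
    proof
      fix x assume "x \<in> int_span (insert v B)"
      then obtain c :: "_ \<Rightarrow> int" where "x = (\<Sum>b\<in>insert v B. of_int (c b) *\<^sub>R b)"
        unfolding int_span_def by blast
      then have "x = of_int (c v) *\<^sub>R v + (\<Sum>b\<in>B. of_int (c b) *\<^sub>R b)" using 1 by simp
      then show "x \<in> {of_int q *\<^sub>R v + y |q y. y \<in> int_span B}" unfolding int_span_def by blast
    qed
    show "{of_int q *\<^sub>R v + y |q y. y \<in> int_span B} \<subseteq> int_span (insert v B)"
    proof safe
      fix q y assume "y \<in> int_span B"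
      then obtain c :: "_ \<Rightarrow> int" where "y = (\<Sum>b\<in>B. of_int (c b) *\<^sub>R b)" unfolding int_span_def by blast
      then show "of_int q *\<^sub>R v + y \<in> int_span (insert v B)"
        unfolding int_span_def using 2 [of q c] by (intro range_eqI [of _ _ "c(v := q)"]) simp
    qed
  qed
qed

lemma int_multiple_mem:
  fixes L :: "'v::real_vector set"
  assumes "0 \<in> L" "\<And>x y. x \<in> L \<Longrightarrow> y \<in> L \<Longrightarrow> x - y \<in> L" "v \<in> L"
  shows "of_int q *\<^sub>R v \<in> L"
proof -
  have add: "x + y \<in> L" if "x \<in> L" "y \<in> L" for x y
    using assms(2) [OF that(1) assms(2) [OF assms(1) that(2)]] by simp
  have nat: "real k *\<^sub>R v \<in> L" for k
    by (induction k) (use assms add in \<open>auto simp: scaleR_left_distrib\<close>)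
  show ?thesis
  proof (cases "q \<ge> 0")
    case True
    then show ?thesis using nat [of "nat q"] by simp
  next
    case False
    then show ?thesis using assms(2) [OF assms(1) nat [of "nat (- q)"]] by simp
  qed
qed

text \<open>Hermite reduction, one coordinate at a time: a basis of the sublattice with vanishing
  i-th coordinate is extended by a vector whose i-th coordinate has least positive absolute value.
  Division with remainder shows that this vector generates the rest.\<close>

lemma exists_int_basis:
  fixes L :: "(real ^ 'a::finite) set"
  assumes "finite I" "0 \<in> L" "\<And>x y. x \<in> L \<Longrightarrow> y \<in> L \<Longrightarrow> x - y \<in> L"
    and "\<And>x a. x \<in> L \<Longrightarrow> vec_nth x a \<in> \<int>" "\<And>x a. x \<in> L \<Longrightarrow> a \<notin> I \<Longrightarrow> vec_nth x a = 0"
  shows "\<exists>B. finite B \<and> independent B \<and> int_span B = L"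
  using assms
proof (induction I arbitrary: L rule: finite_induct)
  case empty
  then have "L = {0}" by (auto simp: Finite_Cartesian_Product.vec_eq_iff)
  then show ?case by (intro exI [of _ "{}"]) (simp add: int_span_def independent_empty)
next
  case (insert i I)
  note zero = insert.prems(1) and diff = insert.prems(2) and ints = insert.prems(3) and supp = insert.prems(4)
  define L0 where "L0 = {x \<in> L. vec_nth x i = 0}"
  have "\<exists>B. finite B \<and> independent B \<and> int_span B = L0"
  proof (rule insert.IH)
    show "vec_nth x a = 0" if "x \<in> L0" "a \<notin> I" for x a
      using that supp [of x a] by (cases "a = i") (auto simp: L0_def)
  qed (use zero diff ints in \<open>auto simp: L0_def\<close>)
  then obtain B where B: "finite B" "independent B" "int_span B = L0" by blast
  show ?case
  proof (cases "L \<subseteq> L0")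
    case True
    then have "L0 = L" by (auto simp: L0_def)
    then show ?thesis using B by blast
  next
    case False
    define P where "P k \<longleftrightarrow> k > 0 \<and> (\<exists>v\<in>L. \<bar>vec_nth v i\<bar> = real k)" for k :: nat
    obtain w where w: "w \<in> L" "vec_nth w i \<noteq> 0" using False by (auto simp: L0_def)
    have "\<exists>k. \<bar>vec_nth x i\<bar> = real k" if xL: "x \<in> L" for x
    proof -
      obtain z where "vec_nth x i = of_int z" using ints [OF xL] by (auto elim: Ints_cases)
      then show ?thesis by (intro exI [of _ "nat \<bar>z\<bar>"]) simp
    qed
    note nat = this
    have "\<exists>k. P k" using nat [OF w(1)] w unfolding P_def by (metis abs_eq_0 gr0I of_nat_0)
    then have P: "P (LEAST k. P k)" by (rule LeastI_ex)
    then obtain v where v: "v \<in> L" "\<bar>vec_nth v i\<bar> = real (LEAST k. P k)" "vec_nth v i \<noteq> 0"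
      by (auto simp: P_def)
    have vmin: "\<bar>vec_nth v i\<bar> \<le> \<bar>vec_nth x i\<bar>" if xL: "x \<in> L" and nz: "vec_nth x i \<noteq> 0" for x
    proof -
      obtain k where k: "\<bar>vec_nth x i\<bar> = real k" using nat [OF xL] by blast
      then have "P k" using xL nz unfolding P_def by (metis abs_eq_0 gr0I of_nat_0)
      then show ?thesis using k v(2) Least_le [of P k] by simp
    qed
    have decomp: "\<exists>q. x - of_int q *\<^sub>R v \<in> L0" if x: "x \<in> L" for x
    proof -
      obtain a where a: "vec_nth x i = of_int a" using ints [OF x] by (auto elim: Ints_cases)
      obtain b where b: "vec_nth v i = of_int b" using ints [OF v(1)] by (auto elim: Ints_cases)
      define y where "y = x - of_int (a div b) *\<^sub>R v"
      have y: "y \<in> L" unfolding y_def using int_multiple_mem [OF zero diff v(1)] diff x by blast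
      have "vec_nth y i = of_int (a mod b)"
        by (simp add: y_def a b minus_div_mult_eq_mod [symmetric])
      moreover have "\<bar>a mod b\<bar> < \<bar>b\<bar>" using v(3) b by (simp add: abs_mod_less)
      ultimately have "vec_nth y i = 0" using vmin [OF y] b by force
      then show ?thesis using y unfolding y_def L0_def by blast
    qed
    have "B \<subseteq> {x. vec_nth x i = 0}" using int_span_superset [OF B(1)] B(3) by (auto simp: L0_def)
    moreover have "subspace {x :: real ^ 'a. vec_nth x i = 0}" by (simp add: subspace_def)
    ultimately have "span B \<subseteq> {x. vec_nth x i = 0}" by (rule span_minimal)
    then have vB: "v \<notin> span B" using v(3) by auto
    then have "v \<notin> B" using span_base by blast
    have "int_span (insert v B) = L"
      unfolding int_span_insert [OF B(1) \<open>v \<notin> B\<close>] B(3)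
    proof safe
      fix q y assume y: "y \<in> L0"
      have "y - of_int (- q) *\<^sub>R v \<in> L"
        using int_multiple_mem [OF zero diff v(1)] diff y unfolding L0_def by blast
      then show "of_int q *\<^sub>R v + y \<in> L" by (simp add: add.commute)
    next
      fix x assume "x \<in> L"
      then obtain q where "x - of_int q *\<^sub>R v \<in> L0" using decomp by blast
      then show "\<exists>q y. x = of_int q *\<^sub>R v + y \<and> y \<in> L0"
        by (intro exI [of _ q] exI [of _ "x - of_int q *\<^sub>R v"]) simp
    qed
    moreover have "independent (insert v B)" using B(2) vB by (simp add: independent_insert)
    ultimately show ?thesis using B(1) by blast
  qed
qed

lemma exists_lattice_basis:
  fixes L :: "(real ^ 'a::finite) set"
  assumes "0 \<in> L" "\<And>x y. x \<in> L \<Longrightarrow> y \<in> L \<Longrightarrow> x - y \<in> L" "\<And>x a. x \<in> L \<Longrightarrow> vec_nth x a \<in> \<int>"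
  obtains bs where "lattice_basis bs L"
proof -
  obtain B where B: "finite B" "independent B" "int_span B = L"
    using exists_int_basis [of UNIV L] assms by auto
  obtain bs where "set bs = B" "distinct bs" using finite_distinct_list [OF B(1)] by blast
  then show thesis using that B by (auto simp: lattice_basis_def)
qed

section \<open>The lattice and its span\<close>

locale lattice_group = comm_group A for A :: "('a::finite, 'm) monoid_scheme" (structure)
begin

definition to_real :: "int ^ 'a \<Rightarrow> real ^ 'a" where
  "to_real k = (\<chi> a. real_of_int (vec_nth k a))"

lemma group_lattice_def': "group_lattice A = to_real ` (psi_kernel A \<inter> augmentation_ideal A)"
  unfolding group_lattice_def to_real_def ..

lemma psi_closed [simp]: "psi A k \<in> carrier A"
  unfolding psi_def by (rule finprod_closed) auto

lemma psi_add: "psi A (k + l) = psi A k \<otimes> psi A l"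
proof -
  have "psi A (k + l) = finprod A (\<lambda>a. a [^] vec_nth k a \<otimes> a [^] vec_nth l a) (carrier A)"
    unfolding psi_def by (rule finprod_cong') (auto simp: int_pow_mult)
  also have "\<dots> = psi A k \<otimes> psi A l"
    unfolding psi_def by (rule finprod_multf) auto
  finally show ?thesis .
qed

lemma psi_zero: "psi A 0 = \<one>"
  unfolding psi_def by (rule finprod_one_eqI) simp

lemma psi_diff: "psi A (k - l) = psi A k \<otimes> inv (psi A l)"
proof -
  have "psi A k = psi A (k - l) \<otimes> psi A l" using psi_add [of "k - l" l] by simp
  then show ?thesis by (simp add: inv_solve_right)
qed

lemma psi_axis:
  assumes "a \<in> carrier A"
  shows "psi A (axis a c) = a [^] c"
proof -
  have "psi A (axis a c) = finprod A (\<lambda>b. if a = b then b [^] c else \<one>) (carrier A)"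
    unfolding psi_def by (rule finprod_cong') (auto simp: axis_def)
  also have "\<dots> = a [^] c" by (rule finprod_singleton) (use assms in auto)
  finally show ?thesis .
qed

definition lat where "lat = psi_kernel A \<inter> augmentation_ideal A"

lemma lat_iff: "k \<in> lat \<longleftrightarrow> (\<forall>a. a \<notin> carrier A \<longrightarrow> vec_nth k a = 0) \<and> psi A k = \<one> \<and> (\<Sum>a\<in>carrier A. vec_nth k a) = 0"
  by (auto simp: lat_def psi_kernel_def augmentation_ideal_def int_group_ring_def)

lemma lat_zero: "0 \<in> lat"
  by (simp add: lat_iff psi_zero)

lemma lat_diff: "k \<in> lat \<Longrightarrow> l \<in> lat \<Longrightarrow> k - l \<in> lat"
  by (simp add: lat_iff psi_diff sum_subtractf)

lemma group_lattice_eq: "group_lattice A = to_real ` lat"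
  by (simp add: group_lattice_def' lat_def)

lemma to_real_simps [simp]:
  "to_real 0 = 0" "to_real (k + l) = to_real k + to_real l" "to_real (k - l) = to_real k - to_real l"
  "to_real (axis a c) = of_int c *\<^sub>R axis a 1"
  by (auto simp: to_real_def Finite_Cartesian_Product.vec_eq_iff axis_def)

lemma group_lattice_zero: "0 \<in> group_lattice A"
  unfolding group_lattice_eq by (rule image_eqI [of _ _ 0]) (simp_all add: lat_zero)

lemma group_lattice_diff:
  assumes "x \<in> group_lattice A" "y \<in> group_lattice A"
  shows "x - y \<in> group_lattice A"
proof -
  obtain k l where "k \<in> lat" "l \<in> lat" "x = to_real k" "y = to_real l"
    using assms by (auto simp: group_lattice_eq)
  then show ?thesis unfolding group_lattice_eq by (intro image_eqI [of _ _ "k - l"]) (simp_all add: lat_diff)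
qed

lemma sum_axis:
  fixes c :: "'c::comm_monoid_add"
  assumes "a \<in> carrier A"
  shows "(\<Sum>b\<in>carrier A. vec_nth (axis a c) b) = c"
  using assms by (simp add: axis_def)

lemma quad_mem:
  assumes "a \<in> carrier A" "b \<in> carrier A" "c \<in> carrier A" "d \<in> carrier A" "a \<otimes> b = c \<otimes> d"
  shows "axis a 1 + axis b 1 - axis c 1 - axis d 1 \<in> group_lattice A"
proof -
  let ?k = "axis a 1 + axis b 1 - axis c 1 - axis d 1 :: int ^ 'a"
  have "psi A ?k = (c \<otimes> d) \<otimes> inv c \<otimes> inv d"
    using assms by (simp add: psi_diff psi_add psi_axis)
  also have "\<dots> = \<one>" using assms by (simp add: m_comm [of c d] m_assoc)
  finally have "?k \<in> lat"
    using assms by (auto simp: lat_iff sum.distrib sum_subtractf sum_axis) (auto simp: axis_def)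
  then show ?thesis unfolding group_lattice_eq by (intro image_eqI [of _ _ ?k]) simp_all
qed

definition V\<^sub>0 :: "(real ^ 'a) set" where
  "V\<^sub>0 = {x. (\<forall>a. a \<notin> carrier A \<longrightarrow> vec_nth x a = 0) \<and> (\<Sum>a\<in>carrier A. vec_nth x a) = 0}"

lemma subspace_V\<^sub>0: "subspace V\<^sub>0"
  by (auto simp: subspace_def V\<^sub>0_def sum.distrib simp flip: sum_distrib_left)

lemma group_lattice_V\<^sub>0: "group_lattice A \<subseteq> V\<^sub>0"
  by (auto simp: group_lattice_eq lat_iff V\<^sub>0_def to_real_def simp flip: of_int_sum)

text \<open>The order of each element divides |A|, so |A|(a - \<one>) lies in the lattice, and these
  vectors span the sum-zero part.\<close>

lemma span_group_lattice: "span (group_lattice A) = V\<^sub>0"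
proof
  show "span (group_lattice A) \<subseteq> V\<^sub>0" by (rule span_minimal [OF group_lattice_V\<^sub>0 subspace_V\<^sub>0])
  have ax: "axis a 1 - axis \<one> 1 \<in> span (group_lattice A)" if a: "a \<in> carrier A" for a
  proof -
    let ?N = "int (card (carrier A))"
    let ?k = "axis a ?N - axis \<one> ?N"
    have N: "card (carrier A) > 0" using a by (simp add: card_gt_0_iff) blast
    have "b [^] ?N = \<one>" if "b \<in> carrier A" for b
      using pow_order_eq_1 [OF that] by (simp add: int_pow_int order_def)
    then have "?k \<in> lat"
      using a by (auto simp: lat_iff psi_diff psi_axis sum_subtractf sum_axis) (auto simp: axis_def)
    then have "to_real ?k \<in> group_lattice A" unfolding group_lattice_eq by (rule imageI)
    moreover have "to_real ?k = real (card (carrier A)) *\<^sub>R (axis a 1 - axis \<one> 1)"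
      by (simp add: scaleR_diff_right)
    ultimately have "real (card (carrier A)) *\<^sub>R (axis a 1 - axis \<one> 1) \<in> span (group_lattice A)"
      by (metis span_base)
    then have "inverse (real (card (carrier A))) *\<^sub>R real (card (carrier A)) *\<^sub>R (axis a 1 - axis \<one> 1)
        \<in> span (group_lattice A)" by (rule span_scale)
    moreover have "inverse (real (card (carrier A))) * real (card (carrier A)) = 1"
      by (rule left_inverse) (use N in linarith)
    ultimately show ?thesis by (simp only: scaleR_scaleR scaleR_one)
  qed
  show "V\<^sub>0 \<subseteq> span (group_lattice A)"
  proof
    fix x assume x: "x \<in> V\<^sub>0"
    have "x = (\<Sum>a\<in>carrier A. vec_nth x a *\<^sub>R (axis a 1 - axis \<one> 1))"
    proof (subst Finite_Cartesian_Product.vec_eq_iff, rule allI)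
      fix b
      have "(\<Sum>a\<in>carrier A. vec_nth x a *\<^sub>R (axis a 1 - axis \<one> (1::real))) $ b
          = (\<Sum>a\<in>carrier A. vec_nth x a * vec_nth (axis a 1) b) - (\<Sum>a\<in>carrier A. vec_nth x a) * vec_nth (axis \<one> 1) b"
        by (simp add: right_diff_distrib sum_subtractf sum_distrib_right)
      also have "(\<Sum>a\<in>carrier A. vec_nth x a * vec_nth (axis a 1) b) = (\<Sum>a\<in>carrier A. if a = b then vec_nth x a else 0)"
        by (rule sum.cong) (auto simp: axis_def)
      also have "\<dots> = vec_nth x b" using x by (auto simp: V\<^sub>0_def)
      finally show "vec_nth x b = (\<Sum>a\<in>carrier A. vec_nth x a *\<^sub>R (axis a 1 - axis \<one> 1)) $ b"
        using x by (simp add: V\<^sub>0_def)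
    qed
    moreover have "(\<Sum>a\<in>carrier A. vec_nth x a *\<^sub>R (axis a 1 - axis \<one> 1)) \<in> span (group_lattice A)"
      by (intro span_sum span_scale ax)
    ultimately show "x \<in> span (group_lattice A)" by simp
  qed
qed

section \<open>The minimum of the lattice\<close>

text \<open>A nonzero sum-zero vector of squared length at most 3 has a positive and a negative
  entry, necessarily 1 and -1. The other entries sum to zero, so by parity their squares sum to an
  even number, at most 1. Hence the vector is a - b with a \<noteq> b, which \<open>psi\<close> does
  not kill.\<close>

lemma lat_square_sum:
  assumes k: "k \<in> lat" "k \<noteq> 0"
  shows "(\<Sum>a\<in>UNIV. (vec_nth k a)\<^sup>2) \<ge> 4"
proof (rule ccontr)
  assume "\<not> ?thesis"
  then have less: "(\<Sum>a\<in>UNIV. (vec_nth k a)\<^sup>2) \<le> 3" by simp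
  have out: "vec_nth k a = 0" if "a \<notin> carrier A" for a using k that by (simp add: lat_iff)
  have "(\<Sum>a\<in>UNIV. vec_nth k a) = (\<Sum>a\<in>carrier A. vec_nth k a)"
    by (rule sum.mono_neutral_right) (use out in auto)
  then have sum0: "(\<Sum>a\<in>UNIV. vec_nth k a) = 0" using k by (simp add: lat_iff)
  have "\<exists>a. vec_nth k a > 0"
  proof (rule ccontr)
    assume "\<nexists>a. vec_nth k a > 0"
    then have le: "\<And>a. 0 \<le> - vec_nth k a" by (simp add: not_less)
    moreover have "(\<Sum>a\<in>UNIV. - vec_nth k a) = 0" using sum0 by (simp add: sum_negf)
    ultimately have "\<forall>a\<in>UNIV. - vec_nth k a = 0" by (subst (asm) sum_nonneg_eq_0_iff) auto
    then show False using k by (auto simp: Finite_Cartesian_Product.vec_eq_iff)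
  qed
  then obtain a where a: "vec_nth k a > 0" by blast
  have "\<exists>b. vec_nth k b < 0"
  proof (rule ccontr)
    assume "\<nexists>b. vec_nth k b < 0"
    then have "\<And>b. 0 \<le> vec_nth k b" by (simp add: not_less)
    then have "\<forall>b\<in>UNIV. vec_nth k b = 0" using sum0 by (subst (asm) sum_nonneg_eq_0_iff) auto
    then show False using a by auto
  qed
  then obtain b where b: "vec_nth k b < 0" by blast
  have ab: "a \<noteq> b" using a b by auto
  let ?R = "UNIV - {a} - {b}"
  have split: "(\<Sum>x\<in>UNIV. f x) = f a + (f b + (\<Sum>x\<in>?R. f x))" for f :: "'a \<Rightarrow> int"
    using sum.remove [of UNIV a f] sum.remove [of "UNIV - {a}" b f] ab by simp
  have "(\<Sum>x\<in>?R. (vec_nth k x)\<^sup>2) \<ge> 0" by (simp add: sum_nonneg)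
  then have le3: "(vec_nth k a)\<^sup>2 + (vec_nth k b)\<^sup>2 \<le> 3" using less split [of "\<lambda>x. (vec_nth k x)\<^sup>2"] by linarith
  have a1: "vec_nth k a = 1"
  proof (rule ccontr)
    assume "vec_nth k a \<noteq> 1"
    then have "(vec_nth k a)\<^sup>2 \<ge> 2\<^sup>2" using a by (intro power_mono) auto
    then show False using le3 zero_le_power2 [of "vec_nth k b"] by simp
  qed
  have b1: "vec_nth k b = - 1"
  proof (rule ccontr)
    assume "vec_nth k b \<noteq> - 1"
    then have "(- vec_nth k b)\<^sup>2 \<ge> 2\<^sup>2" using b by (intro power_mono) auto
    then show False using le3 zero_le_power2 [of "vec_nth k a"] by simp
  qed
  have "(\<Sum>x\<in>?R. vec_nth k x) = 0" using split [of "vec_nth k"] sum0 a1 b1 by simp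
  moreover have "even (\<Sum>x\<in>?R. (vec_nth k x)\<^sup>2 - vec_nth k x)" by (rule dvd_sum) (simp add: power2_eq_square)
  ultimately have "even (\<Sum>x\<in>?R. (vec_nth k x)\<^sup>2)" by (simp add: sum_subtractf)
  moreover have "(\<Sum>x\<in>?R. (vec_nth k x)\<^sup>2) \<le> 1" using less split [of "\<lambda>x. (vec_nth k x)\<^sup>2"] a1 b1 by simp
  moreover have "(\<Sum>x\<in>?R. (vec_nth k x)\<^sup>2) \<ge> 0" by (simp add: sum_nonneg)
  ultimately have "(\<Sum>x\<in>?R. (vec_nth k x)\<^sup>2) = 0" by presburger
  then have "\<forall>x\<in>?R. (vec_nth k x)\<^sup>2 = 0" by (subst (asm) sum_nonneg_eq_0_iff) auto
  then have "k = axis a 1 - axis b 1" using a1 b1 ab by (auto simp: Finite_Cartesian_Product.vec_eq_iff axis_def)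
  moreover have "a \<in> carrier A" "b \<in> carrier A" using out a b by force+
  ultimately have "a \<otimes> inv b = \<one>" using k by (simp add: lat_iff psi_diff psi_axis)
  then have "a = b" using \<open>a \<in> carrier A\<close> \<open>b \<in> carrier A\<close> by (metis inv_equality inv_inv inv_closed)
  then show False using ab by simp
qed

lemma norm_group_lattice:
  assumes "x \<in> group_lattice A" "x \<noteq> 0"
  shows "norm x \<ge> 2"
proof -
  obtain k where k: "k \<in> lat" "x = to_real k" using assms by (auto simp: group_lattice_eq)
  then have "(\<Sum>a\<in>UNIV. (vec_nth k a)\<^sup>2) \<ge> 4" using lat_square_sum assms to_real_simps(1) by metis
  then have "real_of_int (\<Sum>a\<in>UNIV. (vec_nth k a)\<^sup>2) \<ge> 4" by linarith
  moreover have "(norm x)\<^sup>2 = real_of_int (\<Sum>a\<in>UNIV. (vec_nth k a)\<^sup>2)"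
    unfolding power2_norm_eq_inner by (simp add: inner_vec_def k to_real_def power2_eq_square)
  ultimately have "(norm x)\<^sup>2 \<ge> 2\<^sup>2" by simp
  then show ?thesis by (rule power2_le_imp_le) simp
qed

lemma exists_basis: obtains bs where "lattice_basis bs (group_lattice A)"
proof (rule exists_lattice_basis [of "group_lattice A"])
  show "vec_nth x a \<in> \<int>" if "x \<in> group_lattice A" for x a
    using that by (auto simp: group_lattice_eq to_real_def)
qed (use group_lattice_zero group_lattice_diff in auto)

lemma full_rank: "full_rank_lattice (span (group_lattice A)) (group_lattice A)"
proof -
  obtain bs where "lattice_basis bs (group_lattice A)" using exists_basis .
  then show ?thesis unfolding full_rank_lattice_def using span_lattice_basis by blast
qed

sublocale finite_comm_group A
  by unfold_locales simp

section \<open>Perfection and eutaxy in quantitative form\<close>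

abbreviation e :: "'a \<Rightarrow> real ^ 'a" where "e a \<equiv> axis a 1"

definition \<Psi>\<^sub>0 :: "('a \<Rightarrow> 'a \<Rightarrow> real) \<Rightarrow> 'a \<Rightarrow> 'a \<Rightarrow> 'a \<Rightarrow> real" where
  "\<Psi>\<^sub>0 D g c d = D g (g \<otimes> c) + D g (g \<otimes> d) + D (g \<otimes> (c \<otimes> d)) (g \<otimes> c) + D (g \<otimes> (c \<otimes> d)) (g \<otimes> d)
   - D g (g \<otimes> (c \<otimes> d)) - D (g \<otimes> c) (g \<otimes> d)"

text \<open>The functions \<open>D\<close> of the locale \<open>sym_form\<close> as matrices,
  extended by zero outside the carrier, so that they form a subspace of a normed space. For the same
  reason \<open>\<Psi>\<^sub>0\<close> repeats \<open>\<Psi>\<close> with \<open>D\<close> as an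
  argument: its linearity in \<open>D\<close> is what matters.\<close>

definition form_space :: "(real ^ 'a ^ 'a) set" where
  "form_space = {M. (\<forall>a b. vec_nth (vec_nth M a) b = vec_nth (vec_nth M b) a) \<and> (\<forall>a. vec_nth (vec_nth M a) a = 0)
     \<and> (\<forall>a b. a \<notin> carrier A \<longrightarrow> vec_nth (vec_nth M a) b = 0)}"

abbreviation ent :: "real ^ 'a ^ 'a \<Rightarrow> 'a \<Rightarrow> 'a \<Rightarrow> real" where
  "ent M a b \<equiv> vec_nth (vec_nth M a) b"

definition eval_map :: "real ^ 'a ^ 'a \<Rightarrow> real ^ ('a \<times> 'a \<times> 'a)" where
  "eval_map M = (\<chi> p. case p of (c, d, g) \<Rightarrow> if g \<in> carrier A \<and> (c, d) \<in> allowed then \<Psi>\<^sub>0 (ent M) g c d else 0)"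

lemma linear_eval_map: "linear eval_map"
  by (rule linearI) (auto simp: eval_map_def \<Psi>\<^sub>0_def Finite_Cartesian_Product.vec_eq_iff algebra_simps)

lemma subspace_form_space: "subspace form_space"
  by (auto simp: subspace_def form_space_def)

lemma sym_form_ent: "M \<in> form_space \<Longrightarrow> sym_form A (ent M)"
  by unfold_locales (auto simp: form_space_def)

lemma eval_map_nth:
  "\<lbrakk>g \<in> carrier A; (c, d) \<in> allowed\<rbrakk> \<Longrightarrow> vec_nth (eval_map M) (c, d, g) = \<Psi>\<^sub>0 (ent M) g c d"
  by (simp add: eval_map_def)

text \<open>Perfection in terms of \<open>eval_map\<close>. A quadruple with ab = cd is the
  translate by a of \<one>, c/a, d/a and their product, so its relation is an entry of
  \<open>eval_map M\<close>.\<close>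

lemma eval_map_injective:
  assumes M: "M \<in> form_space" and "eval_map M = 0"
    and "card (carrier A) \<ge> 7" "\<not> (card (carrier A) = 8 \<and> card squares = 2)"
  shows "M = 0"
proof -
  interpret sym_form A "ent M" by (rule sym_form_ent [OF M])
  interpret quad_form A "ent M"
  proof
    fix a b c d assume *: "a \<in> carrier A" "b \<in> carrier A" "c \<in> carrier A" "d \<in> carrier A"
      "a \<otimes> b = c \<otimes> d" "a \<noteq> b" "c \<noteq> d"
    let ?c = "inv a \<otimes> c" and ?d = "inv a \<otimes> d"
    have cd: "?c \<otimes> ?d = inv a \<otimes> b"
    proof -
      have "?c \<otimes> ?d = inv a \<otimes> (inv a \<otimes> (c \<otimes> d))" using *(1-4) by (simp add: group_simps)
      also have "\<dots> = inv a \<otimes> b" unfolding *(5) [symmetric] using *(1-4) by (simp add: cancel_inv0)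
      finally show ?thesis .
    qed
    moreover have "inv a \<otimes> b \<noteq> \<one>" using * by (metis inv_equality inv_inv inv_closed m_comm)
    moreover have "?c \<noteq> ?d" using * by simp
    ultimately have "(?c, ?d) \<in> allowed" using * by (simp add: allowed_def)
    then have "\<Psi>\<^sub>0 (ent M) a ?c ?d = 0" using eval_map_nth [OF *(1), of ?c ?d M] assms(2) by simp
    moreover have "a \<otimes> ?c = c" "a \<otimes> ?d = d" "a \<otimes> (?c \<otimes> ?d) = b" using * by (simp_all add: cd cancel_inv0)
    ultimately show "ent M a b + ent M c d = ent M a c + ent M a d + ent M b c + ent M b d"
      by (simp add: \<Psi>\<^sub>0_def)
  qed
  have "ent M a b = 0" for a b
    using D_zero [OF assms(3,4), of a b] M unfolding form_space_def by (cases "a \<in> carrier A"; cases "b \<in> carrier A") auto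
  then show ?thesis by (simp add: Finite_Cartesian_Product.vec_eq_iff)
qed

text \<open>An injective linear map on a finite-dimensional space is bounded below by some factor
  \<open>k\<close>. When all increments are nonnegative, the sum of the absolute values of the
  entries of \<open>eval_map M\<close> is the total in \<open>eutactic_bound\<close>, and \<kappa> =
  3k / (28N) results.\<close>

lemma trace_bound:
  assumes "card (carrier A) \<ge> 7" "\<not> (card (carrier A) = 8 \<and> card squares = 2)"
  obtains \<kappa> where "\<kappa> > 0" "\<And>M. \<lbrakk>M \<in> form_space;
      \<And>g c d. \<lbrakk>g \<in> carrier A; (c, d) \<in> allowed\<rbrakk> \<Longrightarrow> \<Psi>\<^sub>0 (ent M) g c d \<ge> 0\<rbrakk>
    \<Longrightarrow> \<kappa> * norm M \<le> (\<Sum>a\<in>carrier A. \<Sum>b\<in>carrier A. ent M a b)"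
proof -
  have "\<exists>k>0. \<forall>M\<in>form_space. norm (eval_map M) \<ge> k * norm M"
  proof (rule injective_imp_isometric [OF closed_subspace [OF subspace_form_space] subspace_form_space])
    show "bounded_linear eval_map" using linear_eval_map by (simp add: linear_linear)
  qed (use eval_map_injective assms in blast)
  then obtain k where k: "k > 0" "\<And>M. M \<in> form_space \<Longrightarrow> norm (eval_map M) \<ge> k * norm M" by blast
  define N where "N = real (card (carrier A))"
  have N: "N \<ge> 7" using assms(1) by (simp add: N_def)
  show thesis
  proof
    show "3 * k / (28 * N) > 0" using k N by simp
    fix M assume M: "M \<in> form_space"
      and pos: "\<And>g c d. \<lbrakk>g \<in> carrier A; (c, d) \<in> allowed\<rbrakk> \<Longrightarrow> \<Psi>\<^sub>0 (ent M) g c d \<ge> 0"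
    interpret sym_form A "ent M" by (rule sym_form_ent [OF M])
    have \<Psi>: "\<Psi> = \<Psi>\<^sub>0 (ent M)" by (simp add: fun_eq_iff \<Psi>_def \<Psi>\<^sub>0_def)
    have "k * norm M \<le> norm (eval_map M)" by (rule k(2) [OF M])
    also have "\<dots> \<le> (\<Sum>i\<in>UNIV. \<bar>vec_nth (eval_map M) i\<bar>)" by (rule norm_le_l1_cart)
    also have "\<dots> = (\<Sum>i\<in>(\<lambda>((c, d), g). (c, d, g)) ` (allowed \<times> carrier A). \<bar>vec_nth (eval_map M) i\<bar>)"
    proof (rule sum.mono_neutral_right)
      have "vec_nth (eval_map M) (c, d, g) = 0"
        if "(c, d, g) \<notin> (\<lambda>((c, d), g). (c, d, g)) ` (allowed \<times> carrier A)" for c d g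
        using that by (force simp: eval_map_def)
      then show "\<forall>i\<in>UNIV - (\<lambda>((c, d), g). (c, d, g)) ` (allowed \<times> carrier A). \<bar>vec_nth (eval_map M) i\<bar> = 0"
        by auto
    qed auto
    also have "\<dots> = (\<Sum>((c, d), g)\<in>allowed \<times> carrier A. \<Psi> g c d)"
      by (subst sum.reindex) (auto simp: inj_on_def eval_map_nth \<Psi> pos intro!: sum.cong)
    also have "\<dots> = (\<Sum>(c, d)\<in>allowed. \<Psi>_sum c d)"
      unfolding \<Psi>_sum_def by (simp add: sum.cartesian_product' case_prod_unfold)
    finally have "3 * (k * norm M) \<le> 28 * N * \<sigma>"
      using eutactic_bound(1) pos N by (simp add: \<Psi> n_def N_def)
    then show "3 * k / (28 * N) * norm M \<le> (\<Sum>a\<in>carrier A. \<Sum>b\<in>carrier A. ent M a b)"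
      using N by (simp add: \<sigma>_def s_def field_simps)
  qed
qed

section \<open>Perturbations in terms of distances\<close>

lemma V\<^sub>0_expand: "x \<in> V\<^sub>0 \<Longrightarrow> x = (\<Sum>a\<in>carrier A. vec_nth x a *\<^sub>R e a)"
  by (auto simp: Finite_Cartesian_Product.vec_eq_iff V\<^sub>0_def axis_def if_distrib [of "\<lambda>z. _ * z"] cong: if_cong)

text \<open>Polarisation: the terms with the squared length of g(e a) or g(e b) alone drop out
  because the coordinates of x and y sum to zero.\<close>

lemma inner_via_distances:
  fixes g :: "real ^ 'a \<Rightarrow> real ^ 'a"
  assumes "linear g" "x \<in> V\<^sub>0" "y \<in> V\<^sub>0"
  shows "g x \<bullet> g y = - (\<Sum>a\<in>carrier A. \<Sum>b\<in>carrier A. vec_nth x a * vec_nth y b * (norm (g (e a - e b)))\<^sup>2) / 2"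
proof -
  interpret linear g by fact
  let ?S = "carrier A"
  have gx: "g z = (\<Sum>a\<in>?S. vec_nth z a *\<^sub>R g (e a))" if "z \<in> V\<^sub>0" for z
    by (subst V\<^sub>0_expand [OF that]) (simp add: sum scale)
  have sq: "(norm (g (e a - e b)))\<^sup>2 = (norm (g (e a)))\<^sup>2 + (norm (g (e b)))\<^sup>2 - 2 * (g (e a) \<bullet> g (e b))" for a b
    by (simp add: diff power2_norm_eq_inner inner_diff_left inner_diff_right inner_commute)
  have z: "(\<Sum>a\<in>?S. vec_nth x a) = 0" "(\<Sum>a\<in>?S. vec_nth y a) = 0" using assms by (auto simp: V\<^sub>0_def)
  have 1: "(\<Sum>a\<in>?S. \<Sum>b\<in>?S. vec_nth x a * vec_nth y b * (norm (g (e a)))\<^sup>2)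
      = (\<Sum>a\<in>?S. vec_nth x a * (norm (g (e a)))\<^sup>2) * (\<Sum>b\<in>?S. vec_nth y b)"
    unfolding sum_product by (intro sum.cong refl) (simp add: mult_ac)
  have 2: "(\<Sum>a\<in>?S. \<Sum>b\<in>?S. vec_nth x a * vec_nth y b * (norm (g (e b)))\<^sup>2)
      = (\<Sum>a\<in>?S. vec_nth x a) * (\<Sum>b\<in>?S. vec_nth y b * (norm (g (e b)))\<^sup>2)"
    unfolding sum_product by (intro sum.cong refl) (simp add: mult_ac)
  have 3: "(\<Sum>a\<in>?S. \<Sum>b\<in>?S. vec_nth x a * vec_nth y b * (g (e a) \<bullet> g (e b))) = g x \<bullet> g y"
    unfolding gx [OF assms(2)] gx [OF assms(3)]
    by (subst sum.swap) (simp add: inner_sum_left inner_sum_right sum_distrib_left mult_ac)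
  have "(\<Sum>a\<in>?S. \<Sum>b\<in>?S. vec_nth x a * vec_nth y b * (norm (g (e a - e b)))\<^sup>2)
      = (\<Sum>a\<in>?S. \<Sum>b\<in>?S. vec_nth x a * vec_nth y b * (norm (g (e a)))\<^sup>2)
       + (\<Sum>a\<in>?S. \<Sum>b\<in>?S. vec_nth x a * vec_nth y b * (norm (g (e b)))\<^sup>2)
       - 2 * (\<Sum>a\<in>?S. \<Sum>b\<in>?S. vec_nth x a * vec_nth y b * (g (e a) \<bullet> g (e b)))"
    by (simp add: sq algebra_simps sum.distrib sum_subtractf sum_distrib_left)
  then show ?thesis unfolding 1 2 3 z by simp
qed

text \<open>The origin of the six terms of \<open>\<Psi>\<close>: they express the squared length of
  a lattice vector through squared distances of group elements.\<close>

lemma quad_norm: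
  fixes p q r s :: "'v::real_inner"
  shows "(norm (p + q - r - s))\<^sup>2 = (norm (p - r))\<^sup>2 + (norm (p - s))\<^sup>2 + (norm (q - r))\<^sup>2 + (norm (q - s))\<^sup>2
    - (norm (p - q))\<^sup>2 - (norm (r - s))\<^sup>2"
  by (simp add: power2_norm_eq_inner inner_diff_left inner_diff_right inner_add_left inner_add_right inner_commute)

definition quad_vec where "quad_vec g c d = e g + e (g \<otimes> (c \<otimes> d)) - e (g \<otimes> c) - e (g \<otimes> d)"

lemma quad_vec_mem:
  "\<lbrakk>g \<in> carrier A; c \<in> carrier A; d \<in> carrier A\<rbrakk> \<Longrightarrow> quad_vec g c d \<in> group_lattice A"
  unfolding quad_vec_def by (rule quad_mem) (simp_all add: group_simps)

text \<open>If c and d are nontrivial, the four group elements are distinct; otherwise they cancel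
  in pairs.\<close>

lemma norm_quad_vec:
  assumes "g \<in> carrier A" "(c, d) \<in> allowed"
  shows "quad_vec g c d = 0 \<or> norm (quad_vec g c d) = 2"
    and "c \<noteq> \<one> \<Longrightarrow> d \<noteq> \<one> \<Longrightarrow> norm (quad_vec g c d) = 2"
proof -
  have cd: "c \<in> carrier A" "d \<in> carrier A" "c \<noteq> d" "c \<otimes> d \<noteq> \<one>" using assms(2) by (auto simp: allowed_def)
  show *: "norm (quad_vec g c d) = 2" if "c \<noteq> \<one>" "d \<noteq> \<one>"
  proof -
    have "x \<noteq> x \<otimes> y" if "x \<in> carrier A" "y \<in> carrier A" "y \<noteq> \<one>" for x y
      using that by (metis l_cancel_one')
    note ne = this
    have "g \<noteq> g \<otimes> (c \<otimes> d)" "g \<noteq> g \<otimes> c" "g \<noteq> g \<otimes> d" using ne that cd assms(1) by auto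
    moreover have "g \<otimes> c \<noteq> g \<otimes> d" using cd assms(1) by simp
    moreover have "g \<otimes> c \<noteq> g \<otimes> (c \<otimes> d)" using ne [of "g \<otimes> c" d] that cd assms(1) by (simp add: m_assoc)
    moreover have "g \<otimes> d \<noteq> g \<otimes> (c \<otimes> d)" using ne [of "g \<otimes> d" c] that cd assms(1) by (simp add: m_ac)
    ultimately have "quad_vec g c d \<bullet> quad_vec g c d = 4"
      by (simp add: quad_vec_def inner_diff_left inner_diff_right inner_add_left inner_add_right inner_axis_axis)
    then show ?thesis by (simp add: norm_eq_sqrt_inner)
  qed
  show "quad_vec g c d = 0 \<or> norm (quad_vec g c d) = 2"
  proof (cases "c = \<one> \<or> d = \<one>")
    case True
    then show ?thesis using assms(1) cd by (auto simp: quad_vec_def)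
  qed (use * in auto)
qed

lemma norm_square_diff:
  fixes x y :: "'v::real_normed_vector"
  assumes "norm (y - x) \<le> \<epsilon> * norm x" "0 \<le> \<epsilon>" "\<epsilon> \<le> 1"
  shows "\<bar>(norm y)\<^sup>2 - (norm x)\<^sup>2\<bar> \<le> 3 * \<epsilon> * (norm x)\<^sup>2"
proof -
  have d: "\<bar>norm y - norm x\<bar> \<le> \<epsilon> * norm x" using norm_triangle_ineq3 [of y x] assms(1) by linarith
  moreover have "\<epsilon> * norm x \<le> norm x" using assms by (simp add: mult_left_le_one_le)
  ultimately have "norm y + norm x \<le> 3 * norm x" by linarith
  then have "\<bar>norm y - norm x\<bar> * (norm y + norm x) \<le> (\<epsilon> * norm x) * (3 * norm x)"
    using d by (intro mult_mono) auto
  moreover have "(norm y)\<^sup>2 - (norm x)\<^sup>2 = (norm y - norm x) * (norm y + norm x)"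
    by (simp add: power2_eq_square algebra_simps)
  ultimately show ?thesis by (simp add: abs_mult power2_eq_square mult_ac)
qed

text \<open>The trace of a perturbation that shortens no minimal vector is bounded below by a multiple of its
  norm, which beats the quadratic error term of the determinant.\<close>

lemma det_gram_ge_one:
  assumes card: "card (carrier A) \<ge> 7" "\<not> (card (carrier A) = 8 \<and> card squares = 2)"
    and us: "orthonormal_list us V\<^sub>0"
  obtains \<epsilon> where "0 < \<epsilon>" "\<epsilon> \<le> 1" "\<And>g. \<lbrakk>linear g; \<And>x. x \<in> V\<^sub>0 \<Longrightarrow> norm (g x - x) \<le> \<epsilon> * norm x;
      \<And>x. x \<in> group_lattice A \<Longrightarrow> x \<noteq> 0 \<Longrightarrow> norm (g x) \<ge> 2\<rbrakk>
    \<Longrightarrow> Determinant.det (gram_matrix (map g us)) \<ge> 1"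
proof -
  interpret orthonormal_list us "V\<^sub>0" by fact
  obtain \<kappa> where \<kappa>: "\<kappa> > 0" "\<And>M. \<lbrakk>M \<in> form_space;
      \<And>g c d. \<lbrakk>g \<in> carrier A; (c, d) \<in> allowed\<rbrakk> \<Longrightarrow> \<Psi>\<^sub>0 (ent M) g c d \<ge> 0\<rbrakk>
    \<Longrightarrow> \<kappa> * norm M \<le> (\<Sum>a\<in>carrier A. \<Sum>b\<in>carrier A. ent M a b)"
    using trace_bound [OF card] by blast
  obtain C :: real where C: "C \<ge> 0"
    "\<And>M e. \<lbrakk>M \<in> carrier_mat d d; 0 \<le> e; e \<le> 1;
        \<And>i j. \<lbrakk>i < d; j < d\<rbrakk> \<Longrightarrow> \<bar>M $$ (i, j) - (if i = j then 1 else 0)\<bar> \<le> e\<rbrakk>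
      \<Longrightarrow> 1 + (\<Sum>i<d. M $$ (i, i) - 1) - C * e\<^sup>2 \<le> Determinant.det M"
    using det_near_one [of d] by blast
  define N where "N = real (card (carrier A))"
  have N: "N \<ge> 7" using card by (simp add: N_def)
  \<comment> \<open>A bound for the norm of \<open>M\<close>. The first term keeps the entries
    within the range of the determinant estimate. The second makes the quadratic error, at most C
    N^4 (norm M)^2, no larger than \<kappa> norm M / (2N), which bounds the trace from below. The
    summand 1 avoids division by zero when C = 0.\<close>
  define \<delta>\<^sub>0 where "\<delta>\<^sub>0 = min (1 / N\<^sup>2) (\<kappa> / (2 * N) / (C * N ^ 4 + 1))"
  have \<delta>\<^sub>0: "\<delta>\<^sub>0 > 0" "N\<^sup>2 * \<delta>\<^sub>0 \<le> 1" "(C * N ^ 4) * \<delta>\<^sub>0 \<le> \<kappa> / (2 * N)"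
  proof -
    have pos: "C * N ^ 4 + 1 > 0" using C(1) N by (simp add: add_nonneg_pos)
    then show "\<delta>\<^sub>0 > 0" using \<kappa>(1) N by (simp add: \<delta>\<^sub>0_def)
    have "N\<^sup>2 * \<delta>\<^sub>0 \<le> N\<^sup>2 * (1 / N\<^sup>2)" unfolding \<delta>\<^sub>0_def by (intro mult_left_mono) auto
    then show "N\<^sup>2 * \<delta>\<^sub>0 \<le> 1" using N by simp
    have "(C * N ^ 4) * \<delta>\<^sub>0 \<le> (C * N ^ 4 + 1) * \<delta>\<^sub>0" using \<open>\<delta>\<^sub>0 > 0\<close> by simp
    also have "\<dots> \<le> (C * N ^ 4 + 1) * (\<kappa> / (2 * N) / (C * N ^ 4 + 1))"
      unfolding \<delta>\<^sub>0_def using pos by (intro mult_left_mono) auto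
    also have "\<dots> = \<kappa> / (2 * N)" using pos by simp
    finally show "(C * N ^ 4) * \<delta>\<^sub>0 \<le> \<kappa> / (2 * N)" .
  qed
  \<comment> \<open>Each of the N^2 entries of \<open>M\<close> is at most 6\<epsilon>: the relative
    change of a squared length is at most 3\<epsilon>, and differences of group elements have
    squared length at most 2.\<close>
  define \<epsilon> where "\<epsilon> = min 1 (\<delta>\<^sub>0 / (6 * N\<^sup>2))"
  have \<epsilon>: "0 < \<epsilon>" "\<epsilon> \<le> 1" "6 * N\<^sup>2 * \<epsilon> \<le> \<delta>\<^sub>0"
  proof -
    show "0 < \<epsilon>" "\<epsilon> \<le> 1" using \<delta>\<^sub>0 N by (auto simp: \<epsilon>_def)
    have "6 * N\<^sup>2 * \<epsilon> \<le> 6 * N\<^sup>2 * (\<delta>\<^sub>0 / (6 * N\<^sup>2))" unfolding \<epsilon>_def by (intro mult_left_mono) auto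
    then show "6 * N\<^sup>2 * \<epsilon> \<le> \<delta>\<^sub>0" using N by simp
  qed
  have "Determinant.det (gram_matrix (map g us)) \<ge> 1"
    if lin: "linear g" and near: "\<And>x. x \<in> V\<^sub>0 \<Longrightarrow> norm (g x - x) \<le> \<epsilon> * norm x"
      and long: "\<And>x. x \<in> group_lattice A \<Longrightarrow> x \<noteq> 0 \<Longrightarrow> norm (g x) \<ge> 2" for g
  proof -
    interpret g: linear g by fact
    let ?S = "carrier A"
    define D where "D a b = (norm (g (e a - e b)))\<^sup>2 - (norm (e a - e b))\<^sup>2" for a b
    define M :: "real ^ 'a ^ 'a" where "M = (\<chi> a b. if a \<in> ?S \<and> b \<in> ?S then D a b else 0)"
    have ent: "ent M a b = (if a \<in> ?S \<and> b \<in> ?S then D a b else 0)" for a b by (simp add: M_def)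
    have "D a b = D b a" for a b
      using g.neg [of "e a - e b"] by (simp add: D_def norm_minus_commute)
    moreover have "D a a = 0" for a by (simp add: D_def g.zero)
    ultimately have M: "M \<in> form_space" by (auto simp: form_space_def ent)
    have diff_mem: "e a - e b \<in> V\<^sub>0" if "a \<in> ?S" "b \<in> ?S" for a b
      using that by (auto simp: V\<^sub>0_def sum_subtractf sum_axis) (auto simp: axis_def)
    have "\<bar>D a b\<bar> \<le> 6 * \<epsilon>" if "a \<in> ?S" "b \<in> ?S" for a b
    proof -
      have "\<bar>D a b\<bar> \<le> 3 * \<epsilon> * (norm (e a - e b))\<^sup>2"
        unfolding D_def using norm_square_diff [OF near [OF diff_mem [OF that]]] \<epsilon> by simp
      also have "(norm (e a - e b))\<^sup>2 \<le> 2"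
        by (simp add: power2_norm_eq_inner inner_diff_left inner_diff_right inner_axis_axis)
      then have "3 * \<epsilon> * (norm (e a - e b))\<^sup>2 \<le> 3 * \<epsilon> * 2" using \<epsilon> by (intro mult_left_mono) auto
      finally show ?thesis by simp
    qed
    then have "(\<Sum>a\<in>?S. \<Sum>b\<in>?S. \<bar>D a b\<bar>) \<le> (\<Sum>a\<in>?S. \<Sum>b\<in>?S. 6 * \<epsilon>)" by (intro sum_mono) auto
    moreover have "norm M \<le> (\<Sum>a\<in>?S. \<Sum>b\<in>?S. \<bar>D a b\<bar>)"
    proof -
      have "norm M \<le> (\<Sum>a\<in>UNIV. norm (vec_nth M a))"
        unfolding norm_vec_def by (rule L2_set_le_sum) simp
      also have "\<dots> \<le> (\<Sum>a\<in>UNIV. \<Sum>b\<in>UNIV. \<bar>ent M a b\<bar>)" by (intro sum_mono norm_le_l1_cart)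
      also have "\<dots> = (\<Sum>a\<in>?S. \<Sum>b\<in>UNIV. \<bar>ent M a b\<bar>)" by (rule sum.mono_neutral_right) (auto simp: ent)
      also have "\<dots> = (\<Sum>a\<in>?S. \<Sum>b\<in>?S. \<bar>ent M a b\<bar>)"
        by (rule sum.cong [OF refl], rule sum.mono_neutral_right) (auto simp: ent)
      finally show ?thesis by (simp add: ent)
    qed
    ultimately have "norm M \<le> N * (N * (6 * \<epsilon>))" by (simp add: N_def)
    then have \<delta>: "norm M \<le> \<delta>\<^sub>0" using \<epsilon>(3) by (simp add: power2_eq_square mult_ac)
    have ent_le: "\<bar>ent M a b\<bar> \<le> norm M" for a b
      using Finite_Cartesian_Product.norm_nth_le [of "vec_nth M a" b] Finite_Cartesian_Product.norm_nth_le [of M a] by simp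
    have "\<Psi>\<^sub>0 (ent M) h c f \<ge> 0" if h: "h \<in> ?S" and cf: "(c, f) \<in> allowed" for h c f
    proof -
      have cl: "c \<in> ?S" "f \<in> ?S" using cf by (auto simp: allowed_def)
      let ?v = "quad_vec h c f"
      have "\<Psi>\<^sub>0 (ent M) h c f = (norm (g ?v))\<^sup>2 - (norm ?v)\<^sup>2"
        using h cl
        by (simp add: quad_vec_def \<Psi>\<^sub>0_def ent D_def quad_norm g.add g.diff)
      moreover have "norm ?v \<le> norm (g ?v)"
      proof (cases "?v = 0")
        case False
        then show ?thesis using norm_quad_vec(1) [OF h cf] long [OF quad_vec_mem [OF h cl]] by simp
      qed (simp add: g.zero)
      ultimately show ?thesis by (simp add: power_mono)
    qed
    then have tr: "\<kappa> * norm M \<le> (\<Sum>a\<in>?S. \<Sum>b\<in>?S. D a b)" using \<kappa>(2) [OF M] by (simp add: ent)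
    define S where "S = gram_matrix (map g us)"
    have S_carrier: "S \<in> carrier_mat d d" by (simp add: S_def gram_matrix_def)
    have us_V: "us ! i \<in> V\<^sub>0" if "i < d" for i
      using us_span span_base [of "us ! i" "set us"] that by simp
    have S_entry: "S $$ (i, j) - (if i = j then 1 else 0)
        = - (\<Sum>a\<in>?S. \<Sum>b\<in>?S. vec_nth (us ! i) a * vec_nth (us ! j) b * D a b) / 2" if "i < d" "j < d" for i j
    proof -
      have "S $$ (i, j) - (if i = j then 1 else 0) = g (us ! i) \<bullet> g (us ! j) - us ! i \<bullet> us ! j"
        using that us_inner by (simp add: S_def gram_matrix_def)
      then show ?thesis
        using inner_via_distances [OF lin us_V [OF that(1)] us_V [OF that(2)]]
          inner_via_distances [OF linear_id us_V [OF that(1)] us_V [OF that(2)]]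
        by (simp add: D_def right_diff_distrib sum_subtractf field_simps)
    qed
    have us_le: "\<bar>vec_nth (us ! i) a\<bar> \<le> 1" if "i < d" for i a
      using Finite_Cartesian_Product.norm_nth_le [of "us ! i" a] us_norm [of "us ! i"] that by simp
    have S_near: "\<bar>S $$ (i, j) - (if i = j then 1 else 0)\<bar> \<le> N\<^sup>2 * norm M" if "i < d" "j < d" for i j
    proof -
      have "\<bar>\<Sum>a\<in>?S. \<Sum>b\<in>?S. vec_nth (us ! i) a * vec_nth (us ! j) b * D a b\<bar> \<le> (\<Sum>a\<in>?S. \<Sum>b\<in>?S. norm M)"
      proof (rule order_trans [OF sum_abs sum_mono], rule order_trans [OF sum_abs sum_mono])
        fix a b assume ab: "a \<in> ?S" "b \<in> ?S"
        have "\<bar>vec_nth (us ! i) a\<bar> * \<bar>vec_nth (us ! j) b\<bar> * \<bar>D a b\<bar> \<le> 1 * 1 * norm M"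
          using us_le that ent_le [of a b] ab by (intro mult_mono) (auto simp: ent)
        then show "\<bar>vec_nth (us ! i) a * vec_nth (us ! j) b * D a b\<bar> \<le> norm M" by (simp add: abs_mult)
      qed
      then have "\<bar>\<Sum>a\<in>?S. \<Sum>b\<in>?S. vec_nth (us ! i) a * vec_nth (us ! j) b * D a b\<bar> \<le> N\<^sup>2 * norm M"
        by (simp add: N_def power2_eq_square mult_ac)
      then show ?thesis unfolding S_entry [OF that] by simp
    qed
    \<comment> \<open>These sums are the entries of the orthogonal projection onto the sum-zero
      part, the identity minus the matrix with all entries 1/N; \<open>p x\<close> is the projection
      of \<open>e x\<close>. In the trace the diagonal is multiplied by D(a,a) = 0.\<close>
    have proj: "(\<Sum>i<d. vec_nth (us ! i) a * vec_nth (us ! i) b) = - 1 / N" if "a \<in> ?S" "b \<in> ?S" "a \<noteq> b" for a b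
    proof -
      define p where "p x = e x - (\<Sum>c\<in>?S. (1 / N) *\<^sub>R e c)" for x
      have p_nth: "vec_nth (p x) y = (if x = y then 1 else 0) - (if y \<in> ?S then 1 / N else 0)" for x y
        by (simp add: p_def axis_def if_distrib [of "\<lambda>z. _ * z"] cong: if_cong)
      have p: "p x \<in> V\<^sub>0" if "x \<in> ?S" for x
        using that N by (auto simp: V\<^sub>0_def p_nth sum_subtractf N_def)
      have ip: "v \<bullet> p x = vec_nth v x" if "v \<in> V\<^sub>0" for v x
        using that by (simp add: p_def inner_diff_right inner_sum_right inner_axis V\<^sub>0_def flip: sum_divide_distrib)
      have "p b \<bullet> p a = (\<Sum>i<d. (us ! i \<bullet> p b) * (us ! i \<bullet> p a))" by (rule inner_expand [OF p [OF that(1)]])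
      also have "\<dots> = (\<Sum>i<d. vec_nth (us ! i) a * vec_nth (us ! i) b)"
        by (rule sum.cong) (use us_V ip in auto)
      finally show ?thesis using ip [OF p [OF that(2)], of a] that by (simp add: p_nth)
    qed
    have "(\<Sum>i<d. S $$ (i, i) - 1) = (\<Sum>i<d. - (\<Sum>a\<in>?S. \<Sum>b\<in>?S. vec_nth (us ! i) a * vec_nth (us ! i) b * D a b) / 2)"
      by (rule sum.cong) (use S_entry in force)+
    also have "\<dots> = - (\<Sum>i<d. \<Sum>a\<in>?S. \<Sum>b\<in>?S. vec_nth (us ! i) a * vec_nth (us ! i) b * D a b) / 2"
      by (simp add: sum_negf flip: sum_divide_distrib)
    also have "(\<Sum>i<d. \<Sum>a\<in>?S. \<Sum>b\<in>?S. vec_nth (us ! i) a * vec_nth (us ! i) b * D a b)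
        = (\<Sum>a\<in>?S. \<Sum>b\<in>?S. (\<Sum>i<d. vec_nth (us ! i) a * vec_nth (us ! i) b) * D a b)"
      unfolding sum_distrib_right by (subst sum.swap, rule sum.cong [OF refl], rule sum.swap)
    also have "\<dots> = (\<Sum>a\<in>?S. \<Sum>b\<in>?S. (- 1 / N) * D a b)"
    proof (intro sum.cong refl)
      fix a b assume ab: "a \<in> ?S" "b \<in> ?S"
      show "(\<Sum>i<d. vec_nth (us ! i) a * vec_nth (us ! i) b) * D a b = (- 1 / N) * D a b"
        using proj [OF ab] \<open>\<And>a. D a a = 0\<close> by (cases "a = b") auto
    qed
    also have "\<dots> = (- 1 / N) * (\<Sum>a\<in>?S. \<Sum>b\<in>?S. D a b)" by (simp only: sum_distrib_left)
    finally have trace: "(\<Sum>i<d. S $$ (i, i) - 1) = (\<Sum>a\<in>?S. \<Sum>b\<in>?S. D a b) / (2 * N)" by simp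
    have "N\<^sup>2 * norm M \<le> N\<^sup>2 * \<delta>\<^sub>0" using \<delta> by (intro mult_left_mono) auto
    then have le1: "N\<^sup>2 * norm M \<le> 1" using \<delta>\<^sub>0(2) by linarith
    have "1 + (\<Sum>i<d. S $$ (i, i) - 1) - C * (N\<^sup>2 * norm M)\<^sup>2 \<le> Determinant.det S"
      by (rule C(2) [OF S_carrier _ le1 S_near]) auto
    moreover have "C * (N\<^sup>2 * norm M)\<^sup>2 \<le> (\<Sum>i<d. S $$ (i, i) - 1)"
    proof -
      have "C * (N\<^sup>2 * norm M)\<^sup>2 = (C * N ^ 4 * norm M) * norm M"
        by (simp add: power2_eq_square power4_eq_xxxx mult_ac)
      also have "\<dots> \<le> (\<kappa> / (2 * N)) * norm M"
      proof (rule mult_right_mono)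
        have "C * N ^ 4 * norm M \<le> C * N ^ 4 * \<delta>\<^sub>0" using C(1) N \<delta> by (intro mult_left_mono) auto
        then show "C * N ^ 4 * norm M \<le> \<kappa> / (2 * N)" using \<delta>\<^sub>0(3) by linarith
      qed simp
      also have "\<dots> = \<kappa> * norm M / (2 * N)" by simp
      also have "\<dots> \<le> (\<Sum>a\<in>?S. \<Sum>b\<in>?S. D a b) / (2 * N)" using tr N by (intro divide_right_mono) auto
      finally show ?thesis unfolding trace .
    qed
    ultimately show ?thesis unfolding S_def by linarith
  qed
  then show thesis using that \<epsilon> by blast
qed

section \<open>Extremality\<close>

text \<open>Supplies the vector whose image bounds the minimum of a perturbed lattice from
  above.\<close>

lemma exists_minimal:
  assumes "card (carrier A) \<ge> 7"
  obtains x where "x \<in> group_lattice A" "norm x = 2"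
proof -
  have ex: "\<exists>c\<in>carrier A. c \<notin> T" if "finite T" "card T \<le> 3" for T
  proof (rule ccontr)
    assume "\<not> ?thesis"
    then have "carrier A \<subseteq> T" by blast
    then have "card (carrier A) \<le> card T" by (rule card_mono [OF that(1)])
    then show False using that(2) assms by linarith
  qed
  obtain c where c: "c \<in> carrier A" "c \<noteq> \<one>" using ex [of "{\<one>}"] by auto
  obtain d where d: "d \<in> carrier A" "d \<noteq> \<one>" "d \<noteq> c" "d \<noteq> inv c"
  proof -
    have "card {\<one>, c, inv c} \<le> 3" by (simp add: card_insert_if)
    then show thesis using ex [of "{\<one>, c, inv c}"] that by auto
  qed
  have "c \<otimes> d \<noteq> \<one>" using c d by (metis inv_equality m_comm)
  then have "(c, d) \<in> allowed" using c d by (auto simp: allowed_def)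
  then show thesis using that quad_vec_mem [of \<one> c d] norm_quad_vec(2) [of \<one> c d] c d by simp
qed

text \<open>The density is invariant under scaling, so \<open>g\<close> can be rescaled until the
  minimum of the image is 2. Then no minimal vector is shortened, \<open>det_gram_ge_one\<close>
  applies, and the covolume of the rescaled image is at least that of the lattice.\<close>

lemma extreme_group_lattice:
  assumes card: "card (carrier A) \<ge> 7" "\<not> (card (carrier A) = 8 \<and> card squares = 2)"
  shows "extreme V\<^sub>0 (group_lattice A)"
proof -
  let ?L = "group_lattice A"
  obtain B where B: "B \<subseteq> V\<^sub>0" "pairwise Linear_Algebra.orthogonal B" "\<And>x. x \<in> B \<Longrightarrow> norm x = 1"
    "independent B" "card B = dim V\<^sub>0" "span B = V\<^sub>0"
    by (rule orthonormal_basis_subspace [OF subspace_V\<^sub>0]) (rule that)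
  obtain us where us: "set us = B" "distinct us"
    using finite_distinct_list [OF independent_imp_finite [OF B(4)]] by blast
  have ol: "orthonormal_list us V\<^sub>0"
    by unfold_locales (use us B in auto)
  interpret orthonormal_list us V\<^sub>0 by (rule ol)
  obtain \<epsilon> where \<epsilon>: "0 < \<epsilon>" "\<epsilon> \<le> 1" "\<And>g. \<lbrakk>linear g; \<And>x. x \<in> V\<^sub>0 \<Longrightarrow> norm (g x - x) \<le> \<epsilon> * norm x;
      \<And>x. x \<in> ?L \<Longrightarrow> x \<noteq> 0 \<Longrightarrow> norm (g x) \<ge> 2\<rbrakk>
    \<Longrightarrow> Determinant.det (gram_matrix (map g us)) \<ge> 1"
    using det_gram_ge_one [OF card ol] by blast
  obtain bs where bs: "lattice_basis bs ?L" by (rule exists_basis)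
  note V = span_group_lattice
  obtain x\<^sub>0 where x\<^sub>0: "x\<^sub>0 \<in> ?L" "norm x\<^sub>0 = 2" using exists_minimal [OF card(1)] .
  then have x\<^sub>0': "x\<^sub>0 \<in> ?L - {0}" by auto
  have min2: "min_dist ?L \<ge> 2"
    unfolding min_dist_def by (rule cInf_greatest) (use x\<^sub>0' norm_group_lattice in auto)
  have "packing_density V\<^sub>0 (g ` ?L) \<le> packing_density V\<^sub>0 ?L"
    if g: "g \<in> GL V\<^sub>0" and near: "\<forall>x\<in>V\<^sub>0. norm (g x - x) \<le> \<epsilon> / 4 * norm x" for g
  proof -
    have lin: "linear g" and inj: "inj_on g V\<^sub>0" using g by (auto simp: GL_def bij_betw_def)
    interpret g: linear g by fact
    define \<mu> where "\<mu> = min_dist (g ` ?L)"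
    have L_V: "x \<in> V\<^sub>0" if "x \<in> ?L" for x using that group_lattice_V\<^sub>0 by blast
    have g0: "g x \<noteq> 0" if "x \<in> ?L" "x \<noteq> 0" for x
      using inj_onD [OF inj, of x 0] that L_V L_V [OF group_lattice_zero] g.zero by auto
    have \<mu>_le: "\<mu> \<le> norm (g x)" if "x \<in> ?L" "x \<noteq> 0" for x
      unfolding \<mu>_def min_dist_def
      by (rule cInf_lower) (use that g0 in \<open>auto intro!: bdd_belowI [of _ 0]\<close>)
    have g_norm: "\<bar>norm (g x) - norm x\<bar> \<le> \<epsilon> / 4 * norm x" if "x \<in> V\<^sub>0" for x
      using norm_triangle_ineq3 [of "g x" x] near that by force
    have "\<mu> \<le> norm (g x\<^sub>0)" using \<mu>_le x\<^sub>0' by blast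
    moreover have "\<bar>norm (g x\<^sub>0) - 2\<bar> \<le> \<epsilon> / 4 * 2" using g_norm [OF L_V [OF x\<^sub>0(1)]] x\<^sub>0(2) by simp
    ultimately have "\<mu> \<le> 2 + \<epsilon> / 2" by linarith
    have \<mu>_ge: "\<mu> \<ge> 2 - \<epsilon> / 2"
      unfolding \<mu>_def min_dist_def
    proof (rule cInf_greatest)
      show "norm ` (g ` ?L - {0}) \<noteq> {}" using x\<^sub>0' g0 by blast
      fix r assume "r \<in> norm ` (g ` ?L - {0})"
      then obtain x where x: "x \<in> ?L" "r = norm (g x)" "g x \<noteq> 0" by auto
      then have "x \<noteq> 0" using g.zero by auto
      then have "norm x \<ge> 2" using norm_group_lattice x by blast
      then have "(1 - \<epsilon> / 4) * 2 \<le> (1 - \<epsilon> / 4) * norm x" using \<epsilon> by (intro mult_left_mono) auto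
      moreover have "norm (g x) \<ge> (1 - \<epsilon> / 4) * norm x"
        using g_norm [OF L_V [OF x(1)]] unfolding left_diff_distrib by linarith
      ultimately show "2 - \<epsilon> / 2 \<le> r" using x by simp
    qed
    then have \<mu>: "\<mu> > 0" using \<epsilon> by simp
    \<comment> \<open>The image under \<open>h\<close> has minimum 2. Both the deviation of
      \<open>g\<close> and that of \<mu> from 2 enter the distance of \<open>h\<close> from the
      identity, each contributing \<epsilon>/2; this is why \<open>g\<close> is taken within
      \<epsilon>/4.\<close>
    define h where "h = (\<lambda>x. (2 / \<mu>) *\<^sub>R g x)"
    have lin_h: "linear h" unfolding h_def by (rule linear_compose_scale_right [OF lin])
    have "Determinant.det (gram_matrix (map h us)) \<ge> 1"
    proof (rule \<epsilon>(3) [OF lin_h])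
      show "norm (h x - x) \<le> \<epsilon> * norm x" if x: "x \<in> V\<^sub>0" for x
      proof -
        have "\<mu> *\<^sub>R (h x - x) = 2 *\<^sub>R (g x - x) + (2 - \<mu>) *\<^sub>R x"
          using \<mu> by (simp add: h_def algebra_simps)
        then have "\<mu> * norm (h x - x) \<le> 2 * norm (g x - x) + \<bar>2 - \<mu>\<bar> * norm x"
          using norm_triangle_ineq [of "2 *\<^sub>R (g x - x)" "(2 - \<mu>) *\<^sub>R x"] \<mu>
          by (metis abs_numeral abs_of_pos norm_scaleR)
        also have "\<dots> \<le> 2 * (\<epsilon> / 4 * norm x) + \<epsilon> / 2 * norm x"
        proof (intro add_mono mult_left_mono mult_right_mono)
          show "norm (g x - x) \<le> \<epsilon> / 4 * norm x" using near x by blast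
          show "\<bar>2 - \<mu>\<bar> \<le> \<epsilon> / 2" using \<mu>_ge \<open>\<mu> \<le> 2 + \<epsilon> / 2\<close> by linarith
        qed auto
        also have "\<dots> = 1 * (\<epsilon> * norm x)" by simp
        also have "\<dots> \<le> \<mu> * (\<epsilon> * norm x)" using \<mu>_ge \<epsilon> by (intro mult_right_mono) auto
        finally show ?thesis using \<mu> by simp
      qed
      show "norm (h x) \<ge> 2" if "x \<in> ?L" "x \<noteq> 0" for x
        using \<mu>_le [OF that] \<mu> by (simp add: h_def field_simps)
    qed
    moreover have "gram_matrix (map h us) = (2 / \<mu>)\<^sup>2 \<cdot>\<^sub>m gram_matrix (map g us)"
      by (rule eq_matI) (auto simp: gram_matrix_def h_def power2_eq_square)
    moreover have "dim_col (gram_matrix (map g us)) = d" by (simp add: gram_matrix_def)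
    ultimately have G: "1 \<le> ((2 / \<mu>)\<^sup>2) ^ d * Determinant.det (gram_matrix (map g us))" by simp
    have "(\<mu> / 2)\<^sup>2 * (2 / \<mu>)\<^sup>2 = 1" using \<mu> by (simp add: power2_eq_square)
    then have inv: "((\<mu> / 2)\<^sup>2) ^ d * ((2 / \<mu>)\<^sup>2) ^ d = 1" by (simp only: power_mult_distrib [symmetric] power_one)
    have "((\<mu> / 2)\<^sup>2) ^ d * 1 \<le> ((\<mu> / 2)\<^sup>2) ^ d * (((2 / \<mu>)\<^sup>2) ^ d * Determinant.det (gram_matrix (map g us)))"
      using G by (rule mult_left_mono) simp
    also have "\<dots> = Determinant.det (gram_matrix (map g us))"
      by (simp only: mult.assoc [symmetric] inv mult_1)
    finally have "((\<mu> / 2)\<^sup>2) ^ d * (covolume ?L)\<^sup>2 \<le> (covolume (g ` ?L))\<^sup>2"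
      unfolding covolume_image(1) [OF bs V g] mult_1_right by (rule mult_right_mono) simp
    moreover have "((\<mu> / 2) ^ d * covolume ?L)\<^sup>2 = ((\<mu> / 2)\<^sup>2) ^ d * (covolume ?L)\<^sup>2"
      by (simp only: power_mult_distrib power_mult [symmetric] mult.commute [of d])
    ultimately have "((\<mu> / 2) ^ d * covolume ?L)\<^sup>2 \<le> (covolume (g ` ?L))\<^sup>2" by simp
    then have cov: "(\<mu> / 2) ^ d * covolume ?L \<le> covolume (g ` ?L)"
      by (rule power2_le_imp_le) (rule less_imp_le [OF covolume_image(2) [OF bs V g]])
    have pos: "covolume ?L > 0" by (rule covolume_eq(2) [OF bs V])
    have "(\<mu> / 2) ^ d / covolume (g ` ?L) \<le> (\<mu> / 2) ^ d / ((\<mu> / 2) ^ d * covolume ?L)"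
    proof (rule divide_left_mono [OF cov])
      have "(\<mu> / 2) ^ d > 0" using \<mu> by simp
      then show "0 \<le> (\<mu> / 2) ^ d" "0 < covolume (g ` ?L) * ((\<mu> / 2) ^ d * covolume ?L)"
        using pos covolume_image(2) [OF bs V g] by simp_all
    qed
    also have "\<dots> = 1 / covolume ?L"
    proof -
      have "(\<mu> / 2) ^ d \<noteq> 0" using \<mu> by simp
      then show ?thesis by (metis divide_divide_eq_left divide_self)
    qed
    also have "\<dots> \<le> (min_dist ?L / 2) ^ d / covolume ?L"
      using min2 pos by (intro divide_right_mono) auto
    finally have "unit_ball_vol d * ((\<mu> / 2) ^ d / covolume (g ` ?L))
        \<le> unit_ball_vol d * ((min_dist ?L / 2) ^ d / covolume ?L)"
      by (intro mult_left_mono) auto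
    then show ?thesis by (simp add: packing_density_def dim_V \<mu>_def)
  qed
  then show ?thesis
    unfolding extreme_def using full_rank \<epsilon>(1) by (auto simp: V intro!: exI [of _ "\<epsilon> / 4"])
qed

end


theorem corollary5p11:
  fixes A :: "('a::finite, 'm) monoid_scheme"
  assumes "comm_group A"
    and "card (carrier A) \<ge> 7"
    and "\<not> A \<cong> integer_mod_group 4 \<times>\<times> integer_mod_group 2"
  shows "extreme (span (group_lattice A)) (group_lattice A)"
proof -
  interpret lattice_group A using assms(1) by (simp add: lattice_group_def)
  show ?thesis
    unfolding span_group_lattice by (rule extreme_group_lattice) (use assms iso_C4_C2 in auto)
qed

end
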